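(* Let $A,C,\sigma,R_a$ be positive real numbers and consider the system $$\dot x=Ayz+Cz-\sigma x,\qquad \dot y=-xz+R_a-y,\qquad \dot z=-z+xy$$ on $\mathbb{R}^3$. Let $E_0$, $E_\pm$, $R_a^*$, $R_a^{**}$ and $L(A,\sigma,C)$ be as defined in the context. Then: (i) $E_0$ is asymptotically stable if and only if $R_a<R_a^*$. (ii) Supposing $R_a>R_a^*$, $E_{\pm}$ is asymptotically stable if and only if either $L(A,\sigma,C)\le 0$, or $L(A,\sigma,C)>0$ and $R_a<R_a^{**}$.
   Context: $E_0=(0,R_a,0)$ is an equilibrium of the system. Put $$R_a^*=\frac{\sqrt{C^2+4A\sigma}-C}{2A}.$$ For $R_a>R_a^*$ the system has two further equilibria $$E_{\pm}=\left(\pm\sqrt{\eta},\frac{R_a}{\eta+1},\pm\frac{R_a\sqrt{\eta}}{\eta+1}\right),\qquad \eta=\frac{CR_a-2\sigma+R_a\sqrt{C^2+4A\sigma}}{2\sigma}.$$ Define $$\begin{aligned}L(A,\sigma,C)={}&-AC\sigma^3+3AC\sigma^2+C^3\sigma-6AC\sigma-2C^3\\&+\sqrt{4A\sigma+C^2}\,(-A\sigma^3+A\sigma^2+C^2\sigma-2A\sigma-2C^2),\\ R(A,\sigma,C)={}&C^2\sigma^3+8A\sigma^3+4C^2\sigma^2+\sqrt{4A\sigma+C^2}\,(C\sigma^3+4C\sigma^2),\end{aligned}$$ and, when $L(A,\sigma,C)>0$, $R_a^{**}=R(A,\sigma,C)/L(A,\sigma,C)$.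
   Formalization: In (i) the equivalence for asymptotic stability is stated only for R_a ≠ R_a^*, since at R_a = R_a^* E_0 is still asymptotically stable (with algebraic decay); for exponential stability it is stated for all R_a, and (ii) is stated for both notions. *)

theory Defs
  imports "HOL-Analysis.Analysis"
begin

definition solution_on :: "('a::real_normed_vector \<Rightarrow> 'a) \<Rightarrow> real set \<Rightarrow> (real \<Rightarrow> 'a) \<Rightarrow> bool" where
  "solution_on f S u \<longleftrightarrow> (\<forall>t\<in>S. (u has_vector_derivative f (u t)) (at t within S))"

text \<open>Solutions need not exist for all positive times, so stability is required along every
  solution on every compact interval starting at 0 (the value of \<open>T\<close> plays no role in the choice
  of \<open>\<delta>\<close>).  For a locally Lipschitz right-hand side this is the usual notion: solutions which
  stay in a small ball extend to all of \<open>[0, \<infinity>)\<close>.\<close>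

definition lyapunov_stable :: "('a::real_normed_vector \<Rightarrow> 'a) \<Rightarrow> 'a \<Rightarrow> bool" where
  "lyapunov_stable f e \<longleftrightarrow> f e = 0 \<and>
     (\<forall>\<epsilon>>0. \<exists>\<delta>>0. \<forall>T\<ge>0. \<forall>u. solution_on f {0..T} u \<and> dist (u 0) e < \<delta>
        \<longrightarrow> (\<forall>t\<in>{0..T}. dist (u t) e < \<epsilon>))"

definition asymptotically_stable :: "('a::real_normed_vector \<Rightarrow> 'a) \<Rightarrow> 'a \<Rightarrow> bool" where
  "asymptotically_stable f e \<longleftrightarrow> lyapunov_stable f e \<and>
     (\<exists>\<delta>>0. \<forall>u. solution_on f {0..} u \<and> dist (u 0) e < \<delta> \<longrightarrow> (u \<longlongrightarrow> e) at_top)"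

text \<open>Asymptotic stability as detected by the linearization.  It differs from
  \<open>asymptotically_stable\<close> only at non-hyperbolic equilibria: at \<open>Ra = Ra_star\<close> the origin-type
  equilibrium \<open>(0, Ra, 0)\<close> of the system below still attracts, but only at an algebraic rate.\<close>

definition exponentially_stable :: "('a::real_normed_vector \<Rightarrow> 'a) \<Rightarrow> 'a \<Rightarrow> bool" where
  "exponentially_stable f e \<longleftrightarrow> f e = 0 \<and>
     (\<exists>\<delta>>0. \<exists>K>0. \<exists>\<alpha>>0. \<forall>T\<ge>0. \<forall>u. solution_on f {0..T} u \<and> dist (u 0) e < \<delta>
        \<longrightarrow> (\<forall>t\<in>{0..T}. dist (u t) e \<le> K * exp (- \<alpha> * t) * dist (u 0) e))"

text \<open>The components 1, 2, 3 of a vector are the coordinates \<open>x\<close>, \<open>y\<close>, \<open>z\<close>.\<close>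

definition vfield :: "real \<Rightarrow> real \<Rightarrow> real \<Rightarrow> real \<Rightarrow> real^3 \<Rightarrow> real^3" where
  "vfield A C \<sigma> Ra v = (let x = v $ 1; y = v $ 2; z = v $ 3 in
     vector [A * y * z + C * z - \<sigma> * x, - x * z + Ra - y, - z + x * y])"

definition Ra_star :: "real \<Rightarrow> real \<Rightarrow> real \<Rightarrow> real" where
  "Ra_star A C \<sigma> = (sqrt (C^2 + 4 * A * \<sigma>) - C) / (2 * A)"

definition E_zero :: "real \<Rightarrow> real^3" where
  "E_zero Ra = vector [0, Ra, 0]"

definition eta :: "real \<Rightarrow> real \<Rightarrow> real \<Rightarrow> real \<Rightarrow> real" where
  "eta A C \<sigma> Ra = (C * Ra - 2 * \<sigma> + Ra * sqrt (C^2 + 4 * A * \<sigma>)) / (2 * \<sigma>)"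

definition E_plus :: "real \<Rightarrow> real \<Rightarrow> real \<Rightarrow> real \<Rightarrow> real^3" where
  "E_plus A C \<sigma> Ra = (let \<eta> = eta A C \<sigma> Ra in
     vector [sqrt \<eta>, Ra / (\<eta> + 1), Ra * sqrt \<eta> / (\<eta> + 1)])"

definition E_minus :: "real \<Rightarrow> real \<Rightarrow> real \<Rightarrow> real \<Rightarrow> real^3" where
  "E_minus A C \<sigma> Ra = (let \<eta> = eta A C \<sigma> Ra in
     vector [- sqrt \<eta>, Ra / (\<eta> + 1), - (Ra * sqrt \<eta> / (\<eta> + 1))])"

definition L_coef :: "real \<Rightarrow> real \<Rightarrow> real \<Rightarrow> real" where
  "L_coef A \<sigma> C = - A * C * \<sigma>^3 + 3 * A * C * \<sigma>^2 + C^3 * \<sigma> - 6 * A * C * \<sigma> - 2 * C^3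
     + sqrt (4 * A * \<sigma> + C^2) * (- A * \<sigma>^3 + A * \<sigma>^2 + C^2 * \<sigma> - 2 * A * \<sigma> - 2 * C^2)"

definition R_coef :: "real \<Rightarrow> real \<Rightarrow> real \<Rightarrow> real" where
  "R_coef A \<sigma> C = C^2 * \<sigma>^3 + 8 * A * \<sigma>^3 + 4 * C^2 * \<sigma>^2
     + sqrt (4 * A * \<sigma> + C^2) * (C * \<sigma>^3 + 4 * C * \<sigma>^2)"

text \<open>Only meaningful if \<open>L_coef A \<sigma> C > 0\<close>.\<close>

definition Ra_star_star :: "real \<Rightarrow> real \<Rightarrow> real \<Rightarrow> real" where
  "Ra_star_star A C \<sigma> = R_coef A \<sigma> C / L_coef A \<sigma> C"

end

theory Submission
  imports Defs
begin

text \<open>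
  Off the critical parameters the linearization decides: quadratic forms, obtained from the
  factorization of the characteristic cubic (Routh--Hurwitz) or, at \<open>E_zero\<close>, from its
  symmetric \<open>2 \<times> 2\<close> block, serve as Lyapunov and Chetaev functions.  With \<open>y = Ra_star\<close> and
  \<open>p\<^sup>2 = Ra / y - 1\<close> the Routh--Hurwitz condition at \<open>E_plus\<close> and \<open>E_minus\<close> reads
  \<open>p\<^sup>2 (\<sigma> - 2 - \<sigma> A y\<^sup>2) < (\<sigma> + 1) (\<sigma> + 2)\<close>, and \<open>L_coef\<close> is a positive multiple of
  \<open>\<sigma> - 2 - \<sigma> A y\<^sup>2\<close>.

  At \<open>Ra = Ra_star_star\<close> a pair of eigenvalues is imaginary.  There the first Lyapunov coefficient
  is always positive, i.e. the Hopf bifurcation is subcritical, and a quartic Chetaev function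
  excludes asymptotic stability.  Since solutions that witness instability have to exist for all
  times, Picard's theorem is needed for the vector field truncated outside a ball.
\<close>

section \<open>Global solutions near a stable equilibrium\<close>

text \<open>Both stability notions quantify over all solutions, so a negative result has to produce
  one. Existence is drawn from the assumption to be refuted: Lyapunov stability keeps a solution of
  the truncated field inside the ball where the truncation is invisible. At
  \<open>Ra = Ra_star\<close> there is a zero eigenvalue and only the exponential rate can be
  refuted. A left null vector of the linearization changes at a quadratic speed, so under
  exponential decay its total change is quadratic in the initial displacement, yet it would have to
  lose a linear amount. At the Hopf value the difficulty is a sign on a whole family of parameters.
  Rescaled deviations leave \<sigma>, p^2 and A y^2. The Hopf relation removes one of them, and
  \<rho> = (p^2 + 1) / \<sigma> makes everything polynomial in \<sigma> and \<rho>, so that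
  subcriticality becomes the positivity of a single polynomial on the region \<rho> (\<sigma> - 2)
  \<ge> \<sigma> + 4.\<close>

lemma bounded_lipschitz_global_solution:
  fixes g :: "'a::euclidean_space \<Rightarrow> 'a"
  assumes lip: "L-lipschitz_on UNIV g" and bd: "\<And>x. norm (g x) \<le> B"
  shows "\<exists>u. u 0 = x0 \<and> solution_on g {0..} u"
proof -
  \<comment> \<open>Twice the Lipschitz constant gives the contraction factor
    \<open>L / l \<le> 1/2\<close>; the added 1 keeps \<open>l\<close> positive when
    \<open>L = 0\<close>.\<close>
  define l where "l = 2 * L + 1"
  have L0: "L \<ge> 0" using lip by (rule lipschitz_on_nonneg)
  have l0: "l > 0" using L0 by (simp add: l_def)
  have B0: "B \<ge> 0" using bd[of 0] norm_ge_zero order_trans by blast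
  have gcont: "continuous_on UNIV g" using lip by (rule lipschitz_on_continuous_on)
  define F where "F = (\<lambda>(w :: real \<Rightarrow> 'a) s. g (x0 + exp (l * s) *\<^sub>R w s))"
  \<comment> \<open>Picard's operator for the rescaled unknown \<open>w\<close>, the solution being
    \<open>x0 + exp (l * t) *\<^sub>R w t\<close>. The exponential weight gives a contraction on the
    whole half-line at once. \<open>max 0 t\<close> extends the operator by its value at 0, because
    the complete space of bounded continuous functions used here lives on the whole line.\<close>
  define \<Phi> where "\<Phi> = (\<lambda>(w :: real \<Rightarrow> 'a) t. exp (- (l * max 0 t)) *\<^sub>R integral {0..max 0 t} (F w))"
  have Fcont: "continuous_on S (F w)" if "continuous_on UNIV w" for w S
    unfolding F_def
    by (rule continuous_on_compose2[OF gcont])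
       (auto intro!: continuous_intros continuous_on_subset[OF that])
  have Fint: "F w integrable_on {0..t}" if "continuous_on UNIV w" for w t
    by (rule integrable_continuous_real[OF Fcont[OF that]])
  have Fder: "((\<lambda>t. integral {0..t} (F w)) has_vector_derivative F w t) (at t within {0..T})"
    if "continuous_on UNIV w" "t \<in> {0..T}" for w t T
    by (rule integral_has_vector_derivative[OF Fcont[OF that(1)] that(2)])
  have Phicont: "continuous_on UNIV (\<Phi> w)" if w: "continuous_on UNIV w" for w
  proof -
    have "continuous_on {0..T} (\<lambda>t. integral {0..t} (F w))" for T
      using Fder[OF w] has_vector_derivative_continuous
      unfolding continuous_on_eq_continuous_within by blast
    then have c: "continuous_on {0..} (\<lambda>t. integral {0..t} (F w))"
    proof -
      assume a: "\<And>T. continuous_on {0..T} (\<lambda>t. integral {0..t} (F w))"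
      show ?thesis
        unfolding continuous_on_eq_continuous_within
      proof
        fix t :: real assume t: "t \<in> {0..}"
        have "continuous (at t within {0..t+1}) (\<lambda>t. integral {0..t} (F w))"
          using a[of "t+1"] t by (auto simp: continuous_on_eq_continuous_within)
        moreover have "at t within {0..t+1} = at t within {0..}"
          by (rule at_within_nhd[where S="{..<t+1}"]) auto
        ultimately show "continuous (at t within {0..}) (\<lambda>t. integral {0..t} (F w))" by simp
      qed
    qed
    have "continuous_on UNIV (\<lambda>t. integral {0..max 0 t} (F w))"
      by (rule continuous_on_compose2[OF c]) (auto intro!: continuous_intros)
    then show ?thesis unfolding \<Phi>_def by (intro continuous_intros)
  qed
  have Phibd: "norm (\<Phi> w t) \<le> B / l" if w: "continuous_on UNIV w" for w t
  proof -
    let ?t = "max 0 t"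
    have "norm (integral {0..?t} (F w)) \<le> B * (?t - 0)"
      by (rule integral_bound[OF _ Fcont[OF w]]) (auto simp: F_def bd)
    then have "norm (\<Phi> w t) \<le> exp (- (l * ?t)) * (B * ?t)"
      unfolding \<Phi>_def by (simp add: mult_left_mono)
    also have "\<dots> = B / l * ((l * ?t) / exp (l * ?t))"
      using l0 by (simp add: exp_minus field_simps)
    also have "\<dots> \<le> B / l * 1"
    proof (rule mult_left_mono)
      show "l * ?t / exp (l * ?t) \<le> 1"
        using order_trans[OF _ exp_ge_add_one_self[of "l * ?t"]] by simp
    qed (use B0 l0 in simp)
    finally show ?thesis by simp
  qed
  define \<Psi> where "\<Psi> = (\<lambda>w :: real \<Rightarrow>\<^sub>C 'a. Bcontfun (\<Phi> (apply_bcontfun w)))"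
  have Psi: "apply_bcontfun (\<Psi> w) = \<Phi> (apply_bcontfun w)" for w
    unfolding \<Psi>_def by (rule Bcontfun_inverse) (auto intro!: bcontfun_normI Phicont Phibd)
  have contr: "dist (\<Psi> v) (\<Psi> w) \<le> 1/2 * dist v w" for v w
  proof (rule dist_bound)
    fix t :: real
    let ?t = "max 0 t" and ?v = "apply_bcontfun v" and ?w = "apply_bcontfun w"
    let ?E = "\<lambda>s. L * dist v w * exp (l * s)"
    have cv: "continuous_on UNIV ?v" and cw: "continuous_on UNIV ?w" by simp_all
    have E: "(?E has_integral L * dist v w / l * exp (l * ?t) - L * dist v w / l * exp (l * 0)) {0..?t}"
      by (rule fundamental_theorem_of_calculus)
         (use l0 in \<open>auto intro!: derivative_eq_intros
            simp: has_real_derivative_iff_has_vector_derivative[symmetric]\<close>)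
    have "norm (integral {0..?t} (\<lambda>s. F ?v s - F ?w s)) \<le> integral {0..?t} ?E"
    proof (rule integral_norm_bound_integral)
      show "(\<lambda>s. F ?v s - F ?w s) integrable_on {0..?t}"
        by (intro integrable_diff Fint cv cw)
      show "?E integrable_on {0..?t}" using E by (auto simp: integrable_on_def)
      fix s assume "s \<in> {0..?t}"
      have "norm (F ?v s - F ?w s) \<le> L * dist (x0 + exp (l * s) *\<^sub>R ?v s) (x0 + exp (l * s) *\<^sub>R ?w s)"
        using lipschitz_onD[OF lip UNIV_I UNIV_I, of "x0 + exp (l * s) *\<^sub>R ?v s" "x0 + exp (l * s) *\<^sub>R ?w s"]
        unfolding F_def by (simp only: dist_norm)
      also have "\<dots> = L * (exp (l * s) * dist (?v s) (?w s))"
        by (simp add: dist_norm scaleR_diff_right[symmetric])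
      also have "\<dots> \<le> L * (exp (l * s) * dist v w)"
        by (intro mult_left_mono dist_bounded L0) auto
      finally show "norm (F ?v s - F ?w s) \<le> ?E s" by (simp add: mult_ac)
    qed
    also have "\<dots> \<le> L * dist v w / l * exp (l * ?t)"
      using integral_unique[OF E] L0 l0 by simp
    finally have i: "norm (integral {0..?t} (F ?v) - integral {0..?t} (F ?w)) \<le> L * dist v w / l * exp (l * ?t)"
      by (simp add: integral_diff Fint)
    have "dist (\<Psi> v t) (\<Psi> w t) = exp (- (l * ?t)) * norm (integral {0..?t} (F ?v) - integral {0..?t} (F ?w))"
      by (simp add: Psi \<Phi>_def dist_norm scaleR_diff_right[symmetric])
    also have "\<dots> \<le> exp (- (l * ?t)) * (L * dist v w / l * exp (l * ?t))"
      by (intro mult_left_mono i) simp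
    also have "\<dots> = L / l * dist v w" by (simp add: exp_minus)
    also have "\<dots> \<le> 1/2 * dist v w"
      by (intro mult_right_mono) (use L0 in \<open>auto simp: l_def field_simps\<close>)
    finally show "dist (\<Psi> v t) (\<Psi> w t) \<le> 1/2 * dist v w" .
  qed
  obtain W where W: "\<Psi> W = W"
    using banach_fix_type[of "1/2" \<Psi>] contr by auto
  define w where "w = apply_bcontfun W"
  have cw: "continuous_on UNIV w" by (simp add: w_def)
  have fixw: "\<Phi> w = w" using Psi[of W] W by (simp add: w_def)
  define u where "u = (\<lambda>t. x0 + exp (l * t) *\<^sub>R w t)"
  have ueq: "u t = x0 + integral {0..t} (F w)" if "t \<ge> 0" for t
  proof -
    have "w t = exp (- (l * t)) *\<^sub>R integral {0..t} (F w)"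
      using fun_cong[OF fixw, of t] that by (simp add: \<Phi>_def max_def)
    then show ?thesis by (simp add: u_def exp_minus)
  qed
  have "solution_on g {0..} u" unfolding solution_on_def
  proof
    fix t :: real assume t: "t \<in> {0..}"
    have "((\<lambda>t. x0 + integral {0..t} (F w)) has_vector_derivative 0 + F w t) (at t within {0..t+1})"
      using t by (intro derivative_intros Fder[OF cw]) auto
    then have "(u has_vector_derivative F w t) (at t within {0..t+1})"
      using t by (intro has_vector_derivative_transform[where f = "\<lambda>t. x0 + integral {0..t} (F w)" and g = u])
        (auto simp: ueq)
    moreover have "at t within {0..t+1} = at t within {0..}"
      by (rule at_within_nhd[where S="{..<t+1}"]) (use t in auto)
    ultimately show "(u has_vector_derivative g (u t)) (at t within {0..})"
      by (simp add: F_def u_def)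
  qed
  moreover have "u 0 = x0" using ueq[of 0] by simp
  ultimately show ?thesis by blast
qed

text \<open>At the first time where the distance reaches \<open>r\<close> the closed-ball bound
  still holds up to that time, so \<open>step\<close> yields a contradictory strict bound. In this
  way estimates that are valid only inside the ball become unconditional.\<close>

lemma stays_in_ball:
  fixes u :: "real \<Rightarrow> 'a::metric_space"
  assumes cont: "continuous_on {0..T} u" and u0: "dist (u 0) e < r"
    and step: "\<And>t. t \<in> {0..T} \<Longrightarrow> (\<And>s. s \<in> {0..t} \<Longrightarrow> dist (u s) e \<le> r) \<Longrightarrow> dist (u t) e < r"
    and t: "t \<in> {0..T}"
  shows "dist (u t) e < r"
proof (rule ccontr)
  assume neg: "\<not> dist (u t) e < r"
  define S where "S = {s \<in> {0..T}. dist (u s) e \<ge> r}"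
  have "closed S"
    unfolding S_def by (intro continuous_on_closed_Collect_le continuous_intros cont)
  moreover have tS: "t \<in> S" using neg t by (simp add: S_def)
  moreover have "bdd_below S" by (auto simp: S_def bdd_below_def)
  ultimately have I: "Inf S \<in> S" by (intro closed_contains_Inf) auto
  have less: "dist (u s) e < r" if "s \<in> {0..<Inf S}" for s
  proof (rule ccontr)
    assume "\<not> dist (u s) e < r"
    then have "s \<in> S" using that I by (auto simp: S_def)
    then have "Inf S \<le> s" by (rule cInf_lower) (auto simp: S_def bdd_below_def)
    then show False using that by simp
  qed
  let ?i = "Inf S"
  have i: "?i \<in> {0..T}" "dist (u ?i) e \<ge> r" using I by (auto simp: S_def)
  have ipos: "?i > 0" using i u0 by (metis atLeastAtMost_iff linorder_not_less order_le_less)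
  have "dist (u ?i) e \<le> r"
  proof (rule tendsto_upperbound)
    show "((\<lambda>s. dist (u s) e) \<longlongrightarrow> dist (u ?i) e) (at ?i within {0..<?i})"
    proof (intro tendsto_intros)
      show "(u \<longlongrightarrow> u ?i) (at ?i within {0..<?i})"
        by (rule tendsto_within_subset[of u _ _ "{0..T}"]) (use cont i(1) in \<open>auto simp: continuous_on_def\<close>)
    qed
    show "eventually (\<lambda>s. dist (u s) e \<le> r) (at ?i within {0..<?i})"
      using less by (simp add: eventually_at_filter less_imp_le)
    show "at ?i within {0..<?i} \<noteq> bot"
      using ipos by (simp add: trivial_limit_within islimpt_Ico)
  qed
  then have "dist (u s) e \<le> r" if "s \<in> {0..?i}" for s
    using less[of s] that by (cases "s = ?i") auto
  then have "dist (u ?i) e < r" using step[OF i(1)] by blast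
  then show False using i(2) by simp
qed

lemma solution_on_subset:
  assumes "solution_on f S u" and "T \<subseteq> S"
  shows "solution_on f T u"
  using assms has_vector_derivative_within_subset unfolding solution_on_def by blast

lemma solution_on_continuous:
  assumes "solution_on f S u"
  shows "continuous_on S u"
  using assms has_vector_derivative_continuous
  unfolding solution_on_def continuous_on_eq_continuous_within by blast

lemma solution_on_cong:
  assumes "solution_on f S u" and "\<And>t. t \<in> S \<Longrightarrow> f (u t) = g (u t)"
  shows "solution_on g S u"
  using assms unfolding solution_on_def by auto

text \<open>The truncation is composition with the nearest-point projection onto the ball, which is
  1-Lipschitz. As long as a solution of the truncated field is in the closed ball it solves the
  original equation on a compact interval, and stability, whose \<open>\<delta>\<close> does not
  depend on the interval, then keeps it strictly inside.\<close>

lemma lyapunov_stable_global_solution: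
  fixes f :: "'a::euclidean_space \<Rightarrow> 'a"
  assumes stab: "lyapunov_stable f e" and lip: "L-lipschitz_on (cball e r) f" and r: "r > 0"
  obtains \<delta> where "\<delta> > 0" and "\<And>x. dist x e < \<delta> \<Longrightarrow>
    \<exists>u. u 0 = x \<and> solution_on f {0..} u \<and> (\<forall>t\<ge>0. dist (u t) e < r)"
proof -
  obtain \<delta> where \<delta>: "\<delta> > 0" and *: "\<And>T u t. T \<ge> 0 \<Longrightarrow> solution_on f {0..T} u \<Longrightarrow>
      dist (u 0) e < \<delta> \<Longrightarrow> t \<in> {0..T} \<Longrightarrow> dist (u t) e < r"
    using stab r unfolding lyapunov_stable_def by meson
  define P where "P = closest_point (cball e r)"
  have P: "P x \<in> cball e r" for x
    unfolding P_def by (rule closest_point_in_set) (use r in auto)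
  have Pid: "P x = x" if "x \<in> cball e r" for x
    unfolding P_def by (rule closest_point_self[OF that])
  have "1-lipschitz_on UNIV P"
    unfolding P_def by (intro lipschitz_onI) (use r in \<open>auto intro!: closest_point_lipschitz\<close>)
  moreover have "L-lipschitz_on (P ` UNIV) f"
    using lip P by (auto intro: lipschitz_on_subset)
  ultimately have lipg: "(L * 1)-lipschitz_on UNIV (\<lambda>x. f (P x))"
    by (rule lipschitz_on_compose2)
  have "bounded (f ` cball e r)"
    by (intro compact_imp_bounded compact_continuous_image lipschitz_on_continuous_on[OF lip]) auto
  then obtain B where B: "\<And>x. x \<in> cball e r \<Longrightarrow> norm (f x) \<le> B"
    by (force simp: bounded_iff)
  show thesis
  proof (rule that)
    show "min \<delta> r > 0" using \<delta> r by simp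
    fix x assume x: "dist x e < min \<delta> r"
    obtain u where u: "u 0 = x" "solution_on (\<lambda>x. f (P x)) {0..} u"
      using bounded_lipschitz_global_solution[OF lipg, of B x] B P by blast
    have in_ball: "dist (u t) e < r" if "t \<in> {0..T}" for t T
    proof (rule stays_in_ball[OF _ _ _ that])
      show "continuous_on {0..T} u"
        using solution_on_continuous[OF u(2)] by (rule continuous_on_subset) auto
      show "dist (u 0) e < r" using x u by simp
      fix t assume t: "t \<in> {0..T}" and le: "\<And>s. s \<in> {0..t} \<Longrightarrow> dist (u s) e \<le> r"
      have "solution_on f {0..t} u"
        by (rule solution_on_cong[OF solution_on_subset[OF u(2)]])
           (use le in \<open>auto simp: Pid dist_commute\<close>)
      then show "dist (u t) e < r" using *[of t u t] t x u by auto
    qed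
    then have lt: "dist (u t) e < r" if "t \<ge> 0" for t using that by auto
    have "solution_on f {0..} u"
      by (rule solution_on_cong[OF u(2)]) (use lt in \<open>auto simp: Pid dist_commute less_imp_le\<close>)
    then show "\<exists>u. u 0 = x \<and> solution_on f {0..} u \<and> (\<forall>t\<ge>0. dist (u t) e < r)"
      using u lt by blast
  qed
qed

section \<open>Lyapunov and Chetaev functions\<close>

lemma nondecreasing_within:
  fixes \<phi> :: "real \<Rightarrow> real"
  assumes der: "\<And>t. t \<in> {0..T} \<Longrightarrow> (\<phi> has_real_derivative \<phi>' t) (at t within {0..T})"
    and nonneg: "\<And>t. t \<in> {0..T} \<Longrightarrow> \<phi>' t \<ge> 0" and T: "T \<ge> 0"
  shows "\<phi> 0 \<le> \<phi> T"
proof (rule DERIV_nonneg_imp_increasing_open[OF T])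
  show "continuous_on {0..T} \<phi>"
    using der DERIV_continuous continuous_on_eq_continuous_within by blast
  fix t assume t: "0 < t" "t < T"
  then have "at t within {0..T} = at t" by (intro at_within_interior) simp
  then show "\<exists>y. DERIV \<phi> t :> y \<and> y \<ge> 0"
    using der[of t] nonneg[of t] t by auto
qed

lemma has_real_derivative_along_solution:
  assumes "solution_on f S u" and "\<And>x. (V has_derivative V' x) (at x)" and "t \<in> S"
  shows "((\<lambda>t. V (u t)) has_real_derivative V' (u t) (f (u t))) (at t within S)"
proof -
  have "(u has_derivative (\<lambda>h. h *\<^sub>R f (u t))) (at t within S)"
    using assms(1,3) by (simp add: solution_on_def has_vector_derivative_def)
  then have "((\<lambda>t. V (u t)) has_derivative (\<lambda>h. V' (u t) (h *\<^sub>R f (u t)))) (at t within S)"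
    by (rule has_derivative_compose) (rule assms(2))
  moreover have "linear (V' (u t))" using assms(2) has_derivative_linear by blast
  ultimately show ?thesis
    by (simp add: has_field_derivative_def linear_scale mult.commute[of _ "V' (u t) (f (u t))"])
qed

lemma exp_decay_tendsto_0:
  fixes a c d :: real
  assumes "c < 0"
  shows "((\<lambda>t. a * exp (c * t) * d) \<longlongrightarrow> 0) at_top"
proof -
  have "((\<lambda>t. a * exp (c * t) * d) \<longlongrightarrow> a * 0 * d) at_top"
    by (intro tendsto_intros filterlim_compose[OF exp_at_bot]
          filterlim_tendsto_neg_mult_at_bot[OF tendsto_const assms filterlim_ident])
  then show ?thesis by simp
qed

lemma tendsto_of_exp_bound:
  assumes "c < 0" and "\<And>t. t \<ge> 0 \<Longrightarrow> dist (u t) e \<le> a * exp (c * t) * d"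
  shows "(u \<longlongrightarrow> e) at_top"
proof (rule tendsto_dist_iff[THEN iffD2], rule tendsto_sandwich[OF _ _ tendsto_const exp_decay_tendsto_0[OF assms(1)]])
  show "eventually (\<lambda>t. dist (u t) e \<le> a * exp (c * t) * d) at_top"
    using assms(2) by (rule eventually_at_top_linorderI)
qed simp

lemma exponentially_stable_imp_asymptotically_stable:
  assumes "exponentially_stable f e"
  shows "asymptotically_stable f e"
proof -
  obtain \<delta> K \<alpha> where fe: "f e = 0" and pos: "\<delta> > 0" "K > 0" "\<alpha> > 0" and
    *: "\<And>T u t. T \<ge> 0 \<Longrightarrow> solution_on f {0..T} u \<Longrightarrow> dist (u 0) e < \<delta> \<Longrightarrow> t \<in> {0..T} \<Longrightarrow>
      dist (u t) e \<le> K * exp (- \<alpha> * t) * dist (u 0) e"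
    using assms unfolding exponentially_stable_def by metis
  have "lyapunov_stable f e" unfolding lyapunov_stable_def
  proof (intro conjI fe allI impI)
    fix \<epsilon> :: real assume \<epsilon>: "\<epsilon> > 0"
    show "\<exists>\<delta>>0. \<forall>T\<ge>0. \<forall>u. solution_on f {0..T} u \<and> dist (u 0) e < \<delta> \<longrightarrow>
      (\<forall>t\<in>{0..T}. dist (u t) e < \<epsilon>)"
    proof (intro exI[of _ "min \<delta> (\<epsilon> / K)"] conjI allI impI ballI)
      fix T u t assume T: "0 \<le> T" and u: "solution_on f {0..T} u \<and> dist (u 0) e < min \<delta> (\<epsilon> / K)"
        and t: "t \<in> {0..T}"
      have "dist (u t) e \<le> K * exp (- \<alpha> * t) * dist (u 0) e" using * T u t by auto
      also have "\<dots> \<le> K * 1 * dist (u 0) e"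
        using pos t by (intro mult_right_mono mult_left_mono) auto
      also have "\<dots> < \<epsilon>" using u pos by (simp add: field_simps)
      finally show "dist (u t) e < \<epsilon>" .
    qed (use pos \<epsilon> in auto)
  qed
  moreover have "(u \<longlongrightarrow> e) at_top" if u: "solution_on f {0..} u" "dist (u 0) e < \<delta>" for u
  proof -
    have le: "dist (u t) e \<le> K * exp (- \<alpha> * t) * dist (u 0) e" if "t \<ge> 0" for t
      using *[OF that solution_on_subset[OF u(1)], of t] that u(2) by auto
    show ?thesis by (rule tendsto_of_exp_bound[OF _ le]) (use pos in simp)
  qed
  ultimately show ?thesis unfolding asymptotically_stable_def using pos by blast
qed

text \<open>While the solution is in the ball, \<open>exp (2 * \<alpha> * t) * V\<close> does not
  increase, and the two quadratic bounds convert this into decay of the distance with the constant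
  \<open>k = sqrt (M / m)\<close>. Starting closer than \<open>r / k\<close> guarantees that the
  ball is never left.\<close>

lemma lyapunov_function_exponentially_stable:
  fixes f :: "'a::real_normed_vector \<Rightarrow> 'a" and V :: "'a \<Rightarrow> real"
  assumes fe: "f e = 0" and V: "\<And>x. (V has_derivative V' x) (at x)"
    and pos: "r > 0" "m > 0" "M > 0" "\<alpha> > 0"
    and lower: "\<And>x. dist x e \<le> r \<Longrightarrow> m * (dist x e)\<^sup>2 \<le> V x"
    and upper: "\<And>x. dist x e \<le> r \<Longrightarrow> V x \<le> M * (dist x e)\<^sup>2"
    and decay: "\<And>x. dist x e \<le> r \<Longrightarrow> V' x (f x) \<le> - 2 * \<alpha> * V x"
  shows "exponentially_stable f e"
proof -
  define k where "k = sqrt (M / m)"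
  have k: "k > 0" "k\<^sup>2 = M / m" using pos by (simp_all add: k_def)
  have main: "dist (u t) e \<le> k * exp (- \<alpha> * t) * dist (u 0) e"
    if u: "solution_on f {0..T} u" and u0: "dist (u 0) e < min r (r / k)" and t: "t \<in> {0..T}" for T u t
  proof -
    have bound: "dist (u t) e \<le> k * exp (- \<alpha> * t) * dist (u 0) e"
      if t: "t \<in> {0..T}" and le: "\<And>s. s \<in> {0..t} \<Longrightarrow> dist (u s) e \<le> r" for t
    proof -
      have ut: "solution_on f {0..t} u" using u by (rule solution_on_subset) (use t in auto)
      define \<phi> where "\<phi> = (\<lambda>s. - (exp (2 * \<alpha> * s) * V (u s)))"
      have "\<phi> 0 \<le> \<phi> t"
      proof (rule nondecreasing_within)
        fix s assume s: "s \<in> {0..t}"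
        show "(\<phi> has_real_derivative
            exp (2 * \<alpha> * s) * (- V' (u s) (f (u s)) - 2 * \<alpha> * V (u s))) (at s within {0..t})"
          unfolding \<phi>_def
          by (rule derivative_eq_intros has_real_derivative_along_solution[OF ut V s] refl | simp)+
             (simp add: algebra_simps)
        show "0 \<le> exp (2 * \<alpha> * s) * (- V' (u s) (f (u s)) - 2 * \<alpha> * V (u s))"
          using decay[OF le[OF s]] by simp
      qed (use t in simp)
      then have "exp (2 * \<alpha> * t) * V (u t) \<le> V (u 0)" by (simp add: \<phi>_def)
      then have "exp (2 * \<alpha> * t) * (m * (dist (u t) e)\<^sup>2) \<le> M * (dist (u 0) e)\<^sup>2"
        using lower[OF le[of t]] upper[OF le[of 0]] t
        by (smt (verit) atLeastAtMost_iff exp_gt_zero mult_left_mono)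
      then have "(exp (\<alpha> * t) * dist (u t) e)\<^sup>2 \<le> (k * dist (u 0) e)\<^sup>2"
      proof -
        assume le: "exp (2 * \<alpha> * t) * (m * (dist (u t) e)\<^sup>2) \<le> M * (dist (u 0) e)\<^sup>2"
        have "M = m * k\<^sup>2" using k pos by simp
        then have "m * (exp (\<alpha> * t) * dist (u t) e)\<^sup>2 \<le> m * (k * dist (u 0) e)\<^sup>2"
          using le exp_double[of "\<alpha> * t"] by (simp add: power_mult_distrib mult_ac)
        then show ?thesis using pos by simp
      qed
      then have "exp (\<alpha> * t) * dist (u t) e \<le> k * dist (u 0) e"
        by (rule power2_le_imp_le) (use k in simp)
      then show ?thesis by (simp add: exp_minus field_simps)
    qed
    have in_ball: "dist (u t) e < r" if "t \<in> {0..T}" for t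
    proof (rule stays_in_ball[OF solution_on_continuous[OF u] _ _ that])
      show "dist (u 0) e < r" using u0 by simp
      fix t assume t: "t \<in> {0..T}" and le: "\<And>s. s \<in> {0..t} \<Longrightarrow> dist (u s) e \<le> r"
      have "dist (u t) e \<le> k * exp (- \<alpha> * t) * dist (u 0) e" using bound[OF t le] .
      also have "\<dots> \<le> k * 1 * dist (u 0) e"
        using pos t k by (intro mult_right_mono mult_left_mono) auto
      also have "\<dots> < r" using u0 k by (simp add: field_simps)
      finally show "dist (u t) e < r" .
    qed
    show ?thesis using bound[OF t] in_ball t by (force intro: less_imp_le)
  qed
  show ?thesis unfolding exponentially_stable_def
    using fe main k pos by (intro conjI exI[of _ "min r (r / k)"] exI[of _ k] exI[of _ \<alpha>]) auto
qed

text \<open>Weak growth suffices: convergence to \<open>e\<close> sends \<open>V\<close> along the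
  solution to \<open>V e = 0\<close>, although \<open>V\<close> starts positive and never decreases.
  What is refuted is attraction; Lyapunov stability enters only to provide the global
  solution.\<close>

lemma chetaev_not_asymptotically_stable:
  fixes f :: "'a::euclidean_space \<Rightarrow> 'a" and V :: "'a \<Rightarrow> real"
  assumes Ve: "V e = 0" and V: "\<And>x. (V has_derivative V' x) (at x)"
    and r: "r > 0" and lip: "L-lipschitz_on (cball e r) f"
    and grow: "\<And>x. dist x e < r \<Longrightarrow> V' x (f x) \<ge> 0"
    and pos: "\<And>\<delta>. \<delta> > 0 \<Longrightarrow> \<exists>x. dist x e < \<delta> \<and> V x > 0"
  shows "\<not> asymptotically_stable f e"
proof
  assume as: "asymptotically_stable f e"
  then have "lyapunov_stable f e" by (simp add: asymptotically_stable_def)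
  then obtain \<delta> where \<delta>: "\<delta> > 0" and ex: "\<And>x. dist x e < \<delta> \<Longrightarrow>
      \<exists>u. u 0 = x \<and> solution_on f {0..} u \<and> (\<forall>t\<ge>0. dist (u t) e < r)"
    using lyapunov_stable_global_solution[OF _ lip r] by metis
  obtain \<delta>' where \<delta>': "\<delta>' > 0" and conv: "\<And>u. solution_on f {0..} u \<Longrightarrow> dist (u 0) e < \<delta>' \<Longrightarrow> (u \<longlongrightarrow> e) at_top"
    using as unfolding asymptotically_stable_def by blast
  obtain x where x: "dist x e < min \<delta> \<delta>'" "V x > 0" using pos[of "min \<delta> \<delta>'"] \<delta> \<delta>' by auto
  obtain u where u: "u 0 = x" "solution_on f {0..} u" "\<And>t. t \<ge> 0 \<Longrightarrow> dist (u t) e < r"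
    using ex x by auto
  have "V x \<le> V (u t)" if "t \<ge> 0" for t
    using nondecreasing_within[OF has_real_derivative_along_solution[OF solution_on_subset[OF u(2)] V]]
      grow u that by fastforce
  moreover have "((\<lambda>t. V (u t)) \<longlongrightarrow> V e) at_top"
    by (rule isCont_tendsto_compose[OF has_derivative_continuous[OF V]]) (use conv u x in auto)
  ultimately have "V x \<le> V e"
    by (intro tendsto_lowerbound[of "\<lambda>t. V (u t)" _ at_top]) (auto intro: eventually_at_top_linorderI[of 0])
  then show False using x Ve by simp
qed

text \<open>\<open>\<psi>\<close> stands for a left eigenvector of the linearization for the
  eigenvalue 0, so its speed is quadratic in the distance. Under exponential decay the integrated
  speed is of second order in the initial displacement, which cannot bring a first-order value of
  \<open>\<psi>\<close> down to 0.\<close>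

lemma zero_eigenvalue_not_exponentially_stable:
  fixes f :: "'a::euclidean_space \<Rightarrow> 'a" and \<psi> :: "'a \<Rightarrow> real"
  assumes r: "r > 0" and lip: "L-lipschitz_on (cball e r) f"
    and lin: "bounded_linear \<psi>" and nz: "\<psi> h \<noteq> 0"
    and quad: "\<And>x. dist x e < r \<Longrightarrow> \<bar>\<psi> (f x)\<bar> \<le> M * (dist x e)\<^sup>2"
  shows "\<not> exponentially_stable f e"
proof
  assume es: "exponentially_stable f e"
  interpret \<psi>: bounded_linear \<psi> by (rule lin)
  have as: "asymptotically_stable f e" by (rule exponentially_stable_imp_asymptotically_stable[OF es])
  then have "lyapunov_stable f e" by (simp add: asymptotically_stable_def)
  then obtain \<delta> where \<delta>: "\<delta> > 0" and ex: "\<And>x. dist x e < \<delta> \<Longrightarrow>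
      \<exists>u. u 0 = x \<and> solution_on f {0..} u \<and> (\<forall>t\<ge>0. dist (u t) e < r)"
    using lyapunov_stable_global_solution[OF _ lip r] by metis
  obtain \<delta>' K \<alpha> where pos: "\<delta>' > 0" "K > 0" "\<alpha> > 0" and
    decay: "\<And>T u t. T \<ge> 0 \<Longrightarrow> solution_on f {0..T} u \<Longrightarrow> dist (u 0) e < \<delta>' \<Longrightarrow> t \<in> {0..T} \<Longrightarrow>
      dist (u t) e \<le> K * exp (- \<alpha> * t) * dist (u 0) e"
    using es unfolding exponentially_stable_def by metis
  \<comment> \<open>The factor \<open>1 / (2 * \<alpha>)\<close> is the integral of
    \<open>exp (- 2 * \<alpha> * t)\<close> over the half-line; \<open>\<bar>M\<bar> + 1\<close>
    replaces \<open>M\<close> to make \<open>k\<close> positive.\<close>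
  define k where "k = (\<bar>M\<bar> + 1) * K\<^sup>2 / (2 * \<alpha>)"
  have kpos: "k > 0" using pos by (simp add: k_def)
  define h' where "h' = (if \<psi> h > 0 then h else - h)"
  have h': "\<psi> h' > 0" using nz by (auto simp: h'_def \<psi>.neg)
  then have h'0: "h' \<noteq> 0" by (auto simp: \<psi>.zero)
  have "eventually (\<lambda>\<epsilon>::real. \<epsilon> * norm h' < min \<delta> \<delta>' \<and> \<epsilon> * (k * (norm h')\<^sup>2) < \<psi> h') (at_right 0)"
  proof (intro eventually_conj order_tendstoD)
    show "((\<lambda>\<epsilon>. \<epsilon> * norm h') \<longlongrightarrow> 0 * norm h') (at_right 0)"
         "((\<lambda>\<epsilon>. \<epsilon> * (k * (norm h')\<^sup>2)) \<longlongrightarrow> 0 * (k * (norm h')\<^sup>2)) (at_right 0)"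
      by (intro tendsto_intros)+
  qed (use \<delta> pos h' in auto)
  then have "eventually (\<lambda>\<epsilon>::real. 0 < \<epsilon> \<and> \<epsilon> * norm h' < min \<delta> \<delta>' \<and> \<epsilon> * (k * (norm h')\<^sup>2) < \<psi> h') (at_right 0)"
    using eventually_at_right_less by eventually_elim auto
  then obtain \<epsilon> :: real where \<epsilon>: "\<epsilon> > 0" "\<epsilon> * norm h' < min \<delta> \<delta>'" "\<epsilon> * (k * (norm h')\<^sup>2) < \<psi> h'"
    using eventually_happens by force
  define x where "x = e + \<epsilon> *\<^sub>R h'"
  have d: "dist x e = \<epsilon> * norm h'" using \<epsilon> by (simp add: x_def dist_norm)
  obtain u where u: "u 0 = x" "solution_on f {0..} u" "\<And>t. t \<ge> 0 \<Longrightarrow> dist (u t) e < r"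
    using ex[of x] d \<epsilon> by auto
  have ule: "dist (u t) e \<le> K * exp (- \<alpha> * t) * dist x e" if "t \<ge> 0" for t
    using decay[OF that solution_on_subset[OF u(2)]] u(1) d \<epsilon> that by auto
  define D where "D = k * (dist x e)\<^sup>2"
  \<comment> \<open>The second term has a derivative that dominates the speed of
    \<open>\<psi>\<close>, so \<open>\<phi>\<close> is nondecreasing with limit 0. Hence
    \<open>\<phi> 0 \<le> 0\<close>, against the choice of \<open>\<epsilon>\<close>.\<close>
  define \<phi> where "\<phi> = (\<lambda>t. \<psi> (u t - e) - D * exp (- 2 * \<alpha> * t))"
  have mono: "\<phi> 0 \<le> \<phi> T" if T: "T \<ge> 0" for T
  proof (rule nondecreasing_within[OF _ _ T])
    fix t assume t: "t \<in> {0..T}"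
    show "(\<phi> has_real_derivative \<psi> (f (u t)) + 2 * \<alpha> * D * exp (- 2 * \<alpha> * t)) (at t within {0..T})"
    proof -
      have "((\<lambda>t. \<psi> (u t - e)) has_real_derivative \<psi> (f (u t))) (at t within {0..T})"
        by (rule has_real_derivative_along_solution[where V = "\<lambda>x. \<psi> (x - e)" and V' = "\<lambda>x. \<psi>",
              OF solution_on_subset[OF u(2)] _ t])
           (auto intro!: derivative_eq_intros bounded_linear.has_derivative[OF lin] simp: \<psi>.diff \<psi>.zero)
      then show ?thesis unfolding \<phi>_def by (auto intro!: derivative_eq_intros)
    qed
    have "\<bar>\<psi> (f (u t))\<bar> \<le> (\<bar>M\<bar> + 1) * (dist (u t) e)\<^sup>2"
      using quad[OF u(3), of t] t by (smt (verit) atLeastAtMost_iff mult_right_mono zero_le_power2)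
    also have "\<dots> \<le> (\<bar>M\<bar> + 1) * (K * exp (- \<alpha> * t) * dist x e)\<^sup>2"
      using ule[of t] t by (intro mult_left_mono power_mono) auto
    also have "\<dots> = 2 * \<alpha> * D * exp (- 2 * \<alpha> * t)"
      using pos by (simp add: D_def k_def power_mult_distrib exp_double[symmetric])
    finally show "0 \<le> \<psi> (f (u t)) + 2 * \<alpha> * D * exp (- 2 * \<alpha> * t)" by linarith
  qed
  have "(u \<longlongrightarrow> e) at_top"
    by (rule tendsto_of_exp_bound[OF _ ule]) (use pos in simp)
  then have "((\<lambda>t. \<psi> (u t - e)) \<longlongrightarrow> \<psi> (e - e)) at_top"
    by (intro \<psi>.tendsto tendsto_intros)
  moreover have "((\<lambda>t. D * exp (- 2 * \<alpha> * t) * 1) \<longlongrightarrow> 0) at_top"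
    by (rule exp_decay_tendsto_0) (use pos in simp)
  ultimately have "(\<phi> \<longlongrightarrow> \<psi> (e - e) - 0) at_top"
    unfolding \<phi>_def mult_1_right by (rule tendsto_diff)
  then have "\<phi> 0 \<le> \<psi> (e - e) - 0"
    by (rule tendsto_lowerbound) (auto intro: eventually_at_top_linorderI[of 0] mono)
  moreover have "\<phi> 0 = \<epsilon> * (\<psi> h' - \<epsilon> * (k * (norm h')\<^sup>2))"
    by (simp add: \<phi>_def u(1) D_def d) (simp add: x_def \<psi>.scaleR power2_eq_square algebra_simps)
  ultimately show False using \<epsilon> by (simp add: \<psi>.zero mult_le_0_iff)
qed

section \<open>Quadratic forms and the linearization\<close>

lemma bounded_bilinear_add_fun:
  assumes "bounded_bilinear B" and "bounded_bilinear B'"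
  shows "bounded_bilinear (\<lambda>a b. B a b + B' a b)"
proof -
  interpret B: bounded_bilinear B by fact
  interpret B': bounded_bilinear B' by fact
  obtain K K' where "\<And>a b. norm (B a b) \<le> norm a * norm b * K" "\<And>a b. norm (B' a b) \<le> norm a * norm b * K'"
    using B.bounded B'.bounded by blast
  then have "norm (B a b + B' a b) \<le> norm a * norm b * (K + K')" for a b
    by (metis (no_types) add_mono distrib_left norm_triangle_le)
  then show ?thesis
    by unfold_locales
       (auto simp: B.add_left B.add_right B'.add_left B'.add_right B.scaleR_left B.scaleR_right
         B'.scaleR_left B'.scaleR_right scaleR_add_right)
qed

lemma bounded_bilinear_positive_definite:
  fixes B :: "'a::euclidean_space \<Rightarrow> 'a \<Rightarrow> real"
  assumes B: "bounded_bilinear B" and pos: "\<And>h. h \<noteq> 0 \<Longrightarrow> B h h > 0"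
  obtains m where "m > 0" and "\<And>h. m * (norm h)\<^sup>2 \<le> B h h"
proof -
  interpret B: bounded_bilinear B by (rule B)
  have "continuous_on (sphere 0 1) (\<lambda>h. B h h)"
    by (intro B.continuous_on continuous_intros)
  then obtain h0 where h0: "h0 \<in> sphere 0 1" "\<And>h. h \<in> sphere 0 1 \<Longrightarrow> B h0 h0 \<le> B h h"
    using continuous_attains_inf[of "sphere (0::'a) 1" "\<lambda>h. B h h"] by auto
  show thesis
  proof (rule that[of "B h0 h0"])
    show "B h0 h0 > 0" using h0(1) by (intro pos) auto
    fix h :: 'a
    show "B h0 h0 * (norm h)\<^sup>2 \<le> B h h"
    proof (cases "h = 0")
      case False
      have "B h0 h0 * (norm h)\<^sup>2 \<le> B (sgn h) (sgn h) * (norm h)\<^sup>2"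
        by (intro mult_right_mono h0(2)) (use False in \<open>auto simp: norm_sgn\<close>)
      also have "\<dots> = B (norm h *\<^sub>R sgn h) (norm h *\<^sub>R sgn h)"
        by (simp add: B.scaleR_left B.scaleR_right power2_eq_square)
      also have "norm h *\<^sub>R sgn h = h" using False by (simp add: sgn_div_norm)
      finally show ?thesis .
    qed (simp add: B.zero_left)
  qed
qed

text \<open>The remainder of \<open>f\<close> after its linearization contributes only \<open>o(\<bar>h\<bar>\<^sup>2)\<close> to the derivative of
  \<open>B h h\<close>.\<close>

lemma quadratic_form_derivative_lower_bound:
  fixes f :: "'a::euclidean_space \<Rightarrow> 'a" and B :: "'a \<Rightarrow> 'a \<Rightarrow> real"
  assumes fe: "f e = 0" and J: "(f has_derivative J) (at e)" and B: "bounded_bilinear B"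
    and pos: "\<And>h. h \<noteq> 0 \<Longrightarrow> B h (J h) + B (J h) h > 0"
  obtains r c where "r > 0" and "c > 0" and
    "\<And>x. dist x e \<le> r \<Longrightarrow> c * (dist x e)\<^sup>2 \<le> B (x - e) (f x) + B (f x) (x - e)"
proof -
  interpret B: bounded_bilinear B by (rule B)
  have linJ: "bounded_linear J" using J by (rule has_derivative_bounded_linear)
  have "bounded_bilinear (\<lambda>h k. B h (J k) + B (J h) k)"
    by (intro bounded_bilinear_add_fun bounded_bilinear.comp[OF B] bounded_linear_ident linJ)
  then obtain c where c: "c > 0" "\<And>h. c * (norm h)\<^sup>2 \<le> B h (J h) + B (J h) h"
    using bounded_bilinear_positive_definite pos by (metis (no_types, lifting))
  obtain K where K: "K > 0" "\<And>a b. norm (B a b) \<le> norm a * norm b * K" using B.pos_bounded by blast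
  \<comment> \<open>Each of the two terms of \<open>B\<close> containing the remainder then costs at
    most a quarter of \<open>c\<close>, so half of \<open>c\<close> survives.\<close>
  have "c / (4 * K) > 0" using c K by simp
  then obtain d where d: "d > 0" and
    rem: "\<And>x. norm (x - e) < d \<Longrightarrow> norm (f x - f e - J (x - e)) \<le> c / (4 * K) * norm (x - e)"
    using J unfolding has_derivative_at_alt by meson
  show thesis
  proof (rule that[of "d / 2" "c / 2"])
    fix x assume x: "dist x e \<le> d / 2"
    let ?h = "x - e" and ?R = "f x - J (x - e)"
    have R: "norm ?R \<le> c / (4 * K) * norm ?h" using rem[of x] x d fe by (simp add: dist_norm)
    have "\<bar>B ?h ?R\<bar> \<le> norm ?h * norm ?R * K" "\<bar>B ?R ?h\<bar> \<le> norm ?R * norm ?h * K"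
      using K(2)[of ?h ?R] K(2)[of ?R ?h] by simp_all
    moreover have "norm ?h * norm ?R * K \<le> norm ?h * (c / (4 * K) * norm ?h) * K"
      using R K by (intro mult_right_mono mult_left_mono) auto
    ultimately have "\<bar>B ?h ?R\<bar> + \<bar>B ?R ?h\<bar> \<le> c / 2 * (norm ?h)\<^sup>2"
    proof -
      assume "\<bar>B ?h ?R\<bar> \<le> norm ?h * norm ?R * K" "\<bar>B ?R ?h\<bar> \<le> norm ?R * norm ?h * K"
        "norm ?h * norm ?R * K \<le> norm ?h * (c / (4 * K) * norm ?h) * K"
      moreover have "norm ?R * norm ?h * K = norm ?h * norm ?R * K"
        "norm ?h * (c / (4 * K) * norm ?h) * K = c / 4 * (norm ?h)\<^sup>2"
        using K by (simp_all add: power2_eq_square)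
      ultimately show ?thesis by linarith
    qed
    moreover have "B ?h (f x) + B (f x) ?h = (B ?h (J ?h) + B (J ?h) ?h) + (B ?h ?R + B ?R ?h)"
      by (simp add: B.diff_left B.diff_right)
    ultimately show "c / 2 * (dist x e)\<^sup>2 \<le> B ?h (f x) + B (f x) ?h"
      using c(2)[of ?h] by (simp add: dist_norm)
  qed (use c d in auto)
qed

lemma has_derivative_quadratic_form:
  fixes B :: "'a::real_normed_vector \<Rightarrow> 'a \<Rightarrow> real"
  assumes "bounded_bilinear B"
  shows "((\<lambda>x. B (x - e) (x - e)) has_derivative (\<lambda>k. B (x - e) k + B k (x - e))) (at x)"
  by (rule bounded_bilinear.FDERIV[OF assms]) (auto intro!: derivative_eq_intros)

lemma quadratic_lyapunov_exponentially_stable: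
  fixes f :: "'a::euclidean_space \<Rightarrow> 'a" and B :: "'a \<Rightarrow> 'a \<Rightarrow> real"
  assumes fe: "f e = 0" and J: "(f has_derivative J) (at e)" and B: "bounded_bilinear B"
    and pos: "\<And>h. h \<noteq> 0 \<Longrightarrow> B h h > 0"
    and neg: "\<And>h. h \<noteq> 0 \<Longrightarrow> B h (J h) + B (J h) h < 0"
  shows "exponentially_stable f e"
proof -
  interpret B: bounded_bilinear B by (rule B)
  obtain m where m: "m > 0" "\<And>h. m * (norm h)\<^sup>2 \<le> B h h"
    using bounded_bilinear_positive_definite[OF B pos] by blast
  obtain M where M: "M > 0" "\<And>a b. norm (B a b) \<le> norm a * norm b * M" using B.pos_bounded by blast
  have M': "B h h \<le> M * (norm h)\<^sup>2" for h
    using M(2)[of h h] by (simp add: power2_eq_square mult_ac)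
  have "bounded_bilinear (\<lambda>a b. - B a b)"
    using bounded_bilinear.comp[OF B bounded_linear_minus[OF bounded_linear_ident] bounded_linear_ident]
    by (simp add: B.minus_left)
  moreover have "- B h (J h) + - B (J h) h > 0" if "h \<noteq> 0" for h using neg[OF that] by linarith
  ultimately obtain r c where r: "r > 0" "c > 0" and
    c: "\<And>x. dist x e \<le> r \<Longrightarrow> c * (dist x e)\<^sup>2 \<le> - B (x - e) (f x) + - B (f x) (x - e)"
    using quadratic_form_derivative_lower_bound[OF fe J, of "\<lambda>a b. - B a b"] by metis
  show ?thesis
  proof (rule lyapunov_function_exponentially_stable[where f = f and e = e and V = "\<lambda>x. B (x - e) (x - e)"
          and V' = "\<lambda>x k. B (x - e) k + B k (x - e)",
        OF fe has_derivative_quadratic_form[OF B] r(1) m(1) M(1)])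
    \<comment> \<open>The derivative is at most \<open>- c\<close> times the squared distance, and
      the squared distance is at least \<open>1 / M\<close> times the form; this is decay of the
      form at the rate \<open>c / M\<close>, twice that of the distance.\<close>
    show "c / (2 * M) > 0" using r M by simp
    fix x assume x: "dist x e \<le> r"
    show "m * (dist x e)\<^sup>2 \<le> B (x - e) (x - e)" "B (x - e) (x - e) \<le> M * (dist x e)\<^sup>2"
      using m(2) M' by (simp_all add: dist_norm)
    have "c / M * B (x - e) (x - e) \<le> c / M * (M * (norm (x - e))\<^sup>2)"
      by (intro mult_left_mono M') (use r M in simp)
    then show "B (x - e) (f x) + B (f x) (x - e) \<le> - 2 * (c / (2 * M)) * B (x - e) (x - e)"
      using c[OF x] M(1) by (simp add: dist_norm)
  qed
qed

text \<open>Growth of the form along the linear flow dominates the remainder in a small ball, and by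
  homogeneity the ray through \<open>v\<close> meets the set where the form is positive arbitrarily
  close to \<open>e\<close>.\<close>

lemma quadratic_chetaev_not_asymptotically_stable:
  fixes f :: "'a::euclidean_space \<Rightarrow> 'a" and B :: "'a \<Rightarrow> 'a \<Rightarrow> real"
  assumes fe: "f e = 0" and J: "(f has_derivative J) (at e)" and B: "bounded_bilinear B"
    and lip: "\<And>R. \<exists>L. L-lipschitz_on (cball e R) f"
    and grow: "\<And>h. h \<noteq> 0 \<Longrightarrow> B h (J h) + B (J h) h > 0"
    and pos: "B v v > 0"
  shows "\<not> asymptotically_stable f e"
proof -
  interpret B: bounded_bilinear B by (rule B)
  obtain r c where r: "r > 0" "c > 0" and
    c: "\<And>x. dist x e \<le> r \<Longrightarrow> c * (dist x e)\<^sup>2 \<le> B (x - e) (f x) + B (f x) (x - e)"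
    using quadratic_form_derivative_lower_bound[OF fe J B grow] by blast
  obtain L where L: "L-lipschitz_on (cball e r) f" using lip by blast
  have v: "v \<noteq> 0" using pos by (auto simp: B.zero_left)
  show ?thesis
  proof (rule chetaev_not_asymptotically_stable[where f = f and e = e and V = "\<lambda>x. B (x - e) (x - e)"
          and V' = "\<lambda>x k. B (x - e) k + B k (x - e)",
        OF _ has_derivative_quadratic_form[OF B] r(1) L])
    show "B (x - e) (f x) + B (f x) (x - e) \<ge> 0" if "dist x e < r" for x
      using c[of x] that r by (smt (verit) mult_nonneg_nonneg zero_le_power2)
    fix \<delta> :: real assume \<delta>: "\<delta> > 0"
    let ?t = "\<delta> / (2 * norm v)"
    show "\<exists>x. dist x e < \<delta> \<and> B (x - e) (x - e) > 0"
      using \<delta> v pos by (intro exI[of _ "e + ?t *\<^sub>R v"]) (auto simp: dist_norm B.scaleR_left B.scaleR_right)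
  qed (simp add: B.zero_left)
qed

section \<open>Cubic characteristic polynomials\<close>

text \<open>X^3 + a X^2 + b X + c has a negative root \<open>- \<nu>\<close>: \<open>p x\<close> is
  minus its value at \<open>- x\<close>, negative at 0 and positive at \<open>1 + a + b + c\<close>.
  Division by X + \<nu> leaves X^2 - \<beta> X + \<gamma>.\<close>

lemma cubic_factorization:
  fixes a b c :: real
  assumes "a > 0" "b > 0" "c > 0"
  obtains \<nu> \<beta> \<gamma> where "\<nu> > 0" "\<gamma> > 0" "a = \<nu> - \<beta>" "b = \<gamma> - \<nu> * \<beta>" "c = \<nu> * \<gamma>"
proof -
  define p where "p = (\<lambda>x. x ^ 3 - a * x\<^sup>2 + b * x - c)"
  let ?x = "1 + a + b + c"
  have "p ?x > 0"
  proof -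
    have "?x * ?x \<ge> 1 * 1" using assms by (intro mult_mono) auto
    then have "c \<le> c * (?x * ?x)" using assms by simp
    moreover have "p ?x = (1 + b) * (?x * ?x) + (c * (?x * ?x) - c) + b * ?x"
      by (simp add: p_def power2_eq_square power3_eq_cube algebra_simps)
    moreover have "(1 + b) * (?x * ?x) > 0" "b * ?x > 0" using assms by auto
    ultimately show ?thesis by linarith
  qed
  moreover have "continuous_on {0..?x} p" unfolding p_def by (intro continuous_intros)
  ultimately obtain \<nu> where \<nu>: "0 \<le> \<nu>" "p \<nu> = 0"
    using IVT'[of p 0 0 ?x] assms by (auto simp: p_def)
  have \<nu>0: "\<nu> > 0" using \<nu> assms by (cases "\<nu> = 0") (auto simp: p_def)
  show thesis
  proof (rule that[of \<nu> "c / \<nu>" "\<nu> - a"])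
    have "\<nu> * (c / \<nu> - \<nu> * (\<nu> - a)) = \<nu> * b"
      using \<nu> \<nu>0 by (simp add: p_def power2_eq_square power3_eq_cube algebra_simps)
    then show "b = c / \<nu> - \<nu> * (\<nu> - a)" using \<nu>0 by simp
  qed (use \<nu>0 assms in auto)
qed

lemma two_mult_le_weighted_squares:
  fixes p q w :: real
  assumes "w > 0"
  shows "2 * p * q \<le> w * p\<^sup>2 + q\<^sup>2 / w"
proof -
  have "0 \<le> (w * p - q)\<^sup>2 / w" using assms by simp
  also have "\<dots> = w * p\<^sup>2 + q\<^sup>2 / w - 2 * p * q"
    using assms by (simp add: power2_eq_square field_simps)
  finally show ?thesis by simp
qed

text \<open>The first expression is the derivative of \<tau> (\<gamma> x^2 + y^2) + \<epsilon> x y +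
  K s^2 along x' = y, y' = s + \<beta> y - \<gamma> x, s' = - \<nu> s with \<beta> = - \<tau> d.
  Without the cross term only y^2 is controlled; \<epsilon> x y contributes the missing - \<epsilon>
  \<gamma> x^2, and a large K absorbs the products with s. The second bound says that the cross term
  does not spoil the sign of the planar part.\<close>

lemma cubic_lyapunov_form:
  fixes d \<gamma> \<nu> \<tau> :: real
  assumes pos: "d > 0" "\<gamma> > 0" "\<nu> > 0" and \<tau>: "\<tau>\<^sup>2 = 1"
  obtains \<epsilon> K where "K > 0" and
    "\<And>x y s. (x, y, s) \<noteq> (0, 0, 0) \<Longrightarrow>
      - (2 * d - \<epsilon>) * y\<^sup>2 - \<epsilon> * \<tau> * d * x * y - \<epsilon> * \<gamma> * x\<^sup>2 + s * (2 * \<tau> * y + \<epsilon> * x) - 2 * K * \<nu> * s\<^sup>2 < 0"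
    and "\<And>x y. (x, y) \<noteq> (0, 0) \<Longrightarrow> \<bar>\<epsilon> * x * y\<bar> < \<gamma> * x\<^sup>2 + y\<^sup>2"
proof -
  \<comment> \<open>The bound \<open>\<epsilon> \<le> d\<close> preserves half of the damping in
    \<open>y\<close>; \<open>\<epsilon> * d \<le> \<gamma>\<close> controls the mixed term in
    \<open>x * y\<close>, and both together give
    \<open>\<epsilon> * \<epsilon> \<le> \<gamma>\<close> for the second claim.\<close>
  define \<epsilon> where "\<epsilon> = min d (\<gamma> / d)"
  have \<epsilon>: "\<epsilon> > 0" "\<epsilon> \<le> d" "\<epsilon> * d \<le> \<gamma>"
    using pos by (auto simp: \<epsilon>_def min_def field_simps)
  \<comment> \<open>\<open>4 / d\<close> and \<open>\<epsilon> / \<gamma>\<close> are the amounts of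
    \<open>s\<^sup>2\<close> released when the two products with \<open>s\<close> are split; the 1
    is what remains.\<close>
  define K where "K = (4 / d + \<epsilon> / \<gamma> + 1) / (2 * \<nu>)"
  have K: "K > 0" "2 * K * \<nu> = 4 / d + \<epsilon> / \<gamma> + 1"
    using pos \<epsilon> by (auto simp: K_def intro!: add_pos_pos divide_pos_pos)
  have \<tau>_abs: "\<bar>\<tau>\<bar> = 1" using \<tau> by (simp add: power2_eq_1_iff) auto
  show thesis
  proof (rule that[OF K(1)])
    fix x y s :: real assume nz: "(x, y, s) \<noteq> (0, 0, 0)"
    have *: "2 * (- \<tau> * x) * y \<le> (\<gamma> / d) * (- \<tau> * x)\<^sup>2 + y\<^sup>2 / (\<gamma> / d)"
      by (rule two_mult_le_weighted_squares) (use pos in simp)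
    have "- \<epsilon> * \<tau> * d * x * y = \<epsilon> * d / 2 * (2 * (- \<tau> * x) * y)" by simp
    also have "\<dots> \<le> \<epsilon> * d / 2 * ((\<gamma> / d) * (- \<tau> * x)\<^sup>2 + y\<^sup>2 / (\<gamma> / d))"
      by (intro mult_left_mono *) (use pos \<epsilon> in simp)
    also have "\<dots> = \<epsilon> * \<gamma> / 2 * x\<^sup>2 + (\<epsilon> * d) * (d / (2 * \<gamma>) * y\<^sup>2)"
      using pos \<tau> by (simp add: power_mult_distrib field_simps power2_eq_square[of d])
    also have "(\<epsilon> * d) * (d / (2 * \<gamma>) * y\<^sup>2) \<le> \<gamma> * (d / (2 * \<gamma>) * y\<^sup>2)"
      by (intro mult_right_mono \<epsilon>) (use pos in simp)
    also have "\<gamma> * (d / (2 * \<gamma>) * y\<^sup>2) = d / 2 * y\<^sup>2" using pos by simp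
    finally have i1: "- \<epsilon> * \<tau> * d * x * y \<le> \<epsilon> * \<gamma> / 2 * x\<^sup>2 + d / 2 * y\<^sup>2" by simp
    have i2: "2 * (\<tau> * y) * s \<le> d / 4 * (\<tau> * y)\<^sup>2 + s\<^sup>2 / (d / 4)"
      by (rule two_mult_le_weighted_squares) (use pos in simp)
    have "2 * (x / 2) * s \<le> \<gamma> * (x / 2)\<^sup>2 + s\<^sup>2 / \<gamma>"
      by (rule two_mult_le_weighted_squares) (use pos in simp)
    then have i3: "\<epsilon> * (2 * (x / 2) * s) \<le> \<epsilon> * (\<gamma> * (x / 2)\<^sup>2 + s\<^sup>2 / \<gamma>)"
      by (intro mult_left_mono) (use \<epsilon> in auto)
    have i4: "\<epsilon> * y\<^sup>2 \<le> d * y\<^sup>2" by (intro mult_right_mono \<epsilon>) simp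
    have "- (2 * d - \<epsilon>) * y\<^sup>2 - \<epsilon> * \<tau> * d * x * y - \<epsilon> * \<gamma> * x\<^sup>2 + s * (2 * \<tau> * y + \<epsilon> * x) - 2 * K * \<nu> * s\<^sup>2
        \<le> - (d / 4 * y\<^sup>2 + \<epsilon> * \<gamma> / 4 * x\<^sup>2 + s\<^sup>2)"
      using i1 i2 i3 i4 \<tau> unfolding K(2) power_mult_distrib
      by (simp add: algebra_simps power2_eq_square[of 2] add_divide_distrib power_divide)
    also have "\<dots> < 0"
    proof -
      have "d / 4 * y\<^sup>2 \<ge> 0" "\<epsilon> * \<gamma> / 4 * x\<^sup>2 \<ge> 0" "s\<^sup>2 \<ge> 0" using pos \<epsilon> by auto
      moreover have "d / 4 * y\<^sup>2 > 0 \<or> \<epsilon> * \<gamma> / 4 * x\<^sup>2 > 0 \<or> s\<^sup>2 > 0" using nz pos \<epsilon> by auto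
      ultimately show ?thesis by linarith
    qed
    finally show "- (2 * d - \<epsilon>) * y\<^sup>2 - \<epsilon> * \<tau> * d * x * y - \<epsilon> * \<gamma> * x\<^sup>2
        + s * (2 * \<tau> * y + \<epsilon> * x) - 2 * K * \<nu> * s\<^sup>2 < 0" .
  next
    fix x y :: real assume nz: "(x, y) \<noteq> (0, 0)"
    have "\<epsilon> * \<epsilon> \<le> \<gamma>" using \<epsilon> mult_left_mono[of \<epsilon> d \<epsilon>] by linarith
    then have "\<epsilon>\<^sup>2 * x\<^sup>2 \<le> \<gamma> * x\<^sup>2" by (intro mult_right_mono) (auto simp: power2_eq_square)
    moreover have "2 * (\<epsilon> * \<bar>x\<bar>) * \<bar>y\<bar> \<le> 1 * (\<epsilon> * \<bar>x\<bar>)\<^sup>2 + \<bar>y\<bar>\<^sup>2 / 1"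
      by (rule two_mult_le_weighted_squares) simp
    ultimately have "2 * \<bar>\<epsilon> * x * y\<bar> \<le> \<gamma> * x\<^sup>2 + y\<^sup>2"
      using \<epsilon> by (simp add: abs_mult power_mult_distrib mult_ac)
    moreover have "\<gamma> * x\<^sup>2 + y\<^sup>2 > 0"
      using nz pos by (cases "x = 0") (auto intro: add_pos_nonneg)
    ultimately show "\<bar>\<epsilon> * x * y\<bar> < \<gamma> * x\<^sup>2 + y\<^sup>2" by linarith
  qed
qed

text \<open>The characteristic polynomial factors as \<open>(X + \<nu>) (X\<^sup>2 - \<beta> X + \<gamma>)\<close> with \<open>\<beta>\<close> of the sign of
  \<open>c - a b\<close>; in the coordinates \<open>\<phi>\<close>, \<open>\<phi> J\<close>, \<open>\<phi> (J\<^sup>2 - \<beta> J + \<gamma>)\<close> the linearization is block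
  triangular.\<close>

lemma routh_hurwitz_cubic_form:
  fixes J :: "'a::euclidean_space \<Rightarrow> 'a" and \<phi> :: "'a \<Rightarrow> real"
  assumes linJ: "linear J" and lin\<phi>: "linear \<phi>" and abc: "a > 0" "b > 0" "c > 0" "a * b \<noteq> c"
    and char: "\<And>h. \<phi> (J (J (J h))) = - a * \<phi> (J (J h)) - b * \<phi> (J h) - c * \<phi> h"
    and obs: "\<And>h. \<phi> h = 0 \<Longrightarrow> \<phi> (J h) = 0 \<Longrightarrow> \<phi> (J (J h)) = 0 \<Longrightarrow> h = 0"
  obtains B :: "'a \<Rightarrow> 'a \<Rightarrow> real" where "bounded_bilinear B" and "\<And>h. h \<noteq> 0 \<Longrightarrow> B h (J h) + B (J h) h < 0"
    and "\<And>h. a * b > c \<Longrightarrow> h \<noteq> 0 \<Longrightarrow> B h h > 0"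
    and "\<And>k. a * b < c \<Longrightarrow> \<phi> k = 0 \<Longrightarrow> \<phi> (J k) \<noteq> 0 \<Longrightarrow> \<exists>h. B h h < 0"
proof -
  obtain \<nu> \<beta> \<gamma> where f: "\<nu> > 0" "\<gamma> > 0" "a = \<nu> - \<beta>" "b = \<gamma> - \<nu> * \<beta>" "c = \<nu> * \<gamma>"
    using cubic_factorization[OF abc(1-3)] by metis
  have abc': "a * b - c = - \<beta> * (\<nu>\<^sup>2 + b)"
    by (simp add: f power2_eq_square algebra_simps)
  have nb: "\<nu>\<^sup>2 + b > 0" using abc by (simp add: add_nonneg_pos)
  \<comment> \<open>\<open>\<tau>\<close> is the sign of \<open>- \<beta>\<close>. It makes the
    derivative of the form negative for either sign of \<open>\<beta>\<close>; stability is then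
    read off the sign of the form itself.\<close>
  define \<tau> where "\<tau> = (if \<beta> < 0 then 1 else -1 :: real)"
  have \<beta>0: "\<beta> \<noteq> 0" using abc' abc(4) by auto
  have \<tau>: "\<tau>\<^sup>2 = 1" "\<tau> * \<beta> = - \<bar>\<beta>\<bar>" "\<beta> = - \<tau> * \<bar>\<beta>\<bar>" using \<beta>0 by (auto simp: \<tau>_def)
  have sgn: "a * b > c \<longleftrightarrow> \<beta> < 0" "a * b < c \<longleftrightarrow> \<beta> > 0"
    using abc' nb by (smt (verit) mult_minus_left mult_pos_pos mult_neg_pos mult_eq_0_iff)+
  obtain \<epsilon> K where K: "K > 0" and
    neg: "\<And>x y s. (x, y, s) \<noteq> (0, 0, 0) \<Longrightarrow>
      - (2 * \<bar>\<beta>\<bar> - \<epsilon>) * y\<^sup>2 - \<epsilon> * \<tau> * \<bar>\<beta>\<bar> * x * y - \<epsilon> * \<gamma> * x\<^sup>2 + s * (2 * \<tau> * y + \<epsilon> * x) - 2 * K * \<nu> * s\<^sup>2 < 0"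
    and def: "\<And>x y. (x, y) \<noteq> (0, 0) \<Longrightarrow> \<bar>\<epsilon> * x * y\<bar> < \<gamma> * x\<^sup>2 + y\<^sup>2"
    using cubic_lyapunov_form[of "\<bar>\<beta>\<bar>" \<gamma> \<nu> \<tau>] \<beta>0 f \<tau>(1) by (metis zero_less_abs_iff)
  define X where "X = \<phi>"
  define Y where "Y = (\<lambda>h. \<phi> (J h))"
  define S where "S = (\<lambda>h. \<phi> (J (J h)) - \<beta> * \<phi> (J h) + \<gamma> * \<phi> h)"
  have XJ: "X (J h) = Y h" and YJ: "Y (J h) = S h + \<beta> * Y h - \<gamma> * X h" and SJ: "S (J h) = - \<nu> * S h" for h
    by (simp_all add: X_def Y_def S_def char f algebra_simps)
  have bl: "bounded_linear X" "bounded_linear Y" "bounded_linear S"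
    using linear_compose[OF linJ lin\<phi>] linear_compose[OF linJ linear_compose[OF linJ lin\<phi>]] lin\<phi>
    unfolding X_def Y_def S_def comp_def linear_conv_bounded_linear
    by (auto intro!: bounded_linear_add bounded_linear_sub bounded_linear_const_mult)
  define B where "B = (\<lambda>h k. (\<tau> * \<gamma> * X h) * X k + (\<tau> * Y h) * Y k
      + (\<epsilon> / 2 * X h) * Y k + (\<epsilon> / 2 * Y h) * X k + (K * S h) * S k)"
  have "bounded_bilinear B" unfolding B_def
    by (intro bounded_bilinear_add_fun bounded_bilinear.comp[OF bounded_bilinear_mult]
          bl bounded_linear_const_mult)
  moreover have "B h (J h) + B (J h) h < 0" if h: "h \<noteq> 0" for h
  proof -
    have "(X h, Y h, S h) \<noteq> (0, 0, 0)"
      using obs[of h] h by (auto simp: X_def Y_def S_def)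
    from neg[OF this] have "- (2 * \<bar>\<beta>\<bar> - \<epsilon>) * (Y h)\<^sup>2 - \<epsilon> * \<tau> * \<bar>\<beta>\<bar> * X h * Y h - \<epsilon> * \<gamma> * (X h)\<^sup>2
        + S h * (2 * \<tau> * Y h + \<epsilon> * X h) - 2 * K * \<nu> * (S h)\<^sup>2 < 0" .
    also have "- (2 * \<bar>\<beta>\<bar> - \<epsilon>) * (Y h)\<^sup>2 - \<epsilon> * \<tau> * \<bar>\<beta>\<bar> * X h * Y h = 2 * (\<tau> * \<beta>) * (Y h)\<^sup>2 + \<epsilon> * (Y h)\<^sup>2 + \<epsilon> * \<beta> * X h * Y h"
      unfolding \<tau>(2) using arg_cong[OF \<tau>(3), of "\<lambda>t. \<epsilon> * t * X h * Y h"] by (simp add: algebra_simps)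
    finally show ?thesis
      by (simp add: B_def XJ YJ SJ algebra_simps power2_eq_square)
  qed
  moreover have "B h h > 0" if ab: "a * b > c" and h: "h \<noteq> 0" for h
  proof -
    have "\<tau> = 1" using ab sgn by (simp add: \<tau>_def)
    then have B: "B h h = \<gamma> * (X h)\<^sup>2 + (Y h)\<^sup>2 + \<epsilon> * X h * Y h + K * (S h)\<^sup>2"
      by (simp add: B_def power2_eq_square)
    have "(X h, Y h, S h) \<noteq> (0, 0, 0)" using obs[of h] h by (auto simp: X_def Y_def S_def)
    then show ?thesis
    proof (cases "(X h, Y h) = (0, 0)")
      case False
      then have "\<bar>\<epsilon> * X h * Y h\<bar> < \<gamma> * (X h)\<^sup>2 + (Y h)\<^sup>2" by (rule def)
      moreover have "K * (S h)\<^sup>2 \<ge> 0" using K by simp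
      ultimately show ?thesis unfolding B by linarith
    qed (use K in \<open>auto simp: B\<close>)
  qed
  moreover have "\<exists>h. B h h < 0" if ab: "a * b < c" and k: "\<phi> k = 0" "\<phi> (J k) \<noteq> 0" for k
  proof
    \<comment> \<open>Since \<open>S\<close> composed with \<open>J\<close> is
      \<open>- \<nu> * S\<close>, the map \<open>J + \<nu>\<close> sends every vector into the
      kernel of \<open>S\<close>. There only the planar part of the form is left, and it is negative
      for \<open>\<tau> = -1\<close>.\<close>
    let ?h = "J k + \<nu> *\<^sub>R k"
    have "S ?h = S (J k) + \<nu> * S k"
      using bl(3) by (simp add: bounded_linear.linear linear_add linear_scale)
    then have S: "S ?h = 0" by (simp add: SJ)
    have "X ?h = X (J k) + \<nu> * X k"
      using bl(1) by (simp add: bounded_linear.linear linear_add linear_scale)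
    then have "X ?h \<noteq> 0" using k by (simp add: X_def)
    then have "\<bar>\<epsilon> * X ?h * Y ?h\<bar> < \<gamma> * (X ?h)\<^sup>2 + (Y ?h)\<^sup>2" by (intro def) simp
    moreover have "\<tau> = -1" using ab sgn by (simp add: \<tau>_def)
    ultimately show "B ?h ?h < 0"
      by (simp add: B_def S power2_eq_square)
  qed
  ultimately show thesis by (rule that)
qed

lemma routh_hurwitz_cubic_stable:
  fixes f J :: "'a::euclidean_space \<Rightarrow> 'a" and \<phi> :: "'a \<Rightarrow> real"
  assumes fe: "f e = 0" and J: "(f has_derivative J) (at e)" and lin\<phi>: "linear \<phi>"
    and abc: "a > 0" "b > 0" "c > 0" "a * b > c"
    and char: "\<And>h. \<phi> (J (J (J h))) = - a * \<phi> (J (J h)) - b * \<phi> (J h) - c * \<phi> h"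
    and obs: "\<And>h. \<phi> h = 0 \<Longrightarrow> \<phi> (J h) = 0 \<Longrightarrow> \<phi> (J (J h)) = 0 \<Longrightarrow> h = 0"
  shows "exponentially_stable f e"
proof -
  have "a * b \<noteq> c" using abc(4) by simp
  then show ?thesis
  proof (rule routh_hurwitz_cubic_form[OF has_derivative_linear[OF J] lin\<phi> abc(1-3)])
    show "\<phi> (J (J (J h))) = - a * \<phi> (J (J h)) - b * \<phi> (J h) - c * \<phi> h" for h by (rule char)
    show "h = 0" if "\<phi> h = 0" "\<phi> (J h) = 0" "\<phi> (J (J h)) = 0" for h using that by (rule obs)
    fix B :: "'a \<Rightarrow> 'a \<Rightarrow> real"
    assume "bounded_bilinear B" "\<And>h. h \<noteq> 0 \<Longrightarrow> B h (J h) + B (J h) h < 0"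
      "\<And>h. a * b > c \<Longrightarrow> h \<noteq> 0 \<Longrightarrow> B h h > 0"
    then show ?thesis using abc(4) by (intro quadratic_lyapunov_exponentially_stable[OF fe J])
  qed
qed

lemma routh_hurwitz_cubic_unstable:
  fixes f J :: "'a::euclidean_space \<Rightarrow> 'a" and \<phi> :: "'a \<Rightarrow> real"
  assumes fe: "f e = 0" and J: "(f has_derivative J) (at e)" and lin\<phi>: "linear \<phi>"
    and lip: "\<And>R. \<exists>L. L-lipschitz_on (cball e R) f"
    and abc: "a > 0" "b > 0" "c > 0" "a * b < c"
    and char: "\<And>h. \<phi> (J (J (J h))) = - a * \<phi> (J (J h)) - b * \<phi> (J h) - c * \<phi> h"
    and obs: "\<And>h. \<phi> h = 0 \<Longrightarrow> \<phi> (J h) = 0 \<Longrightarrow> \<phi> (J (J h)) = 0 \<Longrightarrow> h = 0"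
    and k: "\<phi> k = 0" "\<phi> (J k) \<noteq> 0"
  shows "\<not> asymptotically_stable f e"
proof -
  have "a * b \<noteq> c" using abc(4) by simp
  then show ?thesis
  proof (rule routh_hurwitz_cubic_form[OF has_derivative_linear[OF J] lin\<phi> abc(1-3)])
    show "\<phi> (J (J (J h))) = - a * \<phi> (J (J h)) - b * \<phi> (J h) - c * \<phi> h" for h by (rule char)
    show "h = 0" if "\<phi> h = 0" "\<phi> (J h) = 0" "\<phi> (J (J h)) = 0" for h using that by (rule obs)
    fix B :: "'a \<Rightarrow> 'a \<Rightarrow> real"
    assume B: "bounded_bilinear B" and neg: "\<And>h. h \<noteq> 0 \<Longrightarrow> B h (J h) + B (J h) h < 0"
      and ex: "\<And>k. a * b < c \<Longrightarrow> \<phi> k = 0 \<Longrightarrow> \<phi> (J k) \<noteq> 0 \<Longrightarrow> \<exists>h. B h h < 0"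
    obtain h0 where h0: "B h0 h0 < 0" using ex[OF abc(4) k] by blast
    have B': "bounded_bilinear (\<lambda>h k. - B h k)"
      using bounded_bilinear.comp[OF B bounded_linear_minus[OF bounded_linear_ident] bounded_linear_ident]
      by (simp add: bounded_bilinear.minus_left[OF B])
    have "- B h (J h) + - B (J h) h > 0" if "h \<noteq> 0" for h using neg[OF that] by linarith
    then show ?thesis
      by (rule quadratic_chetaev_not_asymptotically_stable[OF fe J B' lip, where v = h0]) (use h0 in simp_all)
  qed
qed

section \<open>Subcritical Hopf equilibria\<close>

text \<open>Order-of-vanishing calculus with respect to a gauge \<open>N\<close> that can give
  different coordinates different weights, so that remainders are estimated by counting
  degrees.\<close>

locale weighted_order =
  fixes N :: "'p \<Rightarrow> real"
  assumes N_nonneg: "N p \<ge> 0"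
begin

definition order_ge :: "nat \<Rightarrow> ('p \<Rightarrow> 'b::real_normed_vector) \<Rightarrow> bool" where
  "order_ge n F \<longleftrightarrow> (\<exists>C. \<forall>p. N p \<le> 1 \<longrightarrow> norm (F p) \<le> C * N p ^ n)"

lemma order_ge_bound:
  assumes "order_ge n F"
  obtains C where "C \<ge> 0" and "\<And>p. N p \<le> 1 \<Longrightarrow> norm (F p) \<le> C * N p ^ n"
proof -
  obtain C where C: "\<And>p. N p \<le> 1 \<Longrightarrow> norm (F p) \<le> C * N p ^ n"
    using assms by (auto simp: order_ge_def)
  show thesis
  proof (rule that[of "\<bar>C\<bar>"])
    fix p assume "N p \<le> 1"
    then show "norm (F p) \<le> \<bar>C\<bar> * N p ^ n"
      using C[of p] N_nonneg[of p] by (smt (verit) mult_right_mono zero_le_power)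
  qed simp
qed

lemma order_ge_mono:
  assumes "order_ge m F" "n \<le> m"
  shows "order_ge n F"
proof -
  obtain C where C: "C \<ge> 0" "\<And>p. N p \<le> 1 \<Longrightarrow> norm (F p) \<le> C * N p ^ m"
    using order_ge_bound[OF assms(1)] by blast
  have "norm (F p) \<le> C * N p ^ n" if "N p \<le> 1" for p
  proof -
    have "N p ^ m \<le> N p ^ n" using that N_nonneg assms(2) by (intro power_decreasing) auto
    then show ?thesis using C(2)[OF that] C(1) by (meson mult_left_mono order_trans)
  qed
  then show ?thesis by (auto simp: order_ge_def)
qed

lemma order_ge_add:
  assumes "order_ge n F" "order_ge n G"
  shows "order_ge n (\<lambda>p. F p + G p)"
proof -
  obtain C D where "\<And>p. N p \<le> 1 \<Longrightarrow> norm (F p) \<le> C * N p ^ n" "\<And>p. N p \<le> 1 \<Longrightarrow> norm (G p) \<le> D * N p ^ n"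
    using assms unfolding order_ge_def by blast
  then have "N p \<le> 1 \<Longrightarrow> norm (F p + G p) \<le> (C + D) * N p ^ n" for p
    by (metis (no_types) add_mono distrib_right norm_triangle_le)
  then show ?thesis unfolding order_ge_def by blast
qed

lemma order_ge_minus: "order_ge n F \<Longrightarrow> order_ge n (\<lambda>p. - F p)"
  by (simp add: order_ge_def)

lemma order_ge_diff: "order_ge n F \<Longrightarrow> order_ge n G \<Longrightarrow> order_ge n (\<lambda>p. F p - G p)"
  using order_ge_add[OF _ order_ge_minus, of n F G] by simp

lemma order_ge_mult:
  fixes F G :: "'p \<Rightarrow> 'b::real_normed_field"
  assumes "order_ge m F" "order_ge n G"
  shows "order_ge (m + n) (\<lambda>p. F p * G p)"
proof -
  obtain C where C: "C \<ge> 0" "\<And>p. N p \<le> 1 \<Longrightarrow> norm (F p) \<le> C * N p ^ m"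
    using order_ge_bound[OF assms(1)] by blast
  obtain D where D: "D \<ge> 0" "\<And>p. N p \<le> 1 \<Longrightarrow> norm (G p) \<le> D * N p ^ n"
    using order_ge_bound[OF assms(2)] by blast
  have "norm (F p * G p) \<le> (C * D) * N p ^ (m + n)" if "N p \<le> 1" for p
  proof -
    have "norm (F p) * norm (G p) \<le> (C * N p ^ m) * (D * N p ^ n)"
      using C D that N_nonneg by (intro mult_mono) auto
    then show ?thesis by (simp add: norm_mult power_add mult_ac)
  qed
  then show ?thesis unfolding order_ge_def by blast
qed

lemma order_ge_const: "order_ge 0 (\<lambda>p. c)"
  by (auto simp: order_ge_def intro: exI[of _ "norm c"])

lemma order_ge_cmult:
  fixes F :: "'p \<Rightarrow> 'b::real_normed_field"
  shows "order_ge n F \<Longrightarrow> order_ge n (\<lambda>p. c * F p)"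
  using order_ge_mult[OF order_ge_const] by fastforce

lemma order_ge_cnj: "order_ge n F \<Longrightarrow> order_ge n (\<lambda>p. cnj (F p))"
  by (simp add: order_ge_def)

lemma order_ge_of_real: "order_ge n F \<Longrightarrow> order_ge n (\<lambda>p. complex_of_real (F p))"
  by (simp add: order_ge_def)

lemma order_ge_Re:
  assumes "order_ge n F"
  shows "order_ge n (\<lambda>p. Re (F p))"
  using assms abs_Re_le_cmod unfolding order_ge_def by (metis order_trans real_norm_def)

end

section \<open>A quartic Chetaev function at a pair of imaginary eigenvalues\<close>

lemma Re_eq_0_iff_add_cnj: "Re w = 0 \<longleftrightarrow> w + cnj w = 0"
  by (simp add: complex_eq_iff)

text \<open>The Chetaev function is \<open>\<bar>z\<bar>\<^sup>2\<close> plus cubic and quartic terms in \<open>z\<close> that remove all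
  non-resonant terms of its derivative, minus a large multiple of the squared distance to the
  quadratic approximation \<open>s = q z\<close> of the center manifold.  The real part assumed positive is the
  first Lyapunov coefficient.\<close>

lemma hopf_chetaev_function:
  fixes a b c d e f h j :: complex and g l \<omega> \<nu> :: real
  assumes \<omega>: "\<omega> \<noteq> 0" and \<nu>: "\<nu> > 0"
    and lyap: "Re (\<i> * a * b / \<omega> + d * (g / \<nu>) + e * (h / (\<nu> + 2 * \<i> * \<omega>))) > 0"
    and Z: "\<And>z s. Z z s = \<i> * \<omega> * z + (a * z\<^sup>2 + b * (z * cnj z) + c * (cnj z)\<^sup>2)
      + complex_of_real s * (d * z + e * cnj z) + f * (complex_of_real s)\<^sup>2"
    and W: "\<And>z s. W z s = - \<nu> * s + 2 * Re (h * z\<^sup>2) + g * (cmod z)\<^sup>2 + 2 * s * Re (j * z) + l * s\<^sup>2"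
  obtains V V' r where "\<And>p. (V has_derivative V' p) (at p)" and "V (0, 0) = 0" and "r > 0"
    and "\<And>z s. cmod z < r \<Longrightarrow> \<bar>s\<bar> < r \<Longrightarrow> V' (z, s) (Z z s, W z s) \<ge> 0"
    and "\<And>\<delta>. \<delta> > 0 \<Longrightarrow> \<exists>t. 0 < t \<and> t < \<delta> \<and> V (complex_of_real t, 0::real) > (0::real)"
proof -
  define \<rho> where "\<rho> = Re (\<i> * a * b / \<omega> + d * (g / \<nu>) + e * (h / (\<nu> + 2 * \<i> * \<omega>)))"
  have \<rho>: "\<rho> > 0" using lyap by (simp add: \<rho>_def)
  \<comment> \<open>Invariance of \<open>s = q z\<close> to second order: along the linear rotation
    \<open>z\<^sup>2\<close> turns with frequency \<open>2 * \<omega>\<close> and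
    \<open>z * cnj z\<close> is constant, which leads to the denominators
    \<open>\<nu> + 2 * \<i> * \<omega>\<close> and \<open>\<nu>\<close>.\<close>
  define \<eta> where "\<eta> = h / (\<nu> + 2 * \<i> * \<omega>)"
  define \<theta> where "\<theta> = g / \<nu>"
  have "complex_of_real \<nu> + 2 * \<i> * \<omega> \<noteq> 0" using \<nu> by (auto simp: complex_eq_iff)
  then have h: "h = \<eta> * (\<nu> + 2 * \<i> * \<omega>)" by (simp add: \<eta>_def)
  have g: "g = \<theta> * \<nu>" using \<nu> by (simp add: \<theta>_def)
  \<comment> \<open>Chosen so that the cubic corrections of \<open>V\<close> cancel the cubic terms
    in the derivative of \<open>z * cnj z\<close>, as \<open>cubic\<close> confirms.\<close>
  define \<kappa>\<^sub>1 where "\<kappa>\<^sub>1 = \<i> * (a + cnj b) / \<omega>"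
  define \<kappa>\<^sub>2 where "\<kappa>\<^sub>2 = c / (3 * \<i> * \<omega>)"
  have a: "a = - cnj b - \<i> * \<omega> * \<kappa>\<^sub>1" using \<omega> by (simp add: \<kappa>\<^sub>1_def)
  have c: "c = 3 * \<i> * \<omega> * \<kappa>\<^sub>2" using \<omega> by (simp add: \<kappa>\<^sub>2_def)
  \<comment> \<open>\<open>X\<close> and \<open>Y\<close> are the coefficients of
    \<open>z ^ 3 * cnj z\<close> and \<open>z ^ 4\<close> in the quartic part of the derivative,
    with those of the conjugate monomials folded in. Both monomials rotate, so
    \<open>\<kappa>\<^sub>3\<close> and \<open>\<kappa>\<^sub>4\<close> can remove them.\<close>
  define X where "X = 2 * \<kappa>\<^sub>1 * a + 3 * cnj \<kappa>\<^sub>2 * b + d * \<eta> + cnj (2 * \<kappa>\<^sub>1 * c + cnj \<kappa>\<^sub>1 * b + d * cnj \<eta> + e * \<theta>)"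
  define Y where "Y = 3 * cnj \<kappa>\<^sub>2 * a + cnj (cnj \<kappa>\<^sub>1 * c + e * cnj \<eta>)"
  define \<kappa>\<^sub>3 where "\<kappa>\<^sub>3 = \<i> * X / (2 * \<omega>)"
  define \<kappa>\<^sub>4 where "\<kappa>\<^sub>4 = \<i> * Y / (4 * \<omega>)"
  have X: "X = - 2 * \<i> * \<omega> * \<kappa>\<^sub>3" and Y: "Y = - 4 * \<i> * \<omega> * \<kappa>\<^sub>4"
    using \<omega> by (simp_all add: \<kappa>\<^sub>3_def \<kappa>\<^sub>4_def field_simps)
  define q where "q = (\<lambda>z. \<eta> * z\<^sup>2 + \<theta> * (z * cnj z) + cnj \<eta> * (cnj z)\<^sup>2)"
  have q_real: "q z = complex_of_real (Re (q z))" for z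
    by (simp add: q_def complex_eq_iff power2_eq_square)
  define S where "S = (\<lambda>p. snd p - Re (q (fst p)))"
  \<comment> \<open>\<open>\<Gamma>\<^sub>2\<close>, \<open>\<Gamma>\<^sub>3\<close> and
    \<open>\<Lambda>\<close> are the Wirtinger derivatives in \<open>z\<close> of the cubic part of
    \<open>V\<close>, of its quartic part in \<open>z\<close>, and of \<open>q\<close>; twice the
    real part of their product with a direction is the real derivative.\<close>
  define \<Gamma>\<^sub>2 where "\<Gamma>\<^sub>2 = (\<lambda>z. 2 * \<kappa>\<^sub>1 * (z * cnj z) + cnj \<kappa>\<^sub>1 * (cnj z)\<^sup>2 + 3 * cnj \<kappa>\<^sub>2 * z\<^sup>2)"
  define \<Gamma>\<^sub>3 where "\<Gamma>\<^sub>3 = (\<lambda>z. 3 * \<kappa>\<^sub>3 * (z\<^sup>2 * cnj z) + cnj \<kappa>\<^sub>3 * (cnj z) ^ 3 + 4 * \<kappa>\<^sub>4 * z ^ 3)"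
  define \<Lambda> where "\<Lambda> = (\<lambda>z. 2 * \<eta> * z + \<theta> * cnj z)"
  define Q where "Q = (\<lambda>z. a * z\<^sup>2 + b * (z * cnj z) + c * (cnj z)\<^sup>2)"
  define \<l> where "\<l> = (\<lambda>z. d * z + e * cnj z)"
  define V where "V = (\<lambda>K p. Re (fst p * cnj (fst p) + 2 * (\<kappa>\<^sub>1 * ((fst p)\<^sup>2 * cnj (fst p)) + \<kappa>\<^sub>2 * (cnj (fst p)) ^ 3
      + \<kappa>\<^sub>3 * ((fst p) ^ 3 * cnj (fst p)) + \<kappa>\<^sub>4 * (fst p) ^ 4)) - K * (S p)\<^sup>2)"
  define V' where "V' = (\<lambda>(K::real) p v. 2 * Re ((cnj (fst p) + \<Gamma>\<^sub>2 (fst p) + \<Gamma>\<^sub>3 (fst p)) * fst v)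
      - 2 * K * S p * (snd v - 2 * Re (\<Lambda> (fst p) * fst v)))"
  have d1: "Re (z * cnj \<zeta> + \<zeta> * cnj z + 2 * (\<kappa>\<^sub>1 * (z\<^sup>2 * cnj \<zeta> + 2 * \<zeta> * z * cnj z)
      + \<kappa>\<^sub>2 * (3 * cnj \<zeta> * (cnj z)\<^sup>2) + \<kappa>\<^sub>3 * (z ^ 3 * cnj \<zeta> + 3 * \<zeta> * z\<^sup>2 * cnj z) + \<kappa>\<^sub>4 * (4 * \<zeta> * z ^ 3)))
      = 2 * Re ((cnj z + \<Gamma>\<^sub>2 z + \<Gamma>\<^sub>3 z) * \<zeta>)" (is "Re ?A = 2 * Re ?B") for z \<zeta>
  proof -
    have "Re (?A - 2 * ?B) = 0"
      unfolding Re_eq_0_iff_add_cnj \<Gamma>\<^sub>2_def \<Gamma>\<^sub>3_def by (simp add: algebra_simps)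
    then show ?thesis by simp
  qed
  have d2: "Re (\<eta> * (2 * \<zeta> * z) + \<theta> * (z * cnj \<zeta> + \<zeta> * cnj z) + cnj \<eta> * (2 * cnj \<zeta> * cnj z))
      = 2 * Re (\<Lambda> z * \<zeta>)" (is "Re ?A = 2 * Re ?B") for z \<zeta>
  proof -
    have "Re (?A - 2 * ?B) = 0"
      unfolding Re_eq_0_iff_add_cnj \<Lambda>_def by (simp add: algebra_simps)
    then show ?thesis by simp
  qed
  have deriv: "(V K has_derivative V' K p) (at p)" for K p
  proof -
    have "(S has_derivative (\<lambda>v. snd v - Re (\<eta> * (2 * fst v * fst p)
        + \<theta> * (fst p * cnj (fst v) + fst v * cnj (fst p)) + cnj \<eta> * (2 * cnj (fst v) * cnj (fst p))))) (at p)"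
      unfolding S_def q_def by (rule derivative_eq_intros refl | simp)+
    then have dS: "(S has_derivative (\<lambda>v. snd v - 2 * Re (\<Lambda> (fst p) * fst v))) (at p)"
      unfolding d2 .
    have "(V K has_derivative (\<lambda>v. Re (fst p * cnj (fst v) + fst v * cnj (fst p)
        + 2 * (\<kappa>\<^sub>1 * ((fst p)\<^sup>2 * cnj (fst v) + 2 * fst v * fst p * cnj (fst p))
        + \<kappa>\<^sub>2 * (3 * cnj (fst v) * (cnj (fst p))\<^sup>2) + \<kappa>\<^sub>3 * ((fst p) ^ 3 * cnj (fst v) + 3 * fst v * (fst p)\<^sup>2 * cnj (fst p))
        + \<kappa>\<^sub>4 * (4 * fst v * (fst p) ^ 3))) - K * (2 * (snd v - 2 * Re (\<Lambda> (fst p) * fst v)) * S p))) (at p)"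
      unfolding V_def by (rule derivative_eq_intros dS refl | simp)+
    then show ?thesis unfolding d1 by (simp add: V'_def mult_ac)
  qed
  have cubic: "Re (cnj z * Q z + \<i> * \<omega> * z * \<Gamma>\<^sub>2 z) = 0" for z
    unfolding Re_eq_0_iff_add_cnj Q_def \<Gamma>\<^sub>2_def a c
    by (simp add: power2_eq_square power3_eq_cube algebra_simps)
  \<comment> \<open>\<open>z\<^sup>2 * (cnj z)\<^sup>2\<close> does not rotate and cannot be
    removed. Of the terms that stem from the cubic corrections a single
    \<open>\<kappa>\<^sub>1 * b\<close> counts; substituting \<open>a\<close> and \<open>c\<close>
    shows that the rest is imaginary.\<close>
  have resonant: "Re (2 * \<kappa>\<^sub>1 * b + cnj \<kappa>\<^sub>1 * a + 3 * cnj \<kappa>\<^sub>2 * c + d * \<theta> + e * \<eta>) = \<rho>"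
  proof -
    have "Re (2 * \<kappa>\<^sub>1 * b + cnj \<kappa>\<^sub>1 * a + 3 * cnj \<kappa>\<^sub>2 * c) = Re (\<i> * a * b / \<omega>)"
    proof -
      have "\<i> * a * b / \<omega> = \<kappa>\<^sub>1 * b - \<i> * (b * cnj b) / \<omega>"
        using \<omega> by (simp add: a field_simps)
      moreover have "Re (\<i> * (b * cnj b) / \<omega>) = 0" by (simp add: Re_divide_of_real)
      moreover have "Re (\<kappa>\<^sub>1 * b + cnj \<kappa>\<^sub>1 * a + 3 * cnj \<kappa>\<^sub>2 * c) = 0"
        unfolding Re_eq_0_iff_add_cnj a c by (simp add: algebra_simps)
      ultimately show ?thesis by simp
    qed
    then show ?thesis by (simp add: \<rho>_def \<eta>_def \<theta>_def)
  qed
  have reassoc: "(y - y') * u + xx + ss + xv + yv + (k1 + k2 - y * u) = - y' * u + yv + (xx + xv + k1 + k2) + ss"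
    for y y' u xx ss xv yv k1 k2 :: complex
    by (simp add: algebra_simps)
  have quartic: "Re (cnj z * q z * \<l> z + \<Gamma>\<^sub>2 z * Q z + \<i> * \<omega> * z * \<Gamma>\<^sub>3 z) = \<rho> * (cmod z) ^ 4" for z
  proof -
    let ?S = "2 * \<kappa>\<^sub>1 * b + cnj \<kappa>\<^sub>1 * a + 3 * cnj \<kappa>\<^sub>2 * c + d * \<theta> + e * \<eta>"
    let ?X = "2 * \<kappa>\<^sub>1 * c + cnj \<kappa>\<^sub>1 * b + d * cnj \<eta> + e * \<theta>" and ?Y = "cnj \<kappa>\<^sub>1 * c + e * cnj \<eta>"
    let ?Z4 = "- cnj ?Y * z ^ 4 + ?Y * (cnj z) ^ 4"
    let ?Z3 = "(X - cnj ?X) * (z ^ 3 * cnj z) + ?X * (z * (cnj z) ^ 3)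
        + 3 * \<i> * \<omega> * \<kappa>\<^sub>3 * (z ^ 3 * cnj z) + \<i> * \<omega> * cnj \<kappa>\<^sub>3 * (z * (cnj z) ^ 3)"
    have "cnj z * q z * \<l> z + \<Gamma>\<^sub>2 z * Q z = (Y - cnj ?Y) * z ^ 4 + (X - cnj ?X) * (z ^ 3 * cnj z)
        + ?S * (z\<^sup>2 * (cnj z)\<^sup>2) + ?X * (z * (cnj z) ^ 3) + ?Y * (cnj z) ^ 4"
      unfolding X_def Y_def q_def \<l>_def \<Gamma>\<^sub>2_def Q_def by (simp add: eval_nat_numeral algebra_simps)
    moreover have "\<i> * \<omega> * z * \<Gamma>\<^sub>3 z = 3 * \<i> * \<omega> * \<kappa>\<^sub>3 * (z ^ 3 * cnj z) + \<i> * \<omega> * cnj \<kappa>\<^sub>3 * (z * (cnj z) ^ 3) - Y * z ^ 4"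
      unfolding \<Gamma>\<^sub>3_def Y by (simp add: eval_nat_numeral algebra_simps)
    ultimately have "cnj z * q z * \<l> z + \<Gamma>\<^sub>2 z * Q z + \<i> * \<omega> * z * \<Gamma>\<^sub>3 z
        = ?Z4 + ?Z3 + ?S * (z\<^sup>2 * (cnj z)\<^sup>2)"
      by (simp only:) (rule reassoc)
    moreover have "Re ?Z4 = 0"
      unfolding Re_eq_0_iff_add_cnj by (simp add: algebra_simps)
    moreover have "Re ?Z3 = 0"
      unfolding Re_eq_0_iff_add_cnj X by (simp add: algebra_simps)
    moreover have "Re (?S * (z\<^sup>2 * (cnj z)\<^sup>2)) = \<rho> * (cmod z) ^ 4"
    proof -
      have "complex_of_real ((cmod z) ^ 4) = (complex_of_real ((cmod z)\<^sup>2))\<^sup>2" by (simp flip: power_mult)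
      then have "z\<^sup>2 * (cnj z)\<^sup>2 = complex_of_real ((cmod z) ^ 4)"
        unfolding complex_norm_square[of z] by (simp add: power_mult_distrib)
      then show ?thesis
        by (simp only: Re_complex_of_real times_complex.sel Im_complex_of_real resonant mult_zero_right diff_zero)
    qed
    ultimately show ?thesis by (simp only: plus_complex.sel)
  qed
  \<comment> \<open>Leftovers of the derivative: \<open>R\<close> has weighted order 5,
    \<open>G\<close> has order 2 and occurs multiplied by \<open>S\<close>, and \<open>E\<close>, of
    order 3, is the deviation of the derivative of \<open>S\<close> from
    \<open>- \<nu> * S\<close>.\<close>
  define R where "R = (\<lambda>p. 2 * Re (\<Gamma>\<^sub>2 (fst p) * (q (fst p) * \<l> (fst p)) + \<Gamma>\<^sub>3 (fst p) * Q (fst p) + \<Gamma>\<^sub>3 (fst p) * (q (fst p) * \<l> (fst p))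
      + (cnj (fst p) + \<Gamma>\<^sub>2 (fst p) + \<Gamma>\<^sub>3 (fst p)) * (f * (complex_of_real (snd p) * complex_of_real (snd p)))))"
  define G where "G = (\<lambda>p :: complex \<times> real. 2 * Re ((cnj (fst p) + \<Gamma>\<^sub>2 (fst p) + \<Gamma>\<^sub>3 (fst p)) * \<l> (fst p)))"
  define E where "E = (\<lambda>p. 2 * (snd p * Re (j * fst p)) + l * (snd p * snd p)
      - 2 * Re (\<Lambda> (fst p) * (Q (fst p) + complex_of_real (snd p) * \<l> (fst p) + f * (complex_of_real (snd p) * complex_of_real (snd p)))))"
  have s: "complex_of_real (snd p) = complex_of_real (S p) + q (fst p)" for p
    by (subst q_real) (simp add: S_def)
  have D0: "2 * Re ((cnj z + \<Gamma>\<^sub>2 z + \<Gamma>\<^sub>3 z) * Z z s) = 2 * \<rho> * (cmod z) ^ 4 + S (z, s) * G (z, s) + R (z, s)" for z s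
  proof -
    let ?\<Gamma> = "cnj z + \<Gamma>\<^sub>2 z + \<Gamma>\<^sub>3 z"
    have "Z z s = \<i> * \<omega> * z + Q z + q z * \<l> z + S (z, s) * \<l> z + f * (complex_of_real s * complex_of_real s)"
      using s[of "(z, s)"] by (simp add: Z Q_def \<l>_def algebra_simps power2_eq_square)
    then have "?\<Gamma> * Z z s = \<i> * \<omega> * (z * cnj z) + (cnj z * Q z + \<i> * \<omega> * z * \<Gamma>\<^sub>2 z)
        + (cnj z * q z * \<l> z + \<Gamma>\<^sub>2 z * Q z + \<i> * \<omega> * z * \<Gamma>\<^sub>3 z) + S (z, s) * (?\<Gamma> * \<l> z)
        + (\<Gamma>\<^sub>2 z * (q z * \<l> z) + \<Gamma>\<^sub>3 z * Q z + \<Gamma>\<^sub>3 z * (q z * \<l> z) + ?\<Gamma> * (f * (complex_of_real s * complex_of_real s)))"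
      by (simp add: algebra_simps)
    moreover have "Re (\<i> * \<omega> * (z * cnj z)) = 0" by simp
    ultimately show ?thesis
      using cubic[of z] quartic[of z]
      by (simp only: plus_complex.sel Re_complex_of_real G_def R_def fst_conv snd_conv) (simp add: algebra_simps)
  qed
  have D1: "W z s - 2 * Re (\<Lambda> z * Z z s) = - \<nu> * S (z, s) + E (z, s)" for z s
  proof -
    have "2 * Re (h * z\<^sup>2) + g * (cmod z)\<^sup>2 - 2 * Re (\<Lambda> z * (\<i> * \<omega> * z)) = \<nu> * Re (q z)"
      unfolding h g \<Lambda>_def q_def cmod_power2
      by (simp add: power2_eq_square algebra_simps)
    moreover have "\<Lambda> z * Z z s = \<Lambda> z * (\<i> * \<omega> * z) + \<Lambda> z * (Q z + complex_of_real s * \<l> z + f * (complex_of_real s * complex_of_real s))"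
      by (simp add: Z Q_def \<l>_def algebra_simps power2_eq_square)
    ultimately show ?thesis
      unfolding W E_def S_def fst_conv snd_conv by (simp only: plus_complex.sel) (simp add: algebra_simps power2_eq_square)
  qed
  \<comment> \<open>Weight 1 for \<open>z\<close> and 2 for the distance \<open>S\<close> from the
    approximate center manifold: the two leading terms, \<open>(cmod z) ^ 4\<close> and
    \<open>S\<^sup>2\<close>, then both have degree 4.\<close>
  define N where "N = (\<lambda>p. cmod (fst p) + sqrt \<bar>S p\<bar>)"
  interpret weighted_order N by unfold_locales (simp add: N_def)
  have o_z: "order_ge 1 fst"
  proof -
    have "cmod (fst p) \<le> 1 * N p ^ 1" for p by (simp add: N_def)
    then show ?thesis unfolding order_ge_def by blast
  qed
  have o_S: "order_ge 2 S"
  proof -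
    have "\<bar>S p\<bar> \<le> 1 * (N p)\<^sup>2" for p
    proof -
      have "\<bar>S p\<bar> = (sqrt \<bar>S p\<bar>)\<^sup>2" by simp
      also have "\<dots> \<le> (N p)\<^sup>2" by (intro power_mono) (auto simp: N_def)
      finally show ?thesis by simp
    qed
    then show ?thesis unfolding order_ge_def real_norm_def by blast
  qed
  have o_zz: "order_ge 2 (\<lambda>p. (fst p)\<^sup>2)" "order_ge 2 (\<lambda>p. fst p * cnj (fst p))" "order_ge 2 (\<lambda>p. (cnj (fst p))\<^sup>2)"
    using order_ge_mult[OF o_z o_z] order_ge_mult[OF o_z order_ge_cnj[OF o_z]]
      order_ge_mult[OF order_ge_cnj[OF o_z] order_ge_cnj[OF o_z]]
    by (simp_all add: power2_eq_square numeral_2_eq_2)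
  have o_zzz: "order_ge 3 (\<lambda>p. (fst p)\<^sup>2 * cnj (fst p))" "order_ge 3 (\<lambda>p. (cnj (fst p)) ^ 3)" "order_ge 3 (\<lambda>p. (fst p) ^ 3)"
    using order_ge_mult[OF o_zz(1) order_ge_cnj[OF o_z]] order_ge_mult[OF o_zz(3) order_ge_cnj[OF o_z]]
      order_ge_mult[OF o_zz(1) o_z]
    by (simp_all add: eval_nat_numeral mult.assoc)
  have o_q: "order_ge 2 (\<lambda>p. q (fst p))" and o_Q: "order_ge 2 (\<lambda>p. Q (fst p))" and o_\<Gamma>2: "order_ge 2 (\<lambda>p. \<Gamma>\<^sub>2 (fst p))"
    unfolding q_def Q_def \<Gamma>\<^sub>2_def by (intro order_ge_add order_ge_cmult o_zz)+
  have o_\<Gamma>3: "order_ge 3 (\<lambda>p. \<Gamma>\<^sub>3 (fst p))"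
    unfolding \<Gamma>\<^sub>3_def by (intro order_ge_add order_ge_cmult o_zzz)
  have o_l: "order_ge 1 (\<lambda>p. \<l> (fst p))" and o_\<Lambda>: "order_ge 1 (\<lambda>p. \<Lambda> (fst p))"
    unfolding \<l>_def \<Lambda>_def by (intro order_ge_add order_ge_cmult order_ge_cnj o_z)+
  have o_\<Gamma>: "order_ge 1 (\<lambda>p. cnj (fst p) + \<Gamma>\<^sub>2 (fst p) + \<Gamma>\<^sub>3 (fst p))"
    by (intro order_ge_add order_ge_cnj o_z order_ge_mono[OF o_\<Gamma>2] order_ge_mono[OF o_\<Gamma>3]) auto
  have o_s: "order_ge 2 (\<lambda>p. snd p)"
    using order_ge_add[OF o_S order_ge_Re[OF o_q]] by (simp add: S_def)
  note o_cs = order_ge_of_real[OF o_s]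
  note o_ss = order_ge_mult[OF o_s o_s] order_ge_mult[OF o_cs o_cs]
  have o_R: "order_ge 5 R"
    unfolding R_def
    by (intro order_ge_cmult order_ge_Re order_ge_add
          order_ge_mono[OF order_ge_mult[OF o_\<Gamma>2 order_ge_mult[OF o_q o_l]]]
          order_ge_mono[OF order_ge_mult[OF o_\<Gamma>3 o_Q]]
          order_ge_mono[OF order_ge_mult[OF o_\<Gamma>3 order_ge_mult[OF o_q o_l]]]
          order_ge_mono[OF order_ge_mult[OF o_\<Gamma> order_ge_cmult[OF o_ss(2)]]]) simp_all
  have o_G: "order_ge 2 G"
    unfolding G_def
    by (intro order_ge_cmult order_ge_Re order_ge_mono[OF order_ge_mult[OF o_\<Gamma> o_l]]) simp
  have o_E: "order_ge 3 E"
    unfolding E_def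
    by (intro order_ge_diff order_ge_add order_ge_cmult order_ge_Re
          order_ge_mono[OF order_ge_mult[OF o_s order_ge_Re[OF order_ge_cmult[OF o_z]]]] order_ge_mono[OF o_ss(1)]
          order_ge_mono[OF order_ge_mult[OF o_\<Lambda> order_ge_add[OF order_ge_add[OF o_Q
            order_ge_mono[OF order_ge_mult[OF o_cs o_l]]] order_ge_cmult[OF order_ge_mono[OF o_ss(2)]]]]]) simp_all
  obtain C1 where C1: "C1 \<ge> 0" "\<And>p. N p \<le> 1 \<Longrightarrow> \<bar>G p\<bar> \<le> C1 * N p ^ 2"
    using order_ge_bound[OF o_G] by auto
  obtain C2 where C2: "C2 \<ge> 0" "\<And>p. N p \<le> 1 \<Longrightarrow> \<bar>R p\<bar> \<le> C2 * N p ^ 5"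
    using order_ge_bound[OF o_R] by auto
  obtain C3 where C3: "C3 \<ge> 0" "\<And>p. N p \<le> 1 \<Longrightarrow> \<bar>S p * E p\<bar> \<le> C3 * N p ^ 5"
    using order_ge_bound[OF order_ge_mult[OF o_S o_E]] by auto
  \<comment> \<open>\<open>C1\<close>, \<open>C2\<close> and \<open>C3\<close> do not involve
    \<open>K\<close>, so it may be chosen last. The term \<open>2 * K * \<nu> * S\<^sup>2\<close>
    pays for the \<open>S\<^sup>2\<close> part of the estimate of \<open>S * G\<close> and leaves
    \<open>\<rho> * S\<^sup>2\<close>; likewise one of the two \<open>\<rho> * (cmod z) ^ 4\<close>
    is left.\<close>
  define K where "K = (\<rho> + C1\<^sup>2 / \<rho> + 2 * C1) / (2 * \<nu>)"
  have K: "K \<ge> 0" "2 * K * \<nu> = \<rho> + C1\<^sup>2 / \<rho> + 2 * C1"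
    using \<rho> \<nu> C1 by (auto simp: K_def)
  \<comment> \<open>The 8 is the constant of the comparison \<open>n4\<close> below. On
    \<open>N < \<rho> / M\<close> the fifth-order remainders stay below the surplus of degree
    4.\<close>
  define M where "M = 8 * (C2 + 2 * K * C3) + 1"
  have M: "M > 0" using C2 C3 K by (simp add: M_def add_nonneg_pos)
  have nonneg: "V' K (z, s) (Z z s, W z s) \<ge> 0" if N: "N (z, s) < min 1 (\<rho> / M)" for z s
  proof -
    define x y n where "x = cmod z" and "y = \<bar>S (z, s)\<bar>" and "n = N (z, s)"
    have xy: "x \<ge> 0" "y \<ge> 0" by (auto simp: x_def y_def)
    have n: "n = x + sqrt y" "n \<ge> 0" "n \<le> 1" "n * M \<le> \<rho>"
      using N M by (auto simp: n_def N_def x_def y_def field_simps)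
    have n2: "n\<^sup>2 \<le> 2 * x\<^sup>2 + 2 * y"
      using sum_squares_bound[of x "sqrt y"] xy by (simp add: n(1) power2_sum)
    have n4: "n ^ 4 \<le> 8 * (x ^ 4 + y\<^sup>2)"
    proof -
      have "n ^ 4 = (n\<^sup>2)\<^sup>2" by (simp flip: power_mult)
      also have "\<dots> \<le> (2 * x\<^sup>2 + 2 * y)\<^sup>2" using n2 by (intro power_mono) auto
      also have "\<dots> \<le> 8 * ((x\<^sup>2)\<^sup>2 + y\<^sup>2)"
        using sum_squares_bound[of "x\<^sup>2" y] by (simp add: power2_eq_square algebra_simps)
      finally show ?thesis by (simp flip: power_mult)
    qed
    have "V' K (z, s) (Z z s, W z s) = 2 * \<rho> * x ^ 4 + S (z, s) * G (z, s) + R (z, s)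
        + 2 * K * \<nu> * (S (z, s))\<^sup>2 - 2 * K * (S (z, s) * E (z, s))"
      unfolding V'_def fst_conv snd_conv D0 D1 x_def by (simp add: algebra_simps power2_eq_square)
    moreover have "S (z, s) * G (z, s) \<ge> - (\<rho> * x ^ 4 + (C1\<^sup>2 / \<rho> + 2 * C1) * y\<^sup>2)"
    proof -
      have "\<bar>S (z, s) * G (z, s)\<bar> \<le> y * (C1 * n\<^sup>2)"
        unfolding abs_mult y_def n_def by (intro mult_left_mono C1) (use n in \<open>auto simp: n_def\<close>)
      also have "\<dots> \<le> y * (C1 * (2 * x\<^sup>2 + 2 * y))"
        by (intro mult_left_mono n2 C1 xy)
      also have "\<dots> = 2 * x\<^sup>2 * (C1 * y) + 2 * C1 * y\<^sup>2" by (simp add: power2_eq_square algebra_simps)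
      also have "2 * x\<^sup>2 * (C1 * y) \<le> \<rho> * (x\<^sup>2)\<^sup>2 + (C1 * y)\<^sup>2 / \<rho>"
        by (rule two_mult_le_weighted_squares[OF \<rho>])
      finally show ?thesis by (simp add: power_mult_distrib algebra_simps flip: power_mult)
    qed
    moreover have "\<bar>R (z, s)\<bar> \<le> C2 * n ^ 5" "\<bar>S (z, s) * E (z, s)\<bar> \<le> C3 * n ^ 5"
      unfolding n_def by (intro C2 C3; use n in \<open>simp add: n_def\<close>)+
    moreover have "2 * K * (S (z, s) * E (z, s)) \<le> 2 * K * (C3 * n ^ 5)"
      using calculation(4) K by (intro mult_left_mono) auto
    moreover have "(C2 + 2 * K * C3) * n ^ 5 \<le> \<rho> * (x ^ 4 + y\<^sup>2)"
    proof -
      have "(C2 + 2 * K * C3) * n ^ 5 = (C2 + 2 * K * C3) * n * n ^ 4"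
        by (simp add: eval_nat_numeral)
      also have "\<dots> \<le> (C2 + 2 * K * C3) * n * (8 * (x ^ 4 + y\<^sup>2))"
        using n4 C2 C3 K n by (intro mult_left_mono) auto
      also have "\<dots> \<le> \<rho> * (x ^ 4 + y\<^sup>2)"
      proof -
        have "(C2 + 2 * K * C3) * n * 8 \<le> \<rho>"
          using n(2,4) by (simp add: M_def algebra_simps)
        then have "((C2 + 2 * K * C3) * n * 8) * (x ^ 4 + y\<^sup>2) \<le> \<rho> * (x ^ 4 + y\<^sup>2)"
          by (intro mult_right_mono) auto
        then show ?thesis by (simp add: algebra_simps)
      qed
      finally show ?thesis .
    qed
    moreover have "(S (z, s))\<^sup>2 = y\<^sup>2" by (simp add: y_def)
    ultimately show ?thesis unfolding K(2) by (simp add: algebra_simps)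
  qed
  have "continuous_on UNIV N"
    unfolding N_def S_def q_def by (intro continuous_intros)
  then have "isCont N (0, 0)" by (simp add: continuous_on_eq_continuous_at)
  moreover have "N (0, 0) = 0" by (simp add: N_def S_def q_def)
  ultimately have "(N \<longlongrightarrow> 0) (nhds (0, 0))" by (metis isCont_def tendsto_at_iff_tendsto_nhds)
  then have "eventually (\<lambda>p. N p < min 1 (\<rho> / M)) (nhds (0, 0))"
    using \<rho> M by (intro order_tendstoD(2)[of N 0]) auto
  then obtain r' where r': "r' > 0" "\<And>p. dist p (0, 0) < r' \<Longrightarrow> N p < min 1 (\<rho> / M)"
    by (auto simp: eventually_nhds_metric)
  show thesis
  proof (rule that[of "V K" "V' K" "r' / 2"])
    show "(V K has_derivative V' K p) (at p)" for p by (rule deriv)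
    show "V K (0, 0) = 0" by (simp add: V_def S_def q_def)
    show "r' / 2 > 0" using r' by simp
    show "V' K (z, s) (Z z s, W z s) \<ge> 0" if "cmod z < r' / 2" "\<bar>s\<bar> < r' / 2" for z s
    proof (rule nonneg, rule r'(2))
      have "dist (z, s) (0, 0) \<le> cmod z + \<bar>s\<bar>"
        by (simp add: dist_Pair_Pair sqrt_sum_squares_le_sum_abs[of "cmod z" "\<bar>s\<bar>", simplified])
      then show "dist (z, s) (0, 0) < r'" using that by linarith
    qed
    fix \<delta> :: real assume \<delta>: "\<delta> > 0"
    define A B where "A = 2 * Re (\<kappa>\<^sub>1 + \<kappa>\<^sub>2)" and "B = 2 * Re (\<kappa>\<^sub>3 + \<kappa>\<^sub>4) - K * (2 * Re \<eta> + \<theta>)\<^sup>2"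
    have V: "V K (complex_of_real t, 0) = t\<^sup>2 * (1 + A * t + B * t\<^sup>2)" for t
      by (simp add: V_def S_def q_def A_def B_def eval_nat_numeral algebra_simps)
    have "((\<lambda>t. 1 + A * t + B * t\<^sup>2) \<longlongrightarrow> 1 + A * 0 + B * 0\<^sup>2) (at_right 0)"
      by (intro tendsto_intros)
    then have "eventually (\<lambda>t. 1 + A * t + B * t\<^sup>2 > 0) (at_right 0)"
      by (rule order_tendstoD) simp
    moreover have "eventually (\<lambda>t. t < \<delta>) (at_right 0)"
      using \<delta> eventually_at_right_field by blast
    ultimately have "eventually (\<lambda>t. 0 < t \<and> t < \<delta> \<and> V K (complex_of_real t, 0) > 0) (at_right 0)"
      using eventually_at_right_less by eventually_elim (simp add: V)
    then show "\<exists>t. 0 < t \<and> t < \<delta> \<and> V K (complex_of_real t, 0) > 0"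
      using eventually_happens trivial_limit_at_right_real by blast
  qed
qed

section \<open>From real quadratic coefficients to the complex normal form\<close>

definition quad3 :: "real \<Rightarrow> real \<Rightarrow> real \<Rightarrow> real \<Rightarrow> real \<Rightarrow> real \<Rightarrow> real \<Rightarrow> real \<Rightarrow> real \<Rightarrow> real" where
  "quad3 p11 p12 p22 p13 p23 p33 x y s =
    p11 * x\<^sup>2 + p12 * (x * y) + p22 * y\<^sup>2 + p13 * (x * s) + p23 * (y * s) + p33 * s\<^sup>2"

text \<open>Substitution of \<open>y = Re z\<close> and \<open>x = Im z / \<omega>\<close>. The real
  version feeds the equation of the damped coordinate, the complex one the equation of
  \<open>z\<close>.\<close>

lemma quad3_complex:
  fixes x y s \<omega> :: real
  assumes \<omega>: "\<omega> \<noteq> 0" and z: "z = complex_of_real y + \<i> * \<omega> * complex_of_real x"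
    and \<alpha>: "\<alpha> = Complex ((p22 - p11 / \<omega>\<^sup>2) / 4) (- p12 / (4 * \<omega>))"
    and \<delta>: "\<delta> = Complex (p23 / 2) (- p13 / (2 * \<omega>))"
  shows "quad3 p11 p12 p22 p13 p23 p33 x y s = 2 * Re (\<alpha> * z\<^sup>2) + (p11 / \<omega>\<^sup>2 + p22) / 2 * (cmod z)\<^sup>2
      + 2 * s * Re (\<delta> * z) + p33 * s\<^sup>2" (is "_ = ?R")
    and "complex_of_real (quad3 p11 p12 p22 p13 p23 p33 x y s) = \<alpha> * z\<^sup>2 + ((p11 / \<omega>\<^sup>2 + p22) / 2) * (z * cnj z)
      + cnj \<alpha> * (cnj z)\<^sup>2 + complex_of_real s * (\<delta> * z + cnj \<delta> * cnj z) + p33 * (complex_of_real s)\<^sup>2"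
proof -
  have z': "Re z = y" "Im z = \<omega> * x" by (simp_all add: z)
  show 1: "quad3 p11 p12 p22 p13 p23 p33 x y s = ?R"
  proof -
    have "(cmod z)\<^sup>2 = y\<^sup>2 + (\<omega> * x)\<^sup>2" by (simp add: cmod_power2 z')
    then show ?thesis
      unfolding quad3_def z' \<alpha> \<delta> times_complex.sel complex.sel power2_eq_square
      using \<omega> by (simp add: field_simps)
  qed
  have \<alpha>z: "\<alpha> * z\<^sup>2 + cnj \<alpha> * (cnj z)\<^sup>2 = complex_of_real (2 * Re (\<alpha> * z\<^sup>2))"
    using complex_add_cnj[of "\<alpha> * z\<^sup>2"] by (simp only: complex_cnj_mult complex_cnj_power)
  have \<delta>z: "\<delta> * z + cnj \<delta> * cnj z = complex_of_real (2 * Re (\<delta> * z))"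
    using complex_add_cnj[of "\<delta> * z"] by (simp only: complex_cnj_mult)
  have zz: "z * cnj z = complex_of_real ((cmod z)\<^sup>2)" by (simp only: complex_norm_square)
  have "\<alpha> * z\<^sup>2 + ((p11 / \<omega>\<^sup>2 + p22) / 2) * (z * cnj z) + cnj \<alpha> * (cnj z)\<^sup>2
      + complex_of_real s * (\<delta> * z + cnj \<delta> * cnj z) + p33 * (complex_of_real s)\<^sup>2
      = (\<alpha> * z\<^sup>2 + cnj \<alpha> * (cnj z)\<^sup>2) + complex_of_real ((p11 / \<omega>\<^sup>2 + p22) / 2) * (z * cnj z)
      + complex_of_real s * (\<delta> * z + cnj \<delta> * cnj z) + p33 * (complex_of_real s)\<^sup>2"
    by simp
  also have "\<dots> = complex_of_real (quad3 p11 p12 p22 p13 p23 p33 x y s)"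
    unfolding 1 \<alpha>z \<delta>z zz
    by (simp only: of_real_add of_real_mult of_real_power of_real_numeral mult_ac)
  finally show "complex_of_real (quad3 p11 p12 p22 p13 p23 p33 x y s) = \<alpha> * z\<^sup>2 + ((p11 / \<omega>\<^sup>2 + p22) / 2) * (z * cnj z)
      + cnj \<alpha> * (cnj z)\<^sup>2 + complex_of_real s * (\<delta> * z + cnj \<delta> * cnj z) + p33 * (complex_of_real s)\<^sup>2" ..
qed

text \<open>For \<open>z = Y + \<i> sqrt \<beta> X\<close> the number assumed positive is the first Lyapunov coefficient of
  \<open>hopf_chetaev_function\<close>, written in the real quadratic coefficients.\<close>

lemma subcritical_hopf_not_asymptotically_stable:
  fixes f :: "'a::euclidean_space \<Rightarrow> 'a" and X Y S :: "'a \<Rightarrow> real"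
  assumes lip: "\<And>R. \<exists>L. L-lipschitz_on (cball e R) f"
    and lin: "linear X" "linear Y" "linear S" and \<beta>: "\<beta> > 0" and \<nu>: "\<nu> > 0"
    and fX: "\<And>h. X (f (e + h)) = Y h + quad3 b11 b12 b22 b13 b23 b33 (X h) (Y h) (S h)"
    and fY: "\<And>h. Y (f (e + h)) = - \<beta> * X h + quad3 a11 a12 a22 a13 a23 a33 (X h) (Y h) (S h)"
    and fS: "\<And>h. S (f (e + h)) = - \<nu> * S h + quad3 c11 c12 c22 c13 c23 c33 (X h) (Y h) (S h)"
    and v: "X v = 0" "Y v = 1" "S v = 0"
    and lyap: "- ((a22 - a11 / \<beta> + b12) * (b11 / \<beta> + b22) + (a11 / \<beta> + a22) * (b22 - (b11 + a12) / \<beta>)) / 8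
      + (c11 / \<beta> + c22) * (a23 + b13) / (4 * \<nu>)
      + (\<nu> * ((a23 - b13) * (c22 - c11 / \<beta>) + (a13 / \<beta> + b23) * c12)
        + 2 * ((a13 + \<beta> * b23) * (c22 - c11 / \<beta>) - (a23 - b13) * c12)) / (8 * (\<nu>\<^sup>2 + 4 * \<beta>)) > 0"
  shows "\<not> asymptotically_stable f e"
proof -
  define \<omega> where "\<omega> = sqrt \<beta>"
  have \<omega>: "\<omega> > 0" and \<beta>\<omega>: "\<beta> = \<omega>\<^sup>2" using \<beta> by (simp_all add: \<omega>_def)
  define \<alpha> where "\<alpha> = (\<lambda>p11 p12 p22 :: real. Complex ((p22 - p11 / \<omega>\<^sup>2) / 4) (- p12 / (4 * \<omega>)))"
  define \<delta> where "\<delta> = (\<lambda>p13 p23 :: real. Complex (p23 / 2) (- p13 / (2 * \<omega>)))"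
  define m where "m = (\<lambda>p11 p22 :: real. (p11 / \<omega>\<^sup>2 + p22) / 2)"
  \<comment> \<open>The equation of \<open>z\<close> is that of \<open>Y\<close> plus
    \<open>\<i> * \<omega>\<close> times that of \<open>X\<close>, so its coefficients combine those
    of the two real forms in the same way.\<close>
  define a where "a = \<alpha> a11 a12 a22 + \<i> * \<omega> * \<alpha> b11 b12 b22"
  define b where "b = m a11 a22 + \<i> * \<omega> * m b11 b22"
  define c where "c = cnj (\<alpha> a11 a12 a22) + \<i> * \<omega> * cnj (\<alpha> b11 b12 b22)"
  define d where "d = \<delta> a13 a23 + \<i> * \<omega> * \<delta> b13 b23"
  define e' where "e' = cnj (\<delta> a13 a23) + \<i> * \<omega> * cnj (\<delta> b13 b23)"
  define f' where "f' = a33 + \<i> * \<omega> * b33"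
  define Z where "Z = (\<lambda>z s. \<i> * \<omega> * z + (a * z\<^sup>2 + b * (z * cnj z) + c * (cnj z)\<^sup>2)
      + complex_of_real s * (d * z + e' * cnj z) + f' * (complex_of_real s)\<^sup>2)"
  define W where "W = (\<lambda>z s. - \<nu> * s + 2 * Re (\<alpha> c11 c12 c22 * z\<^sup>2) + m c11 c22 * (cmod z)\<^sup>2
      + 2 * s * Re (\<delta> c13 c23 * z) + c33 * s\<^sup>2)"
  have pos: "Re (\<i> * a * b / \<omega> + d * (m c11 c22 / \<nu>) + e' * (\<alpha> c11 c12 c22 / (\<nu> + 2 * \<i> * \<omega>))) > 0"
  proof -
    have re_im: "Re a = (a22 - a11 / \<beta> + b12) / 4" "Im a = \<omega> * (b22 - (b11 + a12) / \<beta>) / 4"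
      "Re b = (a11 / \<beta> + a22) / 2" "Im b = \<omega> * (b11 / \<beta> + b22) / 2" "Re d = (a23 + b13) / 2"
      "Re e' = (a23 - b13) / 2" "Im e' = (a13 + \<beta> * b23) / (2 * \<omega>)"
      using \<omega> by (simp_all add: a_def b_def d_def e'_def \<alpha>_def \<delta>_def m_def \<beta>\<omega> field_simps power2_eq_square)
    have "Re (\<i> * a * b / \<omega>) = - (Re a * (Im b / \<omega>) + (Im a / \<omega>) * Re b)"
      using \<omega> by (simp add: Re_divide_of_real field_simps)
    also have "\<dots> = - ((a22 - a11 / \<beta> + b12) * (b11 / \<beta> + b22) + (a11 / \<beta> + a22) * (b22 - (b11 + a12) / \<beta>)) / 8"
    proof -
      have ab: "Im a / \<omega> = (b22 - (b11 + a12) / \<beta>) / 4" "Im b / \<omega> = (b11 / \<beta> + b22) / 2"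
        using \<omega> by (simp_all add: re_im)
      show ?thesis
        unfolding ab re_im(1,3) by (simp add: add_divide_distrib diff_divide_distrib algebra_simps)
    qed
    moreover have "Re (d * (m c11 c22 / \<nu>)) = (c11 / \<beta> + c22) * (a23 + b13) / (4 * \<nu>)"
      by (simp add: re_im m_def \<beta>\<omega> mult_ac)
    moreover have "Re (e' * (\<alpha> c11 c12 c22 / (\<nu> + 2 * \<i> * \<omega>)))
        = (\<nu> * ((a23 - b13) * (c22 - c11 / \<beta>) + (a13 / \<beta> + b23) * c12)
        + 2 * ((a13 + \<beta> * b23) * (c22 - c11 / \<beta>) - (a23 - b13) * c12)) / (8 * (\<nu>\<^sup>2 + 4 * \<beta>))"
    proof -
      let ?n = "\<nu>\<^sup>2 + 4 * \<beta>" and ?w = "\<nu> + 2 * \<i> * \<omega>" and ?\<alpha> = "\<alpha> c11 c12 c22"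
      have n: "?n > 0" using \<nu> \<beta> by (simp add: add_nonneg_pos)
      have w: "?w * (\<nu> - 2 * \<i> * \<omega>) = complex_of_real ?n"
        by (simp add: \<beta>\<omega> power2_eq_square algebra_simps)
      have "complex_of_real ?n \<noteq> 0" using n by (simp only: of_real_eq_0_iff)
      then have "\<nu> - 2 * \<i> * \<omega> \<noteq> 0" unfolding w[symmetric] by simp
      then have "?\<alpha> / ?w = ?\<alpha> * (\<nu> - 2 * \<i> * \<omega>) / (?w * (\<nu> - 2 * \<i> * \<omega>))" by simp
      then have "e' * (?\<alpha> / ?w) = e' * ?\<alpha> * (\<nu> - 2 * \<i> * \<omega>) / complex_of_real ?n"
        unfolding w by simp
      then have "Re (e' * (?\<alpha> / ?w)) = (\<nu> * (Re e' * Re ?\<alpha> - Im e' * Im ?\<alpha>)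
          + 2 * \<omega> * (Re e' * Im ?\<alpha> + Im e' * Re ?\<alpha>)) / ?n"
        by (simp only: Re_divide_of_real) (simp add: algebra_simps)
      also have "\<nu> * (Re e' * Re ?\<alpha> - Im e' * Im ?\<alpha>) + 2 * \<omega> * (Re e' * Im ?\<alpha> + Im e' * Re ?\<alpha>)
        = (\<nu> * ((a23 - b13) * (c22 - c11 / \<beta>) + (a13 / \<beta> + b23) * c12)
        + 2 * ((a13 + \<beta> * b23) * (c22 - c11 / \<beta>) - (a23 - b13) * c12)) / 8"
        using \<omega> unfolding re_im \<alpha>_def complex.sel by (simp add: \<beta>\<omega> field_simps power2_eq_square)
      finally show ?thesis by simp
    qed
    ultimately show ?thesis using lyap by (simp only: plus_complex.sel)
  qed
  have \<omega>0: "\<omega> \<noteq> 0" using \<omega> by simp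
  have Z_eq: "Z z s = \<i> * \<omega> * z + (a * z\<^sup>2 + b * (z * cnj z) + c * (cnj z)\<^sup>2)
      + complex_of_real s * (d * z + e' * cnj z) + f' * (complex_of_real s)\<^sup>2" for z s
    by (simp add: Z_def)
  have W_eq: "W z s = - \<nu> * s + 2 * Re (\<alpha> c11 c12 c22 * z\<^sup>2) + m c11 c22 * (cmod z)\<^sup>2
      + 2 * s * Re (\<delta> c13 c23 * z) + c33 * s\<^sup>2" for z s
    by (simp add: W_def)
  define P where "P = (\<lambda>k. (complex_of_real (Y k) + \<i> * \<omega> * complex_of_real (X k), S k))"
  have bl: "bounded_linear X" "bounded_linear Y" "bounded_linear S"
    using lin linear_conv_bounded_linear by auto
  have linP: "bounded_linear P" unfolding P_def
    by (intro bounded_linear_Pair bounded_linear_add bounded_linear_const_mult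
        bounded_linear_compose[OF bounded_linear_of_real] bl)
  interpret P: bounded_linear P by (rule linP)
  have Pf: "P (f x) = (Z (fst (P (x - e))) (snd (P (x - e))), W (fst (P (x - e))) (snd (P (x - e))))" for x
  proof -
    let ?h = "x - e" and ?z = "fst (P (x - e))" and ?s = "S (x - e)"
    have x: "f x = f (e + ?h)" by simp
    have z: "?z = complex_of_real (Y ?h) + \<i> * \<omega> * complex_of_real (X ?h)" by (simp add: P_def)
    note q = quad3_complex[OF less_imp_neq[OF \<omega>, symmetric] z refl refl]
    have "complex_of_real (Y (f x)) + \<i> * \<omega> * complex_of_real (X (f x)) = Z ?z ?s"
    proof -
      have "\<i> * \<omega> * ?z = \<i> * \<omega> * complex_of_real (Y ?h) - \<beta> * complex_of_real (X ?h)"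
        by (simp add: z \<beta>\<omega> power2_eq_square algebra_simps)
      then show ?thesis
        unfolding x fX fY Z_def of_real_add q(2)
        by (simp add: a_def b_def c_def d_def e'_def f'_def \<alpha>_def \<delta>_def m_def algebra_simps)
    qed
    moreover have "S (f x) = W ?z ?s"
      unfolding x fS W_def q(1) by (simp add: \<alpha>_def \<delta>_def m_def)
    ultimately show ?thesis by (simp add: P_def)
  qed
  show ?thesis
  proof (rule hopf_chetaev_function[OF \<omega>0 \<nu> pos Z_eq W_eq])
    fix V :: "complex \<times> real \<Rightarrow> real" and V' r
    assume V: "\<And>p. (V has_derivative V' p) (at p)" "V (0, 0) = 0" and r: "r > 0"
      and grow: "\<And>z s. cmod z < r \<Longrightarrow> \<bar>s\<bar> < r \<Longrightarrow> V' (z, s) (Z z s, W z s) \<ge> 0"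
      and ex: "\<And>\<delta>. \<delta> > 0 \<Longrightarrow> \<exists>t. 0 < t \<and> t < \<delta> \<and> V (complex_of_real t, 0) > 0"
    obtain C where C: "C > 0" "\<And>h. norm (P h) \<le> norm h * C" using P.pos_bounded by blast
    obtain L where L: "L-lipschitz_on (cball e (r / C)) f" using lip by blast
    show "\<not> asymptotically_stable f e"
    proof (rule chetaev_not_asymptotically_stable[where V = "\<lambda>x. V (P (x - e))"
          and V' = "\<lambda>x k. V' (P (x - e)) (P k)", OF _ _ _ L])
      show "V (P (e - e)) = 0" using V(2) by (simp add: P.zero zero_prod_def)
      show "((\<lambda>x. V (P (x - e))) has_derivative (\<lambda>k. V' (P (x - e)) (P k))) (at x)" for x
        by (rule has_derivative_compose[OF _ V(1)])
           (auto intro!: derivative_eq_intros P.has_derivative)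
      show "r / C > 0" using r C by simp
      show "V' (P (x - e)) (P (f x)) \<ge> 0" if x: "dist x e < r / C" for x
      proof -
        have "norm (P (x - e)) < r"
          using C(2)[of "x - e"] x C(1) by (simp add: dist_norm field_simps)
        then have "cmod (fst (P (x - e))) < r" "\<bar>snd (P (x - e))\<bar> < r"
          using norm_fst_le[of "fst (P (x - e))" "snd (P (x - e))"]
            norm_snd_le[of "snd (P (x - e))" "fst (P (x - e))"] by simp_all
        then show ?thesis using grow by (metis Pf prod.collapse)
      qed
      fix \<epsilon> :: real assume \<epsilon>: "\<epsilon> > 0"
      have nv: "norm v > 0" using v(2) lin(2) by (auto simp: linear_0)
      obtain t where t: "0 < t" "t < \<epsilon> / norm v" "V (complex_of_real t, 0) > 0" using ex[of "\<epsilon> / norm v"] \<epsilon> nv by auto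
      \<comment> \<open>\<open>v\<close> is the preimage of \<open>(1, 0)\<close>; its multiples
        realize the points \<open>(t, 0)\<close> at which \<open>V\<close> is known to be
        positive.\<close>
      have "P (t *\<^sub>R v) = (complex_of_real t, 0)"
        using v lin by (simp add: P_def linear_scale)
      then show "\<exists>x. dist x e < \<epsilon> \<and> V (P (x - e)) > 0"
        using t nv by (intro exI[of _ "e + t *\<^sub>R v"]) (simp add: dist_norm field_simps)
    qed
  qed
qed

section \<open>The Hopf locus of the convection system\<close>

text \<open>Reduces the sign of the first Lyapunov coefficient to that of a polynomial in
  \<open>\<beta>\<close>, \<open>\<nu>\<close> and the quadratic coefficients.\<close>

lemma first_lyapunov_coefficient_common_denominator:
  fixes \<beta> \<nu> :: real
  assumes "\<beta> > 0" and "\<nu> > 0"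
  shows "- ((a22 - a11 / \<beta> + b12) * (b11 / \<beta> + b22) + (a11 / \<beta> + a22) * (b22 - (b11 + a12) / \<beta>)) / 8
      + (c11 / \<beta> + c22) * (a23 + b13) / (4 * \<nu>)
      + (\<nu> * ((a23 - b13) * (c22 - c11 / \<beta>) + (a13 / \<beta> + b23) * c12)
        + 2 * ((a13 + \<beta> * b23) * (c22 - c11 / \<beta>) - (a23 - b13) * c12)) / (8 * (\<nu>\<^sup>2 + 4 * \<beta>))
    = (- ((\<beta> * a22 - a11 + \<beta> * b12) * (b11 + \<beta> * b22) + (a11 + \<beta> * a22) * (\<beta> * b22 - b11 - a12)) * \<nu> * (\<nu>\<^sup>2 + 4 * \<beta>)
      + 2 * \<beta> * (\<nu>\<^sup>2 + 4 * \<beta>) * (c11 + \<beta> * c22) * (a23 + b13)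
      + \<nu> * \<beta> * (\<nu> * ((a23 - b13) * (\<beta> * c22 - c11) + (a13 + \<beta> * b23) * c12)
        + 2 * ((a13 + \<beta> * b23) * (\<beta> * c22 - c11) - \<beta> * (a23 - b13) * c12)))
      / (8 * \<beta>\<^sup>2 * \<nu> * (\<nu>\<^sup>2 + 4 * \<beta>))"
proof -
  define n where "n = \<nu>\<^sup>2 + 4 * \<beta>"
  have n: "n > 0" using assms by (simp add: n_def add_nonneg_pos)
  have e: "a22 - a11 / \<beta> + b12 = (\<beta> * a22 - a11 + \<beta> * b12) / \<beta>" "b11 / \<beta> + b22 = (b11 + \<beta> * b22) / \<beta>"
    "a11 / \<beta> + a22 = (a11 + \<beta> * a22) / \<beta>" "b22 - (b11 + a12) / \<beta> = (\<beta> * b22 - b11 - a12) / \<beta>"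
    "c11 / \<beta> + c22 = (c11 + \<beta> * c22) / \<beta>" "c22 - c11 / \<beta> = (\<beta> * c22 - c11) / \<beta>"
    "a13 / \<beta> + b23 = (a13 + \<beta> * b23) / \<beta>" "(a23 - b13) * c12 = \<beta> * (a23 - b13) * c12 / \<beta>"
    using assms by (simp_all add: field_simps)
  \<comment> \<open>With the ten numerators as atoms, clearing denominators does not expand
    them.\<close>
  have gen: "- (e1 / \<beta> * (e2 / \<beta>) + e3 / \<beta> * (e4 / \<beta>)) / 8 + e5 / \<beta> * e6 / (4 * \<nu>)
      + (\<nu> * (e7 * (e8 / \<beta>) + e9 / \<beta> * c12) + 2 * (e9 * (e8 / \<beta>) - e10 / \<beta>)) / (8 * n)
    = (- (e1 * e2 + e3 * e4) * \<nu> * n + 2 * \<beta> * n * e5 * e6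
      + \<nu> * \<beta> * (\<nu> * (e7 * e8 + e9 * c12) + 2 * (e9 * e8 - e10))) / (8 * \<beta>\<^sup>2 * \<nu> * n)"
    for e1 e2 e3 e4 e5 e6 e7 e8 e9 e10 :: real
    using assms n by (simp add: divide_simps power2_eq_square) (simp add: algebra_simps)
  show ?thesis unfolding n_def[symmetric] e by (rule gen)
qed

text \<open>With \<open>s = 2 + m\<close> and \<open>\<rho> m = m + 6 + \<mu>\<close> the polynomial, multiplied by \<open>m\<^sup>4\<close>, has only positive
  coefficients; \<open>\<mu> \<ge> 0\<close> expresses \<open>A \<ge> 0\<close>.\<close>

lemma hopf_numerator_pos:
  fixes s \<rho> :: real
  assumes s: "s > 2" and \<rho>: "\<rho> * (s - 2) \<ge> s + 4"
  shows "12 * s ^ 8 * \<rho> ^ 3 - 3 * s ^ 8 * \<rho> ^ 2 + 56 * s ^ 7 * \<rho> ^ 4 + 4 * s ^ 7 * \<rho> ^ 3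
      - 88 * s ^ 7 * \<rho> ^ 2 + 12 * s ^ 7 * \<rho> + 64 * s ^ 6 * \<rho> ^ 5 - 100 * s ^ 6 * \<rho> ^ 4
      - 564 * s ^ 6 * \<rho> ^ 3 - 133 * s ^ 6 * \<rho> ^ 2 + 228 * s ^ 6 * \<rho> - 12 * s ^ 6 - 320 * s
      ^ 5 * \<rho> ^ 5 - 864 * s ^ 5 * \<rho> ^ 4 + 186 * s ^ 5 * \<rho> ^ 3 + 1976 * s ^ 5 * \<rho> ^ 2 +
      648 * s ^ 5 * \<rho> - 196 * s ^ 5 + 464 * s ^ 4 * \<rho> ^ 5 + 2676 * s ^ 4 * \<rho> ^ 4 + 4998 * s
      ^ 4 * \<rho> ^ 3 + 2408 * s ^ 4 * \<rho> ^ 2 - 2080 * s ^ 4 * \<rho> - 768 * s ^ 4 + 32 * s ^ 3 *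
      \<rho> ^ 5 - 1344 * s ^ 3 * \<rho> ^ 4 - 5800 * s ^ 3 * \<rho> ^ 3 - 9800 * s ^ 3 * \<rho> ^ 2 -
      6520 * s ^ 3 * \<rho> - 48 * s ^ 3 - 560 * s ^ 2 * \<rho> ^ 5 - 2344 * s ^ 2 * \<rho> ^ 4 - 3104 * s
      ^ 2 * \<rho> ^ 3 - 672 * s ^ 2 * \<rho> ^ 2 + 3328 * s ^ 2 * \<rho> + 3392 * s ^ 2 + 384 * s *
      \<rho> ^ 5 + 2656 * s * \<rho> ^ 4 + 6544 * s * \<rho> ^ 3 + 8320 * s * \<rho> ^ 2 + 6880 * s *
      \<rho> + 3072 * s - 64 * \<rho> ^ 5 - 736 * \<rho> ^ 4 - 2496 * \<rho> ^ 3 - 3328 * \<rho> ^ 2 -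
      1536 * \<rho> > 0" (is "?N > 0")
proof -
  define m where "m = s - 2"
  define \<mu> where "\<mu> = \<rho> * m - m - 6"
  have m: "m > 0" and \<mu>: "\<mu> \<ge> 0" and s_eq: "s = 2 + m" using assms by (auto simp: m_def \<mu>_def)
  \<comment> \<open>Four factors \<open>m\<close> clear the denominators although \<open>?N\<close>
    has degree 5 in \<open>\<rho>\<close>, because the coefficient of \<open>\<rho> ^ 5\<close>
    vanishes at \<open>s = 2\<close>.\<close>
  have "m ^ 4 * ?N = (9 * m ^ 12 + 308 * m ^ 11 + 4767 * m ^ 10 + 44222 * m ^ 9 + 274354 * m ^ 8 + 1200468 * m ^ 7 +
      3797936 * m ^ 6 + 8735648 * m ^ 5 + 14434464 * m ^ 4 + 16588224 * m ^ 3 + 12448512 * m ^ 2 + 5391360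
      * m + 995328) + (30 * m ^ 11 + 948 * m ^ 10 + 13310 * m ^ 9 + 109842 * m ^ 8 + 592462 * m ^ 7 + 2190768 * m ^ 6 +
      5648888 * m ^ 5 + 10099280 * m ^ 4 + 12168192 * m ^ 3 + 9314496 * m ^ 2 + 4036608 * m + 746496) * \<mu> + (33 * m ^ 10 + 1004 * m ^ 9 + 13111 * m ^ 8 + 97266 * m ^ 7 + 454182 * m ^ 6 + 1389972 * m ^ 5 +
      2802784 * m ^ 4 + 3636816 * m ^ 3 + 2869536 * m ^ 2 + 1233792 * m + 221184) * \<mu> ^ 2 + (12 * m ^ 9 + 420 * m ^ 8 + 5556 * m ^ 7 + 38266 * m ^ 6 + 153642 * m ^ 5 + 373368 * m ^ 4 + 544608 *
      m ^ 3 + 453456 * m ^ 2 + 193728 * m + 32256) * \<mu> ^ 3 + (56 * m ^ 7 + 1004 * m ^ 6 + 6800 * m ^ 5 + 22676 * m ^ 4 + 39904 * m ^ 3 + 36488 * m ^ 2 + 15712 * m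
      + 2304) * \<mu> ^ 4 + (64 * m ^ 5 + 448 * m ^ 4 + 1104 * m ^ 3 + 1184 * m ^ 2 + 528 * m + 64) * \<mu> ^ 5"
    unfolding \<mu>_def s_eq by algebra
  also have "\<dots> > 0"
    using m \<mu> by (intro add_pos_nonneg mult_nonneg_nonneg add_nonneg_nonneg add_pos_pos mult_pos_pos zero_le_power zero_less_power) auto
  finally show ?thesis using m by (simp add: zero_less_mult_iff)
qed

text \<open>The coefficients are those of \<open>hopf_normal_form\<close>. Over the common positive
  denominator the numerator is \<open>4 * s * \<rho>\<close> times the polynomial of
  \<open>hopf_numerator_pos\<close>. The expansion goes through the individual factors to keep each
  polynomial identity small.\<close>

lemma hopf_first_lyapunov_coefficient_pos:
  fixes s \<rho> :: real
  assumes s: "s > 2" and \<rho>: "\<rho> * (s - 2) \<ge> s + 4"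
    and \<beta>: "\<beta> = 2 * (s * \<rho> - \<rho> - 2)" and \<nu>: "\<nu> = s + 2"
    and b11: "b11 = s ^ 3 * \<rho> + s ^ 2 * \<rho> ^ 2 - 4 * s ^ 2 - 2 * s * \<rho> ^ 2 - 12 * s * \<rho> - 12 * s"
    and b12: "b12 = s ^ 3 * \<rho> + 2 * s ^ 2 * \<rho> ^ 2 + s ^ 2 * \<rho> - 6 * s ^ 2 - 4 * s * \<rho> ^ 2 - 16 * s *
      \<rho> - 20 * s + 4 * \<rho>"
    and b22: "b22 = - (2 * s ^ 2) - 3 * s * \<rho> - 7 * s + 2 * \<rho>"
    and b13: "b13 = - (s ^ 3 * \<rho>) - s ^ 3 - 2 * s ^ 2 * \<rho> ^ 2 - 2 * s ^ 2 * \<rho> - 2 * s ^ 2 + 4 * s *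
      \<rho> ^ 2 + 12 * s * \<rho> + 4 * s + 2 * \<rho> ^ 2 + 4 * \<rho>"
    and b23: "b23 = - (s ^ 3) - 2 * s ^ 2 * \<rho> - 4 * s ^ 2 - 3 * s * \<rho> - 2 * s - 2 * \<rho> ^ 2 - 4 * \<rho>"
    and a11: "a11 = - (s ^ 4 * \<rho> ^ 2) - 2 * s ^ 3 * \<rho> ^ 3 - s ^ 3 * \<rho> ^ 2 + 6 * s ^ 3 * \<rho> + 6 * s ^
      2 * \<rho> ^ 3 + 14 * s ^ 2 * \<rho> ^ 2 + 16 * s ^ 2 * \<rho> - 4 * s ^ 2 - 4 * s * \<rho> ^ 3 - 12
      * s * \<rho> ^ 2 - 8 * s + 8 * \<rho> ^ 2 + 16 * \<rho>"
    and a12: "a12 = 2 * s ^ 3 * \<rho> + 4 * s ^ 2 * \<rho> + 2 * s * \<rho> ^ 2 + 16 * s * \<rho> + 8 * s + 4 * \<rho>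
      ^ 2 + 8 * \<rho>"
    and a22: "a22 = - (s ^ 2 * \<rho>) + s ^ 2 + 4 * s * \<rho> + 6 * s"
    and a13: "a13 = s ^ 4 * \<rho> + 2 * s ^ 3 * \<rho> ^ 2 + 3 * s ^ 3 * \<rho> + 4 * s ^ 2 * \<rho> ^ 2 + 4 * s ^ 2 *
      \<rho> + 4 * s ^ 2 + 4 * s * \<rho> ^ 3 + 8 * s * \<rho> ^ 2 + 4 * s * \<rho> + 8 * s - 4 * \<rho> ^
      3 - 16 * \<rho> ^ 2 - 16 * \<rho>"
    and a23: "a23 = - (s ^ 3 * \<rho>) + s ^ 3 - 2 * s ^ 2 * \<rho> ^ 2 + 4 * s ^ 2 * \<rho> + 8 * s ^ 2 + 6 * s *
      \<rho> ^ 2 + 20 * s * \<rho> + 12 * s + 2 * \<rho> ^ 2 + 4 * \<rho>"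
    and c11: "c11 = s ^ 3 * \<rho> ^ 2 + 2 * s ^ 3 * \<rho> - 4 * s ^ 2 * \<rho> ^ 2 - 4 * s ^ 2 * \<rho> - 4 * s ^ 2 +
      4 * s * \<rho> ^ 2 + 8 * s * \<rho>"
    and c12: "c12 = s ^ 3 * \<rho> - 2 * s ^ 2 * \<rho> ^ 2 - 4 * s ^ 2 * \<rho> - 4 * s ^ 2 + 4 * s * \<rho> ^ 2 + 8 *
      s * \<rho>"
    and c22: "c22 = - (s ^ 2 * \<rho>) - s ^ 2 + 2 * s * \<rho>"
  shows "- ((a22 - a11 / \<beta> + b12) * (b11 / \<beta> + b22) + (a11 / \<beta> + a22) * (b22 - (b11 + a12) / \<beta>)) / 8
      + (c11 / \<beta> + c22) * (a23 + b13) / (4 * \<nu>)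
      + (\<nu> * ((a23 - b13) * (c22 - c11 / \<beta>) + (a13 / \<beta> + b23) * c12)
        + 2 * ((a13 + \<beta> * b23) * (c22 - c11 / \<beta>) - (a23 - b13) * c12)) / (8 * (\<nu>\<^sup>2 + 4 * \<beta>)) > 0"
proof -
  have \<rho>0: "\<rho> > 0" using s \<rho> by (smt (verit) mult_nonneg_nonpos mult_nonpos_nonneg)
  have "\<rho> * (s - 1) > 2" using s \<rho> \<rho>0 by (simp add: algebra_simps)
  then have \<beta>0: "\<beta> > 0" by (simp add: \<beta> algebra_simps)
  have \<nu>0: "\<nu> > 0" using s by (simp add: \<nu>)
  have e1: "\<beta> * a22 - a11 + \<beta> * b12 = 3 * s ^ 4 * \<rho> ^ 2 + 6 * s ^ 3 * \<rho> ^ 3 - s ^ 3 * \<rho> ^ 2 - 20 * s ^ 3 * \<rho> - 18 * s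
      ^ 2 * \<rho> ^ 3 - 46 * s ^ 2 * \<rho> ^ 2 - 34 * s ^ 2 * \<rho> + 24 * s ^ 2 + 12 * s * \<rho> ^ 3
      + 60 * s * \<rho> ^ 2 + 76 * s * \<rho> + 64 * s - 16 * \<rho> ^ 2 - 32 * \<rho>"
    unfolding \<beta> a22 a11 b12 by algebra
  have e2: "b11 + \<beta> * b22 = - (3 * s ^ 3 * \<rho>) - 5 * s ^ 2 * \<rho> ^ 2 - 10 * s ^ 2 * \<rho> + 4 * s ^ 2 + 8 * s * \<rho> ^
      2 + 14 * s * \<rho> + 16 * s - 4 * \<rho> ^ 2 - 8 * \<rho>"
    unfolding \<beta> b11 b22 by algebra
  have e3: "a11 + \<beta> * a22 = - (s ^ 4 * \<rho> ^ 2) - 2 * s ^ 3 * \<rho> ^ 3 - 3 * s ^ 3 * \<rho> ^ 2 + 8 * s ^ 3 * \<rho> + 6 *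
      s ^ 2 * \<rho> ^ 3 + 24 * s ^ 2 * \<rho> ^ 2 + 30 * s ^ 2 * \<rho> - 8 * s ^ 2 - 4 * s * \<rho> ^ 3
      - 20 * s * \<rho> ^ 2 - 28 * s * \<rho> - 32 * s + 8 * \<rho> ^ 2 + 16 * \<rho>"
    unfolding \<beta> a22 a11 by algebra
  have e4: "\<beta> * b22 - b11 - a12 = - (7 * s ^ 3 * \<rho>) - 7 * s ^ 2 * \<rho> ^ 2 - 14 * s ^ 2 * \<rho> + 12 * s ^ 2 + 10 * s * \<rho>
      ^ 2 + 22 * s * \<rho> + 32 * s - 8 * \<rho> ^ 2 - 16 * \<rho>"
    unfolding \<beta> b22 b11 a12 by algebra
  have e5: "c11 + \<beta> * c22 = - (s ^ 3 * \<rho> ^ 2) + 2 * s ^ 2 * \<rho> ^ 2 + 2 * s ^ 2 * \<rho>"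
    unfolding \<beta> c11 c22 by algebra
  have e6: "a23 + b13 = - (2 * s ^ 3 * \<rho>) - 4 * s ^ 2 * \<rho> ^ 2 + 2 * s ^ 2 * \<rho> + 6 * s ^ 2 + 10 * s * \<rho> ^
      2 + 32 * s * \<rho> + 16 * s + 4 * \<rho> ^ 2 + 8 * \<rho>"
    unfolding a23 b13 by algebra
  have e7: "a23 - b13 = 2 * s ^ 3 + 6 * s ^ 2 * \<rho> + 10 * s ^ 2 + 2 * s * \<rho> ^ 2 + 8 * s * \<rho> + 8 * s"
    unfolding a23 b13 by algebra
  have e8: "\<beta> * c22 - c11 = - (3 * s ^ 3 * \<rho> ^ 2) - 4 * s ^ 3 * \<rho> + 10 * s ^ 2 * \<rho> ^ 2 + 10 * s ^ 2 * \<rho> + 8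
      * s ^ 2 - 8 * s * \<rho> ^ 2 - 16 * s * \<rho>"
    unfolding \<beta> c22 c11 by algebra
  have e9: "a13 + \<beta> * b23 = - (s ^ 4 * \<rho>) - 2 * s ^ 3 * \<rho> ^ 2 - 3 * s ^ 3 * \<rho> + 4 * s ^ 3 + 2 * s ^ 2 * \<rho> ^
      2 + 16 * s ^ 2 * \<rho> + 20 * s ^ 2 + 6 * s * \<rho> ^ 2 + 20 * s * \<rho> + 16 * s"
    unfolding \<beta> a13 b23 by algebra
  have T1: "(\<beta> * a22 - a11 + \<beta> * b12) * (b11 + \<beta> * b22) + (a11 + \<beta> * a22) * (\<beta> * b22 - b11 - a12)
    = - (2 * s ^ 7 * \<rho> ^ 3) - 12 * s ^ 6 * \<rho> ^ 4 + 8 * s ^ 6 * \<rho> ^ 3 + 4 * s ^ 6 * \<rho> ^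
      2 - 16 * s ^ 5 * \<rho> ^ 5 + 20 * s ^ 5 * \<rho> ^ 4 + 86 * s ^ 5 * \<rho> ^ 3 - 44 * s ^ 5 *
      \<rho> ^ 2 + 76 * s ^ 4 * \<rho> ^ 5 + 148 * s ^ 4 * \<rho> ^ 4 - 92 * s ^ 4 * \<rho> ^ 3 - 288 * s
      ^ 4 * \<rho> ^ 2 + 64 * s ^ 4 * \<rho> - 124 * s ^ 3 * \<rho> ^ 5 - 460 * s ^ 3 * \<rho> ^ 4 - 624 *
      s ^ 3 * \<rho> ^ 3 - 120 * s ^ 3 * \<rho> ^ 2 + 352 * s ^ 3 * \<rho> + 80 * s ^ 2 * \<rho> ^ 5 + 424
      * s ^ 2 * \<rho> ^ 4 + 768 * s ^ 2 * \<rho> ^ 3 + 848 * s ^ 2 * \<rho> ^ 2 + 512 * s ^ 2 * \<rho> -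
      16 * s * \<rho> ^ 5 - 160 * s * \<rho> ^ 4 - 384 * s * \<rho> ^ 3 - 256 * s * \<rho> ^ 2"
    unfolding e1 e2 e3 e4 by algebra
  have T3: "\<nu> * ((a23 - b13) * (\<beta> * c22 - c11) + (a13 + \<beta> * b23) * c12)
        + 2 * ((a13 + \<beta> * b23) * (\<beta> * c22 - c11) - \<beta> * (a23 - b13) * c12)
    = - (s ^ 8 * \<rho> ^ 2) + 6 * s ^ 7 * \<rho> ^ 3 - 7 * s ^ 7 * \<rho> ^ 2 + 16 * s ^ 6 * \<rho> ^ 4 -
      44 * s ^ 6 * \<rho> ^ 2 - 4 * s ^ 6 * \<rho> - 22 * s ^ 5 * \<rho> ^ 4 - 122 * s ^ 5 * \<rho> ^ 3 -
      84 * s ^ 5 * \<rho> ^ 2 - 4 * s ^ 5 * \<rho> + 16 * s ^ 4 * \<rho> ^ 5 - 24 * s ^ 4 * \<rho> ^ 4 -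
      16 * s ^ 4 * \<rho> ^ 3 + 128 * s ^ 4 * \<rho> ^ 2 + 24 * s ^ 4 * \<rho> - 48 * s ^ 3 * \<rho> ^ 5 -
      96 * s ^ 3 * \<rho> ^ 4 + 112 * s ^ 3 * \<rho> ^ 3 + 224 * s ^ 3 * \<rho> ^ 2 + 32 * s ^ 2 * \<rho>
      ^ 5 + 176 * s ^ 2 * \<rho> ^ 4 + 320 * s ^ 2 * \<rho> ^ 3 + 192 * s ^ 2 * \<rho> ^ 2"
    unfolding e7 e8 e9 unfolding \<nu> \<beta> c12 by algebra
  have "- ((\<beta> * a22 - a11 + \<beta> * b12) * (b11 + \<beta> * b22) + (a11 + \<beta> * a22) * (\<beta> * b22 - b11 - a12)) * \<nu> * (\<nu>\<^sup>2 + 4 * \<beta>)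
      + 2 * \<beta> * (\<nu>\<^sup>2 + 4 * \<beta>) * (c11 + \<beta> * c22) * (a23 + b13)
      + \<nu> * \<beta> * (\<nu> * ((a23 - b13) * (\<beta> * c22 - c11) + (a13 + \<beta> * b23) * c12)
        + 2 * ((a13 + \<beta> * b23) * (\<beta> * c22 - c11) - \<beta> * (a23 - b13) * c12))
    = 4 * s * \<rho> * (12 * s ^ 8 * \<rho> ^ 3 - 3 * s ^ 8 * \<rho> ^ 2 + 56 * s ^ 7 * \<rho> ^ 4 + 4 * s ^ 7 * \<rho> ^ 3
      - 88 * s ^ 7 * \<rho> ^ 2 + 12 * s ^ 7 * \<rho> + 64 * s ^ 6 * \<rho> ^ 5 - 100 * s ^ 6 * \<rho> ^ 4
      - 564 * s ^ 6 * \<rho> ^ 3 - 133 * s ^ 6 * \<rho> ^ 2 + 228 * s ^ 6 * \<rho> - 12 * s ^ 6 - 320 * s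
      ^ 5 * \<rho> ^ 5 - 864 * s ^ 5 * \<rho> ^ 4 + 186 * s ^ 5 * \<rho> ^ 3 + 1976 * s ^ 5 * \<rho> ^ 2 +
      648 * s ^ 5 * \<rho> - 196 * s ^ 5 + 464 * s ^ 4 * \<rho> ^ 5 + 2676 * s ^ 4 * \<rho> ^ 4 + 4998 * s
      ^ 4 * \<rho> ^ 3 + 2408 * s ^ 4 * \<rho> ^ 2 - 2080 * s ^ 4 * \<rho> - 768 * s ^ 4 + 32 * s ^ 3 *
      \<rho> ^ 5 - 1344 * s ^ 3 * \<rho> ^ 4 - 5800 * s ^ 3 * \<rho> ^ 3 - 9800 * s ^ 3 * \<rho> ^ 2 -
      6520 * s ^ 3 * \<rho> - 48 * s ^ 3 - 560 * s ^ 2 * \<rho> ^ 5 - 2344 * s ^ 2 * \<rho> ^ 4 - 3104 * s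
      ^ 2 * \<rho> ^ 3 - 672 * s ^ 2 * \<rho> ^ 2 + 3328 * s ^ 2 * \<rho> + 3392 * s ^ 2 + 384 * s *
      \<rho> ^ 5 + 2656 * s * \<rho> ^ 4 + 6544 * s * \<rho> ^ 3 + 8320 * s * \<rho> ^ 2 + 6880 * s *
      \<rho> + 3072 * s - 64 * \<rho> ^ 5 - 736 * \<rho> ^ 4 - 2496 * \<rho> ^ 3 - 3328 * \<rho> ^ 2 -
      1536 * \<rho>)"
    unfolding T1 T3 e5 e6 unfolding \<nu> \<beta> by algebra
  also have "\<dots> > 0"
    by (intro mult_pos_pos hopf_numerator_pos s \<rho> \<rho>0) (use s in auto)
  finally show ?thesis
    unfolding first_lyapunov_coefficient_common_denominator[OF \<beta>0 \<nu>0]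
    by (rule divide_pos_pos) (use \<beta>0 \<nu>0 in \<open>auto intro!: mult_pos_pos add_pos_pos\<close>)
qed

text \<open>On the Hopf locus \<open>(s\<rho> - 2\<rho> - 4, 2, s\<rho> - 2)\<close> and \<open>(-2, 1, -1)\<close> span the plane of the imaginary
  eigenvalues, and \<open>(- s - \<rho> - 2, - 1, \<rho> + 1)\<close> is an eigenvector for \<open>- \<nu>\<close>.  \<open>F\<close>, \<open>G\<close>, \<open>H\<close> are the
  coordinates with respect to this basis divided by the factor \<open>D\<close> that makes the quadratic coefficients polynomial.\<close>

lemma hopf_normal_form:
  fixes s \<rho> \<mu> u v w :: real
  assumes \<rho>: "\<rho> \<noteq> 0" and D: "D \<noteq> 0" "D = s ^ 2 + 2 * s * \<rho> + 4 * s - 2 * \<rho>"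
    and \<mu>: "\<mu> = \<rho> * (s - 2) - s - 4" and P: "P = s * \<rho> - 1"
    and \<beta>: "\<beta> = 2 * (s * \<rho> - \<rho> - 2)" and \<nu>: "\<nu> = s + 2"
    and F: "F = (\<lambda>u v w. (\<rho> * u + (s + 3 * \<rho> + 4) * v + (s + \<rho> + 4) * w) / (\<rho> * D\<^sup>2))"
    and G: "G = (\<lambda>u v w. (- (s + 2) * \<rho> * u + (s * \<rho> - \<rho> - 2) * (s + 2 * \<rho> + 4) * v
      + (s * \<rho> - 2 * s - 4 * \<rho> - 8) * w) / (\<rho> * D\<^sup>2))"
    and H: "H = (\<lambda>u v w. (- s * u - (s + 2) * v + (s - 2) * w) / D\<^sup>2)"
    and b11: "b11 = s ^ 3 * \<rho> + s ^ 2 * \<rho> ^ 2 - 4 * s ^ 2 - 2 * s * \<rho> ^ 2 - 12 * s * \<rho> - 12 * s"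
    and b12: "b12 = s ^ 3 * \<rho> + 2 * s ^ 2 * \<rho> ^ 2 + s ^ 2 * \<rho> - 6 * s ^ 2 - 4 * s * \<rho> ^ 2 - 16 * s *
      \<rho> - 20 * s + 4 * \<rho>"
    and b22: "b22 = - (2 * s ^ 2) - 3 * s * \<rho> - 7 * s + 2 * \<rho>"
    and b13: "b13 = - (s ^ 3 * \<rho>) - s ^ 3 - 2 * s ^ 2 * \<rho> ^ 2 - 2 * s ^ 2 * \<rho> - 2 * s ^ 2 + 4 * s *
      \<rho> ^ 2 + 12 * s * \<rho> + 4 * s + 2 * \<rho> ^ 2 + 4 * \<rho>"
    and b23: "b23 = - (s ^ 3) - 2 * s ^ 2 * \<rho> - 4 * s ^ 2 - 3 * s * \<rho> - 2 * s - 2 * \<rho> ^ 2 - 4 * \<rho>"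
    and b33: "b33 = s ^ 3 + 2 * s ^ 2 * \<rho> + 7 * s ^ 2 + 10 * s * \<rho> + 17 * s + 5 * \<rho> ^ 2 + 18 * \<rho> +
      16"
    and a11: "a11 = - (s ^ 4 * \<rho> ^ 2) - 2 * s ^ 3 * \<rho> ^ 3 - s ^ 3 * \<rho> ^ 2 + 6 * s ^ 3 * \<rho> + 6 * s ^
      2 * \<rho> ^ 3 + 14 * s ^ 2 * \<rho> ^ 2 + 16 * s ^ 2 * \<rho> - 4 * s ^ 2 - 4 * s * \<rho> ^ 3 - 12
      * s * \<rho> ^ 2 - 8 * s + 8 * \<rho> ^ 2 + 16 * \<rho>"
    and a12: "a12 = 2 * s ^ 3 * \<rho> + 4 * s ^ 2 * \<rho> + 2 * s * \<rho> ^ 2 + 16 * s * \<rho> + 8 * s + 4 * \<rho>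
      ^ 2 + 8 * \<rho>"
    and a22: "a22 = - (s ^ 2 * \<rho>) + s ^ 2 + 4 * s * \<rho> + 6 * s"
    and a13: "a13 = s ^ 4 * \<rho> + 2 * s ^ 3 * \<rho> ^ 2 + 3 * s ^ 3 * \<rho> + 4 * s ^ 2 * \<rho> ^ 2 + 4 * s ^ 2 *
      \<rho> + 4 * s ^ 2 + 4 * s * \<rho> ^ 3 + 8 * s * \<rho> ^ 2 + 4 * s * \<rho> + 8 * s - 4 * \<rho> ^
      3 - 16 * \<rho> ^ 2 - 16 * \<rho>"
    and a23: "a23 = - (s ^ 3 * \<rho>) + s ^ 3 - 2 * s ^ 2 * \<rho> ^ 2 + 4 * s ^ 2 * \<rho> + 8 * s ^ 2 + 6 * s *
      \<rho> ^ 2 + 20 * s * \<rho> + 12 * s + 2 * \<rho> ^ 2 + 4 * \<rho>"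
    and a33: "a33 = 2 * s ^ 3 * \<rho> - s ^ 3 + 5 * s ^ 2 * \<rho> ^ 2 + 4 * s ^ 2 * \<rho> - 11 * s ^ 2 + 2 * s *
      \<rho> ^ 3 + 3 * s * \<rho> ^ 2 - 22 * s * \<rho> - 34 * s - 2 * \<rho> ^ 3 - 18 * \<rho> ^ 2 - 44 *
      \<rho> - 32"
    and c11: "c11 = s ^ 3 * \<rho> ^ 2 + 2 * s ^ 3 * \<rho> - 4 * s ^ 2 * \<rho> ^ 2 - 4 * s ^ 2 * \<rho> - 4 * s ^ 2 +
      4 * s * \<rho> ^ 2 + 8 * s * \<rho>"
    and c12: "c12 = s ^ 3 * \<rho> - 2 * s ^ 2 * \<rho> ^ 2 - 4 * s ^ 2 * \<rho> - 4 * s ^ 2 + 4 * s * \<rho> ^ 2 + 8 *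
      s * \<rho>"
    and c22: "c22 = - (s ^ 2 * \<rho>) - s ^ 2 + 2 * s * \<rho>"
    and c13: "c13 = - (4 * s ^ 3 * \<rho>) - 2 * s ^ 2 * \<rho> ^ 2 - 4 * s ^ 2 * \<rho> + 8 * s ^ 2 + 2 * s * \<rho> ^
      2 + 8 * s * \<rho> + 16 * s - 4 * \<rho> ^ 2 - 8 * \<rho>"
    and c23: "c23 = - (s ^ 3 * \<rho>) - 2 * s ^ 2 * \<rho> ^ 2 + s ^ 2 * \<rho> + 4 * s ^ 2 + 4 * s * \<rho> ^ 2 + 8 *
      s * \<rho> + 8 * s - 4 * \<rho>"
    and c33: "c33 = s ^ 3 * \<rho> + 2 * s ^ 2 * \<rho> ^ 2 - s ^ 2 * \<rho> - 3 * s ^ 2 - 5 * s * \<rho> ^ 2 - 16 * s *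
      \<rho> - 8 * s - 2 * \<rho> ^ 2 - 4 * \<rho>"
    and u': "u' = - s * u + \<mu> * v + s * w + \<mu> * (v * w)"
    and v': "v' = - u - v - w - u * w"
    and w': "w' = u + P * v - w + P * (u * v)"
  shows "F u' v' w' = G u v w + quad3 b11 b12 b22 b13 b23 b33 (F u v w) (G u v w) (H u v w)"
    and "G u' v' w' = - \<beta> * F u v w + quad3 a11 a12 a22 a13 a23 a33 (F u v w) (G u v w) (H u v w)"
    and "H u' v' w' = - \<nu> * H u v w + quad3 c11 c12 c22 c13 c23 c33 (F u v w) (G u v w) (H u v w)"
proof -
  define x y z where "x = F u v w" and "y = G u v w" and "z = H u v w"
  \<comment> \<open>Recombination of the basis vectors with the coordinates \<open>x\<close>,
    \<open>y\<close>, \<open>z\<close>; up to the factor \<open>D\<close> it inverts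
    \<open>F\<close>, \<open>G\<close>, \<open>H\<close>.\<close>
  define U where "U = (s * \<rho> - 2 * \<rho> - 4) * x - 2 * y - (s + \<rho> + 2) * z"
  define V where "V = 2 * x + y - z"
  define W where "W = (s * \<rho> - 2) * x - y + (\<rho> + 1) * z"
  have x: "\<rho> * D\<^sup>2 * x = \<rho> * u + (s + 3 * \<rho> + 4) * v + (s + \<rho> + 4) * w"
    and y: "\<rho> * D\<^sup>2 * y = - (s + 2) * \<rho> * u + (s * \<rho> - \<rho> - 2) * (s + 2 * \<rho> + 4) * v
      + (s * \<rho> - 2 * s - 4 * \<rho> - 8) * w"
    and z: "\<rho> * D\<^sup>2 * z = \<rho> * (- s * u - (s + 2) * v + (s - 2) * w)"
    using \<rho> D(1) by (simp_all add: x_def y_def z_def F G H)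
  have "\<rho> * D\<^sup>2 * U = \<rho> * D * u" "\<rho> * D\<^sup>2 * V = \<rho> * D * v" "\<rho> * D\<^sup>2 * W = \<rho> * D * w"
    using x y z unfolding U_def V_def W_def D(2) by algebra+
  then have uvw: "u = D * U" "v = D * V" "w = D * W"
    using \<rho> D(1) by (simp_all add: power2_eq_square)
  \<comment> \<open>The nonlinear terms are multiples of \<open>v * w\<close>, \<open>u * w\<close>
    and \<open>u * v\<close>. Each product contributes \<open>D\<^sup>2\<close>, which cancels the
    denominator of the coordinates, so that these identities are free of \<open>D\<close>.\<close>
  have qF: "\<rho> * (\<mu> * (V * W)) - (s + 3 * \<rho> + 4) * (U * W) + (s + \<rho> + 4) * (P * (U * V))
      = \<rho> * quad3 b11 b12 b22 b13 b23 b33 x y z"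
    unfolding quad3_def U_def V_def W_def \<mu> P b11 b12 b22 b13 b23 b33 by algebra
  have qG: "- (s + 2) * \<rho> * (\<mu> * (V * W)) - (s * \<rho> - \<rho> - 2) * (s + 2 * \<rho> + 4) * (U * W)
      + (s * \<rho> - 2 * s - 4 * \<rho> - 8) * (P * (U * V)) = \<rho> * quad3 a11 a12 a22 a13 a23 a33 x y z"
    unfolding quad3_def U_def V_def W_def \<mu> P a11 a12 a22 a13 a23 a33 by algebra
  have qH: "- s * (\<mu> * (V * W)) + (s + 2) * (U * W) + (s - 2) * (P * (U * V)) = quad3 c11 c12 c22 c13 c23 c33 x y z"
    unfolding quad3_def U_def V_def W_def \<mu> P c11 c12 c22 c13 c23 c33 by algebra
  have nz: "\<rho> * D\<^sup>2 \<noteq> 0" using \<rho> D(1) by simp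
  have "\<rho> * D\<^sup>2 * F u' v' w' = \<rho> * u' + (s + 3 * \<rho> + 4) * v' + (s + \<rho> + 4) * w'"
    using nz by (simp add: F)
  also have "\<dots> = \<rho> * D\<^sup>2 * y + D\<^sup>2 * (\<rho> * (\<mu> * (V * W)) - (s + 3 * \<rho> + 4) * (U * W) + (s + \<rho> + 4) * (P * (U * V)))"
    unfolding y u' v' w' \<mu> P uvw by algebra
  also have "\<dots> = \<rho> * D\<^sup>2 * (y + quad3 b11 b12 b22 b13 b23 b33 x y z)"
    unfolding qF by algebra
  finally show "F u' v' w' = G u v w + quad3 b11 b12 b22 b13 b23 b33 (F u v w) (G u v w) (H u v w)"
    using nz unfolding x_def y_def z_def by (metis mult_left_cancel)
  have "\<rho> * D\<^sup>2 * G u' v' w' = - (s + 2) * \<rho> * u' + (s * \<rho> - \<rho> - 2) * (s + 2 * \<rho> + 4) * v'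
      + (s * \<rho> - 2 * s - 4 * \<rho> - 8) * w'"
    using nz by (simp add: G)
  also have "\<dots> = - \<beta> * (\<rho> * D\<^sup>2 * x) + D\<^sup>2 * (- (s + 2) * \<rho> * (\<mu> * (V * W))
      - (s * \<rho> - \<rho> - 2) * (s + 2 * \<rho> + 4) * (U * W) + (s * \<rho> - 2 * s - 4 * \<rho> - 8) * (P * (U * V)))"
    unfolding x u' v' w' \<mu> P \<beta> uvw by algebra
  also have "\<dots> = \<rho> * D\<^sup>2 * (- \<beta> * x + quad3 a11 a12 a22 a13 a23 a33 x y z)"
    unfolding qG by algebra
  finally show "G u' v' w' = - \<beta> * F u v w + quad3 a11 a12 a22 a13 a23 a33 (F u v w) (G u v w) (H u v w)"
    using nz unfolding x_def y_def z_def by (metis mult_left_cancel)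
  have "\<rho> * D\<^sup>2 * H u' v' w' = \<rho> * (- s * u' - (s + 2) * v' + (s - 2) * w')"
    using nz by (simp add: H)
  also have "\<dots> = - \<nu> * (\<rho> * D\<^sup>2 * z) + \<rho> * D\<^sup>2 * (- s * (\<mu> * (V * W)) + (s + 2) * (U * W) + (s - 2) * (P * (U * V)))"
    unfolding z u' v' w' \<mu> P \<nu> uvw by algebra
  also have "\<dots> = \<rho> * D\<^sup>2 * (- \<nu> * z + quad3 c11 c12 c22 c13 c23 c33 x y z)"
    unfolding qH by algebra
  finally show "H u' v' w' = - \<nu> * H u v w + quad3 c11 c12 c22 c13 c23 c33 (F u v w) (G u v w) (H u v w)"
    using nz unfolding x_def y_def z_def by (metis mult_left_cancel)
qed

section \<open>The convection system\<close>

lemma vec3_eq_iff: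
  fixes v w :: "real^3"
  shows "v = w \<longleftrightarrow> v $ 1 = w $ 1 \<and> v $ 2 = w $ 2 \<and> v $ 3 = w $ 3"
  by (simp add: vec_eq_iff forall_3)

lemma vfield_nth:
  "vfield A C \<sigma> Ra v $ 1 = A * v $ 2 * v $ 3 + C * v $ 3 - \<sigma> * v $ 1"
  "vfield A C \<sigma> Ra v $ 2 = - v $ 1 * v $ 3 + Ra - v $ 2"
  "vfield A C \<sigma> Ra v $ 3 = - v $ 3 + v $ 1 * v $ 2"
  by (simp_all add: vfield_def Let_def)

definition vfield_jacobian :: "real \<Rightarrow> real \<Rightarrow> real \<Rightarrow> real^3 \<Rightarrow> real^3 \<Rightarrow> real^3" where
  "vfield_jacobian A C \<sigma> e h = vector [A * e $ 2 * h $ 3 + A * e $ 3 * h $ 2 + C * h $ 3 - \<sigma> * h $ 1,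
     - e $ 1 * h $ 3 - e $ 3 * h $ 1 - h $ 2, - h $ 3 + e $ 1 * h $ 2 + e $ 2 * h $ 1]"

lemma vfield_jacobian_nth:
  "vfield_jacobian A C \<sigma> e h $ 1 = A * e $ 2 * h $ 3 + A * e $ 3 * h $ 2 + C * h $ 3 - \<sigma> * h $ 1"
  "vfield_jacobian A C \<sigma> e h $ 2 = - e $ 1 * h $ 3 - e $ 3 * h $ 1 - h $ 2"
  "vfield_jacobian A C \<sigma> e h $ 3 = - h $ 3 + e $ 1 * h $ 2 + e $ 2 * h $ 1"
  by (simp_all add: vfield_jacobian_def)

lemma vfield_has_derivative:
  "(vfield A C \<sigma> Ra has_derivative vfield_jacobian A C \<sigma> e) (at e)"
proof -
  have v: "vfield A C \<sigma> Ra = (\<lambda>v. (A * v $ 2 * v $ 3 + C * v $ 3 - \<sigma> * v $ 1) *\<^sub>R axis 1 1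
      + (- v $ 1 * v $ 3 + Ra - v $ 2) *\<^sub>R axis 2 1 + (- v $ 3 + v $ 1 * v $ 2) *\<^sub>R axis 3 1)"
    by (rule ext) (simp add: vec3_eq_iff vfield_nth axis_def)
  show ?thesis unfolding v
    by (rule derivative_eq_intros bounded_linear.has_derivative[OF bounded_linear_vec_nth] refl)+
       (rule ext, simp add: vec3_eq_iff vfield_jacobian_nth axis_def algebra_simps)
qed

lemma vfield_lipschitz: "\<exists>L. L-lipschitz_on (cball e R) (vfield A C \<sigma> Ra)"
proof -
  define M where "M = norm e + \<bar>R\<bar>"
  have M: "\<bar>v $ i\<bar> \<le> M" if "v \<in> cball e R" for v and i :: 3
  proof -
    have "\<bar>v $ i\<bar> \<le> norm v" using component_le_norm_cart[of v i] by simp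
    also have "norm v \<le> norm e + norm (v - e)" using norm_triangle_ineq[of e "v - e"] by simp
    finally show ?thesis using that by (simp add: M_def dist_norm norm_minus_commute)
  qed
  have M0: "M \<ge> 0" by (simp add: M_def)
  define L where "L = (2 * \<bar>A\<bar> * M + \<bar>C\<bar> + \<bar>\<sigma>\<bar>) + (2 * M + 1) + (2 * M + 1)"
  show ?thesis
  proof (intro exI lipschitz_onI)
    show "L \<ge> 0" using M0 by (simp add: L_def)
    fix v w assume vw: "v \<in> cball e R" "w \<in> cball e R"
    let ?d = "dist v w"
    have d: "\<bar>v $ i - w $ i\<bar> \<le> ?d" for i
      using component_le_norm_cart[of "v - w" i] by (simp add: dist_norm)
    have p: "\<bar>v $ i * v $ j - w $ i * w $ j\<bar> \<le> 2 * M * ?d" for i j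
    proof -
      have "v $ i * v $ j - w $ i * w $ j = v $ i * (v $ j - w $ j) + (v $ i - w $ i) * w $ j"
        by (simp add: algebra_simps)
      also have "\<bar>\<dots>\<bar> \<le> \<bar>v $ i\<bar> * \<bar>v $ j - w $ j\<bar> + \<bar>v $ i - w $ i\<bar> * \<bar>w $ j\<bar>"
        by (metis abs_mult abs_triangle_ineq)
      also have "\<dots> \<le> M * ?d + ?d * M"
        by (intro add_mono mult_mono M d vw M0) auto
      finally show ?thesis by simp
    qed
    have c: "\<bar>k * x\<bar> \<le> \<bar>k\<bar> * y" if "\<bar>x\<bar> \<le> y" for k x y :: real
      using that by (simp add: abs_mult mult_left_mono)
    let ?F = "\<lambda>i. vfield A C \<sigma> Ra v $ i - vfield A C \<sigma> Ra w $ i"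
    have "?F 1 = A * (v $ 2 * v $ 3 - w $ 2 * w $ 3) + C * (v $ 3 - w $ 3) - \<sigma> * (v $ 1 - w $ 1)"
      by (simp add: vfield_nth algebra_simps)
    then have "\<bar>?F 1\<bar> \<le> \<bar>A\<bar> * (2 * M * ?d) + \<bar>C\<bar> * ?d + \<bar>\<sigma>\<bar> * ?d"
      using c[OF p, of A 2 3] c[OF d, of C 3] c[OF d, of \<sigma> 1] by linarith
    then have "\<bar>?F 1\<bar> \<le> (2 * \<bar>A\<bar> * M + \<bar>C\<bar> + \<bar>\<sigma>\<bar>) * ?d" by (simp add: algebra_simps)
    moreover have "\<bar>?F 2\<bar> \<le> (2 * M + 1) * ?d"
      using p[of 1 3] d[of 2] by (simp add: vfield_nth algebra_simps)
    moreover have "\<bar>?F 3\<bar> \<le> (2 * M + 1) * ?d"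
      using p[of 1 2] d[of 3] by (simp add: vfield_nth algebra_simps)
    moreover have "dist (vfield A C \<sigma> Ra v) (vfield A C \<sigma> Ra w) \<le> \<bar>?F 1\<bar> + \<bar>?F 2\<bar> + \<bar>?F 3\<bar>"
      using norm_le_l1_cart[of "vfield A C \<sigma> Ra v - vfield A C \<sigma> Ra w"] by (simp add: dist_norm sum_3)
    ultimately show "dist (vfield A C \<sigma> Ra v) (vfield A C \<sigma> Ra w) \<le> L * ?d"
      by (simp add: L_def algebra_simps)
  qed
qed

lemma bounded_bilinear_nth_mult: "bounded_bilinear (\<lambda>(h :: real^3) (k :: real^3). c * (h $ i) * k $ j)"
  by (rule bounded_bilinear.comp[OF bounded_bilinear_mult])
     (auto intro!: bounded_linear_const_mult bounded_linear_vec_nth)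

lemma linear_nth3: "linear (\<lambda>h :: real^3. h $ i)"
  by (rule bounded_linear.linear[OF bounded_linear_vec_nth])

text \<open>The square root in \<open>eta\<close>, \<open>L_coef\<close> and \<open>R_coef\<close>
  is linear in \<open>Ra_star\<close>, so all later parameter identities are polynomial modulo the
  quadratic relation.\<close>

lemma Ra_star_root:
  assumes "A > 0" "C > 0" "\<sigma> > 0"
  shows "Ra_star A C \<sigma> > 0" and "A * (Ra_star A C \<sigma>)\<^sup>2 + C * Ra_star A C \<sigma> = \<sigma>"
    and "sqrt (C\<^sup>2 + 4 * A * \<sigma>) = 2 * A * Ra_star A C \<sigma> + C"
proof -
  have "sqrt (C\<^sup>2) < sqrt (C\<^sup>2 + 4 * A * \<sigma>)"
    using assms by (intro real_sqrt_less_mono) simp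
  then show "Ra_star A C \<sigma> > 0" using assms by (simp add: Ra_star_def)
  show sq: "sqrt (C\<^sup>2 + 4 * A * \<sigma>) = 2 * A * Ra_star A C \<sigma> + C"
    using assms by (simp add: Ra_star_def)
  have "(sqrt (C\<^sup>2 + 4 * A * \<sigma>))\<^sup>2 = C\<^sup>2 + 4 * A * \<sigma>" using assms by (intro real_sqrt_pow2) simp
  then have "4 * A * (A * (Ra_star A C \<sigma>)\<^sup>2 + C * Ra_star A C \<sigma>) = 4 * A * \<sigma>"
    unfolding sq by (simp add: power2_eq_square algebra_simps)
  then show "A * (Ra_star A C \<sigma>)\<^sup>2 + C * Ra_star A C \<sigma> = \<sigma>" using assms by simp
qed

text \<open>\<open>Ra * (A * Ra + C) - \<sigma>\<close> is minus the determinant of the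
  \<open>(x, z)\<close> block of the linearization at \<open>E_zero\<close>; as a quadratic in
  \<open>Ra\<close> it has the factor \<open>Ra - Ra_star\<close>, and the other factor is
  positive.\<close>

lemma less_Ra_star_iff:
  assumes "A > 0" "C > 0" "\<sigma> > 0" "Ra > 0"
  shows "Ra < Ra_star A C \<sigma> \<longleftrightarrow> Ra * (A * Ra + C) < \<sigma>"
    and "Ra = Ra_star A C \<sigma> \<longleftrightarrow> Ra * (A * Ra + C) = \<sigma>"
proof -
  let ?y = "Ra_star A C \<sigma>"
  have y: "?y > 0" "A * ?y\<^sup>2 + C * ?y = \<sigma>" using Ra_star_root assms by blast+
  have "Ra * (A * Ra + C) - \<sigma> = (Ra - ?y) * (A * (Ra + ?y) + C)"
    using y(2) by (simp add: power2_eq_square algebra_simps)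
  moreover have "A * (Ra + ?y) + C > 0" using assms y(1) by (simp add: add_pos_pos)
  ultimately show "Ra < ?y \<longleftrightarrow> Ra * (A * Ra + C) < \<sigma>" "Ra = ?y \<longleftrightarrow> Ra * (A * Ra + C) = \<sigma>"
    by (smt (verit) mult_pos_pos mult_neg_pos mult_eq_0_iff)+
qed

section \<open>The equilibrium \<open>E_zero\<close>\<close>

lemma E_zero_nth: "E_zero Ra $ 1 = 0" "E_zero Ra $ 2 = Ra" "E_zero Ra $ 3 = 0"
  by (simp_all add: E_zero_def)

lemma vfield_E_zero: "vfield A C \<sigma> Ra (E_zero Ra) = 0"
  by (simp add: vec3_eq_iff vfield_nth E_zero_nth)

text \<open>The weights \<open>Ra\<close> and \<open>A * Ra + C\<close> make the off-diagonal
  entries of the \<open>(x, z)\<close> block equal. Completing the square in the derivative then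
  leaves the determinant \<open>\<sigma> - Ra * (A * Ra + C)\<close> as the coefficient that decides
  the sign.\<close>

lemma E_zero_exponentially_stable:
  assumes pos: "A > 0" "C > 0" "\<sigma> > 0" "Ra > 0" and less: "Ra * (A * Ra + C) < \<sigma>"
  shows "exponentially_stable (vfield A C \<sigma> Ra) (E_zero Ra)"
proof -
  let ?c = "A * Ra + C" and ?J = "vfield_jacobian A C \<sigma> (E_zero Ra)"
  have c: "?c > 0" using pos by (simp add: add_pos_pos)
  define B where "B = (\<lambda>(h :: real^3) (k :: real^3). Ra * h $ 1 * k $ 1 + 1 * h $ 2 * k $ 2 + ?c * h $ 3 * k $ 3)"
  show ?thesis
  proof (rule quadratic_lyapunov_exponentially_stable[where f = "vfield A C \<sigma> Ra" and e = "E_zero Ra",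
        OF vfield_E_zero vfield_has_derivative])
    show "bounded_bilinear B" unfolding B_def
      by (intro bounded_bilinear_add_fun bounded_bilinear_nth_mult)
    fix h :: "real^3" assume h: "h \<noteq> 0"
    then have h': "h $ 1 \<noteq> 0 \<or> h $ 2 \<noteq> 0 \<or> h $ 3 \<noteq> 0" by (simp add: vec3_eq_iff)
    have sq: "Ra * (h $ 1)\<^sup>2 \<ge> 0" "(h $ 2)\<^sup>2 \<ge> 0" "?c * (h $ 3)\<^sup>2 \<ge> 0" using pos c by auto
    have "Ra * (h $ 1)\<^sup>2 > 0 \<or> (h $ 2)\<^sup>2 > 0 \<or> ?c * (h $ 3)\<^sup>2 > 0" using h' pos c by auto
    moreover have "B h h = Ra * (h $ 1)\<^sup>2 + (h $ 2)\<^sup>2 + ?c * (h $ 3)\<^sup>2"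
      by (simp add: B_def power2_eq_square)
    ultimately show "B h h > 0" using sq by linarith
    let ?x = "Ra * (\<sigma> - Ra * ?c) * (h $ 1)\<^sup>2" and ?z = "?c * (h $ 3 - Ra * h $ 1)\<^sup>2"
    have BJ: "B h (?J h) + B (?J h) h = - 2 * (?x + ?z + (h $ 2)\<^sup>2)"
      by (simp add: B_def vfield_jacobian_nth E_zero_nth power2_eq_square algebra_simps)
    have "?x \<ge> 0" "?z \<ge> 0" using pos c less by auto
    moreover have "?x > 0 \<or> ?z > 0 \<or> (h $ 2)\<^sup>2 > 0"
    proof (cases "h $ 1 = 0")
      case True
      then show ?thesis using h' c by auto
    qed (use pos less in auto)
    ultimately have "?x + ?z + (h $ 2)\<^sup>2 > 0" using sq(2) by linarith
    then show "B h (?J h) + B (?J h) h < 0" unfolding BJ by (rule mult_neg_pos[rotated]) simp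
  qed
qed

text \<open>Up to the damped \<open>y\<close>-direction the linearization at \<open>E_zero\<close> is self-adjoint with respect to
  \<open>diag (Ra, A Ra + C)\<close>, so that \<open>\<langle>h, J h\<rangle>\<close> grows at the rate \<open>2 \<langle>J h, J h\<rangle>\<close>.\<close>

lemma E_zero_not_asymptotically_stable:
  assumes pos: "A > 0" "C > 0" "\<sigma> > 0" "Ra > 0" and greater: "Ra * (A * Ra + C) > \<sigma>"
  shows "\<not> asymptotically_stable (vfield A C \<sigma> Ra) (E_zero Ra)"
proof -
  let ?c = "A * Ra + C" and ?J = "vfield_jacobian A C \<sigma> (E_zero Ra)"
  have c: "?c > 0" using pos by (simp add: add_pos_pos)
  define B where "B = (\<lambda>(h :: real^3) (k :: real^3). (- Ra * \<sigma>) * h $ 1 * k $ 1 + (Ra * ?c) * h $ 1 * k $ 3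
      + (Ra * ?c) * h $ 3 * k $ 1 + (- ?c) * h $ 3 * k $ 3 + (- 1) * h $ 2 * k $ 2)"
  \<comment> \<open>Among the vectors \<open>(1, 0, t)\<close> the form is largest at
    \<open>t = Ra\<close>, with a positive value exactly beyond the threshold.\<close>
  define v :: "real^3" where "v = vector [1, 0, Ra]"
  show ?thesis
  proof (rule quadratic_chetaev_not_asymptotically_stable[where f = "vfield A C \<sigma> Ra" and e = "E_zero Ra",
        OF vfield_E_zero vfield_has_derivative _ vfield_lipschitz])
    show "bounded_bilinear B" unfolding B_def
      by (intro bounded_bilinear_add_fun bounded_bilinear_nth_mult)
    have "B v v = Ra * (Ra * ?c - \<sigma>)" by (simp add: B_def v_def algebra_simps)
    then show "B v v > 0" using pos greater by simp
    fix h :: "real^3" assume h: "h \<noteq> 0"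
    then have h': "h $ 1 \<noteq> 0 \<or> h $ 2 \<noteq> 0 \<or> h $ 3 \<noteq> 0" by (simp add: vec3_eq_iff)
    let ?x = "Ra * (?c * h $ 3 - \<sigma> * h $ 1)\<^sup>2" and ?z = "?c * (h $ 3 - Ra * h $ 1)\<^sup>2"
    have BJ: "B h (?J h) + B (?J h) h = 2 * (?x + ?z + (h $ 2)\<^sup>2)"
      by (simp add: B_def vfield_jacobian_nth E_zero_nth power2_eq_square algebra_simps)
    have "?x \<ge> 0" "?z \<ge> 0" "(h $ 2)\<^sup>2 \<ge> 0" using pos c by auto
    moreover have "?x > 0 \<or> ?z > 0 \<or> (h $ 2)\<^sup>2 > 0"
    proof (rule ccontr)
      assume "\<not> ?thesis"
      then have z: "h $ 3 = Ra * h $ 1" "?c * h $ 3 = \<sigma> * h $ 1" "h $ 2 = 0"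
        using pos c by (auto simp: zero_less_mult_iff)
      then have "(Ra * ?c - \<sigma>) * h $ 1 = 0" by (simp add: algebra_simps)
      then show False using greater z h' by auto
    qed
    ultimately have "?x + ?z + (h $ 2)\<^sup>2 > 0" by linarith
    then show "B h (?J h) + B (?J h) h > 0" unfolding BJ by (rule mult_pos_pos[OF zero_less_numeral])
  qed
qed

lemma E_zero_not_exponentially_stable:
  assumes pos: "A > 0" "C > 0" "\<sigma> > 0" "Ra > 0" and eq: "Ra * (A * Ra + C) = \<sigma>"
  shows "\<not> exponentially_stable (vfield A C \<sigma> Ra) (E_zero Ra)"
proof -
  obtain L where L: "L-lipschitz_on (cball (E_zero Ra) 1) (vfield A C \<sigma> Ra)"
    using vfield_lipschitz by blast
  \<comment> \<open>At the threshold this is a left null vector of the linearization: the linear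
    part of its speed is \<open>Ra * (A * Ra + C) - \<sigma>\<close> times the third
    coordinate.\<close>
  define \<psi> where "\<psi> = (\<lambda>h :: real^3. Ra * h $ 1 + \<sigma> * h $ 3)"
  show ?thesis
  proof (rule zero_eigenvalue_not_exponentially_stable[OF _ L])
    show "bounded_linear \<psi>" unfolding \<psi>_def
      by (intro bounded_linear_add bounded_linear_const_mult bounded_linear_vec_nth)
    show "\<psi> (axis 1 1) \<noteq> 0" using pos by (simp add: \<psi>_def axis_def)
    fix x
    let ?h = "x - E_zero Ra"
    have x: "x $ 1 = ?h $ 1" "x $ 2 = Ra + ?h $ 2" "x $ 3 = ?h $ 3" by (simp_all add: E_zero_nth)
    have "\<psi> (vfield A C \<sigma> Ra x) = A * Ra * (?h $ 2 * ?h $ 3) + \<sigma> * (?h $ 1 * ?h $ 2)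
        + (Ra * (A * Ra + C) - \<sigma>) * ?h $ 3"
      unfolding \<psi>_def vfield_nth x by (simp add: algebra_simps)
    then have "\<psi> (vfield A C \<sigma> Ra x) = A * Ra * (?h $ 2 * ?h $ 3) + \<sigma> * (?h $ 1 * ?h $ 2)"
      using eq by simp
    also have "\<bar>\<dots>\<bar> \<le> A * Ra * (\<bar>?h $ 2\<bar> * \<bar>?h $ 3\<bar>) + \<sigma> * (\<bar>?h $ 1\<bar> * \<bar>?h $ 2\<bar>)"
      using pos abs_triangle_ineq[of "A * Ra * (?h $ 2 * ?h $ 3)" "\<sigma> * (?h $ 1 * ?h $ 2)"]
      by (simp only: abs_mult abs_of_pos)
    also have "\<dots> \<le> A * Ra * (norm ?h * norm ?h) + \<sigma> * (norm ?h * norm ?h)"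
      using pos component_le_norm_cart[of ?h] by (intro add_mono mult_left_mono mult_mono) auto
    finally show "\<bar>\<psi> (vfield A C \<sigma> Ra x)\<bar> \<le> (A * Ra + \<sigma>) * (dist x (E_zero Ra))\<^sup>2"
      by (simp add: dist_norm power2_eq_square algebra_simps)
  qed simp
qed

section \<open>The equilibria \<open>E_plus\<close> and \<open>E_minus\<close>\<close>

lemma eta_eq:
  assumes "A > 0" "C > 0" "\<sigma> > 0"
  shows "eta A C \<sigma> Ra = Ra / Ra_star A C \<sigma> - 1"
proof -
  let ?y = "Ra_star A C \<sigma>"
  note y = Ra_star_root[OF assms]
  have "?y * (C + (2 * A * ?y + C)) = 2 * \<sigma>" using y(2) by (simp add: power2_eq_square algebra_simps)
  then have "?y * (C * Ra - 2 * \<sigma> + Ra * (2 * A * ?y + C)) = 2 * \<sigma> * (Ra - ?y)" by algebra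
  then show ?thesis using y(1) assms unfolding eta_def y(3) by (simp add: field_simps)
qed

text \<open>A signed \<open>p\<close> treats the mirror-symmetric pair at once; since
  \<open>\<eta> + 1\<close> is \<open>Ra / Ra_star\<close>, the second coordinate is
  \<open>Ra_star\<close> for every \<open>Ra\<close>.\<close>

lemma E_plus_minus_form:
  assumes "A > 0" "C > 0" "\<sigma> > 0" "Ra > Ra_star A C \<sigma>" and E: "E \<in> {E_plus A C \<sigma> Ra, E_minus A C \<sigma> Ra}"
  obtains p where "p\<^sup>2 = Ra / Ra_star A C \<sigma> - 1"
    and "E $ 1 = p" "E $ 2 = Ra_star A C \<sigma>" "E $ 3 = p * Ra_star A C \<sigma>"
proof -
  let ?y = "Ra_star A C \<sigma>" and ?\<eta> = "eta A C \<sigma> Ra"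
  have y: "?y > 0" using Ra_star_root assms by blast
  have \<eta>: "?\<eta> = Ra / ?y - 1" using eta_eq assms by blast
  have \<eta>0: "?\<eta> \<ge> 0" unfolding \<eta> using assms y by simp
  have q: "Ra / (?\<eta> + 1) = ?y" "Ra * t / (?\<eta> + 1) = t * ?y" for t
    unfolding \<eta> using assms y by simp_all
  from E consider "E = E_plus A C \<sigma> Ra" | "E = E_minus A C \<sigma> Ra" by blast
  then show thesis
  proof cases
    case 1
    show thesis by (rule that[of "sqrt ?\<eta>"]) (use \<eta>0 in \<open>simp_all add: 1 E_plus_def Let_def q \<eta>[symmetric]\<close>)
  next
    case 2
    show thesis by (rule that[of "- sqrt ?\<eta>"]) (use \<eta>0 in \<open>simp_all add: 2 E_minus_def Let_def q \<eta>[symmetric]\<close>)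
  qed
qed

text \<open>At the nontrivial equilibria, with \<open>y = Ra_star\<close>, the deviation variables
  \<open>u = h\<^sub>1 / p\<close>, \<open>v = h\<^sub>2 / (y p\<^sup>2)\<close>, \<open>w = h\<^sub>3 / (y p)\<close> turn the coefficients of the system into
  functions of \<open>\<sigma>\<close>, \<open>p\<^sup>2\<close> and \<open>A y\<^sup>2\<close> alone.\<close>

lemma vfield_scaled_deviation:
  fixes h :: "real^3"
  assumes y: "y > 0" "A * y\<^sup>2 + C * y = \<sigma>" and p: "p \<noteq> 0" "p\<^sup>2 = Ra / y - 1"
    and e: "e $ 1 = p" "e $ 2 = y" "e $ 3 = p * y"
    and uvw: "u = h $ 1 / p" "v = h $ 2 / (y * p\<^sup>2)" "w = h $ 3 / (y * p)"
  shows "vfield A C \<sigma> Ra (e + h) $ 1 / p = - \<sigma> * u + A * y\<^sup>2 * p\<^sup>2 * v + \<sigma> * w + A * y\<^sup>2 * p\<^sup>2 * (v * w)"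
    and "vfield A C \<sigma> Ra (e + h) $ 2 / (y * p\<^sup>2) = - u - v - w - u * w"
    and "vfield A C \<sigma> Ra (e + h) $ 3 / (y * p) = u + p\<^sup>2 * v - w + p\<^sup>2 * (u * v)"
proof -
  have h: "h $ 1 = p * u" "h $ 2 = y * p\<^sup>2 * v" "h $ 3 = y * p * w" using y(1) p(1) by (simp_all add: uvw)
  have Ra: "Ra = y * (p\<^sup>2 + 1)" using y p by simp
  have "vfield A C \<sigma> Ra (e + h) $ 1 = p * (- \<sigma> * u + A * y\<^sup>2 * p\<^sup>2 * v + \<sigma> * w + A * y\<^sup>2 * p\<^sup>2 * (v * w))"
    unfolding vfield_nth vector_add_component e h y(2)[symmetric] by algebra
  then show "vfield A C \<sigma> Ra (e + h) $ 1 / p = - \<sigma> * u + A * y\<^sup>2 * p\<^sup>2 * v + \<sigma> * w + A * y\<^sup>2 * p\<^sup>2 * (v * w)"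
    using p by simp
  have "vfield A C \<sigma> Ra (e + h) $ 2 = y * p\<^sup>2 * (- u - v - w - u * w)"
    unfolding vfield_nth vector_add_component e h Ra by algebra
  then show "vfield A C \<sigma> Ra (e + h) $ 2 / (y * p\<^sup>2) = - u - v - w - u * w" using p(1) y(1) by simp
  have "vfield A C \<sigma> Ra (e + h) $ 3 = y * p * (u + p\<^sup>2 * v - w + p\<^sup>2 * (u * v))"
    unfolding vfield_nth vector_add_component e h by algebra
  then show "vfield A C \<sigma> Ra (e + h) $ 3 / (y * p) = u + p\<^sup>2 * v - w + p\<^sup>2 * (u * v)" using p(1) y(1) by simp
qed

lemma nontrivial_equilibrium_stability:
  assumes pos: "A > 0" "C > 0" "\<sigma> > 0" and y: "y > 0" "A * y\<^sup>2 + C * y = \<sigma>"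
    and p: "p \<noteq> 0" "p\<^sup>2 = Ra / y - 1" and e: "e $ 1 = p" "e $ 2 = y" "e $ 3 = p * y"
  shows "p\<^sup>2 * (\<sigma> - 2 - \<sigma> * (A * y\<^sup>2)) < (\<sigma> + 1) * (\<sigma> + 2) \<Longrightarrow> exponentially_stable (vfield A C \<sigma> Ra) e"
    and "p\<^sup>2 * (\<sigma> - 2 - \<sigma> * (A * y\<^sup>2)) > (\<sigma> + 1) * (\<sigma> + 2) \<Longrightarrow> \<not> asymptotically_stable (vfield A C \<sigma> Ra) e"
    and "p\<^sup>2 * (\<sigma> - 2 - \<sigma> * (A * y\<^sup>2)) = (\<sigma> + 1) * (\<sigma> + 2) \<Longrightarrow> \<not> asymptotically_stable (vfield A C \<sigma> Ra) e"
proof -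
  let ?f = "vfield A C \<sigma> Ra" and ?J = "vfield_jacobian A C \<sigma> e"
  \<comment> \<open>Coefficients of the characteristic polynomial of the Jacobian at
    \<open>e\<close>; \<open>a * b - c\<close> is the difference of the two sides of the stability
    condition.\<close>
  define a b c where "a = \<sigma> + 2" and "b = \<sigma> + 1 + p\<^sup>2 * (1 + A * y\<^sup>2)" and "c = 2 * p\<^sup>2 * (\<sigma> + A * y\<^sup>2)"
  have p2: "p\<^sup>2 > 0" using p(1) by simp
  have Ay: "A * y\<^sup>2 > 0" using pos y by simp
  have abc: "a > 0" "b > 0" "c > 0" using pos p2 Ay by (auto simp: a_def b_def c_def intro!: add_pos_pos mult_pos_pos)
  have ab: "a * b - c = (\<sigma> + 1) * (\<sigma> + 2) - p\<^sup>2 * (\<sigma> - 2 - \<sigma> * (A * y\<^sup>2))"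
    unfolding a_def b_def c_def by algebra
  have fe: "?f e = 0"
  proof -
    have Ra: "Ra = y * (p\<^sup>2 + 1)" using y p by simp
    have "?f e $ 1 = 0" unfolding vfield_nth e y(2)[symmetric] by algebra
    moreover have "?f e $ 2 = 0" unfolding vfield_nth e Ra by algebra
    moreover have "?f e $ 3 = 0" unfolding vfield_nth e by algebra
    ultimately show ?thesis by (simp add: vec3_eq_iff)
  qed
  have char: "?J (?J (?J h)) $ 1 = - a * ?J (?J h) $ 1 - b * ?J h $ 1 - c * h $ 1" for h
    unfolding a_def b_def c_def vfield_jacobian_nth e y(2)[symmetric] by algebra
  \<comment> \<open>The entry of the Jacobian through which the third coordinate drives the first.
    Its positivity makes the first coordinate an observable: it and its first two derivatives along
    the linear flow determine \<open>h\<close>.\<close>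
  define B where "B = A * y + C"
  have B: "B > 0" using pos y by (simp add: B_def add_pos_pos)
  have J1: "?J h $ 1 = B * h $ 3 + A * p * y * h $ 2 - \<sigma> * h $ 1" for h
    unfolding vfield_jacobian_nth e B_def by algebra
  have obs: "h = 0" if h: "h $ 1 = 0" "?J h $ 1 = 0" "?J (?J h) $ 1 = 0" for h
  proof -
    have h3: "B * h $ 3 = - (A * p * y * h $ 2)" using h(1,2) unfolding J1 by simp
    have "B * (- h $ 3 + p * h $ 2) + A * p * y * (- p * h $ 3 - h $ 2) = 0"
      using h(3) unfolding J1[of "?J h"] h(2) by (simp add: vfield_jacobian_nth e h(1) algebra_simps)
    then have "p * (B * h $ 2 - A * p * y * h $ 3) = 0" using h3 by algebra
    then have h2: "B * h $ 2 = A * p * y * h $ 3" using p by simp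
    have "(B\<^sup>2 + (A * p * y)\<^sup>2) * h $ 2 = 0" using h2 h3 by algebra
    moreover have "B\<^sup>2 + (A * p * y)\<^sup>2 > 0" using B by (intro add_pos_nonneg) auto
    ultimately have "h $ 2 = 0" by (metis less_irrefl mult_eq_0_iff)
    then show ?thesis using h3 h(1) B by (simp add: vec3_eq_iff)
  qed
  show "exponentially_stable ?f e" if "p\<^sup>2 * (\<sigma> - 2 - \<sigma> * (A * y\<^sup>2)) < (\<sigma> + 1) * (\<sigma> + 2)"
    by (rule routh_hurwitz_cubic_stable[where f = ?f and e = e, OF fe vfield_has_derivative linear_nth3[of 1] abc _ char obs])
       (use that ab in auto)
  \<comment> \<open>\<open>axis 3 1\<close> has first coordinate 0, while its image under the
    Jacobian has first coordinate \<open>B > 0\<close>.\<close>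
  show "\<not> asymptotically_stable ?f e" if "p\<^sup>2 * (\<sigma> - 2 - \<sigma> * (A * y\<^sup>2)) > (\<sigma> + 1) * (\<sigma> + 2)"
    by (rule routh_hurwitz_cubic_unstable[where f = ?f and e = e, OF fe vfield_has_derivative linear_nth3[of 1] vfield_lipschitz abc _ char obs,
          where k = "axis 3 1"])
       (use that ab B in \<open>auto simp: J1 axis_def\<close>)
  show "\<not> asymptotically_stable ?f e" if hopf: "p\<^sup>2 * (\<sigma> - 2 - \<sigma> * (A * y\<^sup>2)) = (\<sigma> + 1) * (\<sigma> + 2)"
  proof -
    \<comment> \<open>With this parameter the Hopf relation can be divided by
      \<open>\<sigma>\<close>, and both \<open>p\<^sup>2\<close> and
      \<open>A * y\<^sup>2 * p\<^sup>2\<close> become polynomials in \<open>\<sigma>\<close> and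
      \<open>\<rho>\<close>.\<close>
    define \<rho> where "\<rho> = (p\<^sup>2 + 1) / \<sigma>"
    have P: "p\<^sup>2 = \<sigma> * \<rho> - 1" using pos by (simp add: \<rho>_def)
    have \<rho>0: "\<rho> > 0" unfolding \<rho>_def by (intro divide_pos_pos add_pos_pos pos p2) simp
    have "\<sigma> * (A * y\<^sup>2 * p\<^sup>2) = p\<^sup>2 * (\<sigma> - 2) - (\<sigma> + 1) * (\<sigma> + 2)" using hopf by algebra
    also have "\<dots> = \<sigma> * (\<rho> * (\<sigma> - 2) - \<sigma> - 4)" unfolding P by algebra
    finally have \<mu>: "A * y\<^sup>2 * p\<^sup>2 = \<rho> * (\<sigma> - 2) - \<sigma> - 4" using pos by simp
    \<comment> \<open>This is the positivity of \<open>A * y\<^sup>2 * p\<^sup>2\<close>; as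
      \<open>\<rho> > 0\<close>, it forces \<open>\<sigma> > 2\<close>, so a Hopf point exists only
      there.\<close>
    have "\<rho> * (\<sigma> - 2) \<ge> \<sigma> + 4" using \<mu> Ay p2 by (smt (verit) mult_pos_pos)
    moreover from this have s2: "\<sigma> > 2" using \<rho>0 pos by (smt (verit) mult_nonneg_nonpos)
    ultimately have bnd: "\<sigma> > 2" "\<rho> * (\<sigma> - 2) \<ge> \<sigma> + 4" by blast+
    define D where "D = \<sigma> ^ 2 + 2 * \<sigma> * \<rho> + 4 * \<sigma> - 2 * \<rho>"
    have "2 * (\<sigma> * \<rho>) > 2 * (1 * \<rho>)" using s2 \<rho>0 by (intro mult_strict_left_mono mult_strict_right_mono) auto
    moreover have "D = \<sigma> ^ 2 + 4 * \<sigma> + (2 * (\<sigma> * \<rho>) - 2 * (1 * \<rho>))" by (simp add: D_def)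
    moreover have "\<sigma> ^ 2 > 0" using pos by simp
    ultimately have D0: "D > 0" using pos by linarith
    define F where "F = (\<lambda>u v w. (\<rho> * u + (\<sigma> + 3 * \<rho> + 4) * v + (\<sigma> + \<rho> + 4) * w) / (\<rho> * D\<^sup>2))"
    define G where "G = (\<lambda>u v w. (- (\<sigma> + 2) * \<rho> * u + (\<sigma> * \<rho> - \<rho> - 2) * (\<sigma> + 2 * \<rho> + 4) * v
      + (\<sigma> * \<rho> - 2 * \<sigma> - 4 * \<rho> - 8) * w) / (\<rho> * D\<^sup>2))"
    define H where "H = (\<lambda>u v w. (- \<sigma> * u - (\<sigma> + 2) * v + (\<sigma> - 2) * w) / D\<^sup>2)"
    define lift where "lift K h = K (h $ 1 / p) (h $ 2 / (y * p\<^sup>2)) (h $ 3 / (y * p))"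
      for K :: "real \<Rightarrow> real \<Rightarrow> real \<Rightarrow> real" and h :: "real^3"
    have lin: "linear (lift F)" "linear (lift G)" "linear (lift H)"
      using D0 \<rho>0 p(1) y(1) unfolding lift_def F_def G_def H_def
      by (auto simp: linear_iff field_simps)
    \<comment> \<open>\<open>D\<close> times the basis vector \<open>(-2, 1, -1)\<close>,
      transported back to the unscaled variables; its normal-form coordinates are
      \<open>(0, 1, 0)\<close>.\<close>
    define v :: "real^3" where "v = vector [- 2 * D * p, D * (y * p\<^sup>2), - D * (y * p)]"
    have v: "v $ 1 / p = - 2 * D" "v $ 2 / (y * p\<^sup>2) = D" "v $ 3 / (y * p) = - D"
      using p(1) y(1) by (simp_all add: v_def)
    have "- (\<sigma> + 2) * \<rho> * (- 2 * D) + (\<sigma> * \<rho> - \<rho> - 2) * (\<sigma> + 2 * \<rho> + 4) * D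
        + (\<sigma> * \<rho> - 2 * \<sigma> - 4 * \<rho> - 8) * (- D) = \<rho> * D\<^sup>2"
      unfolding D_def by algebra
    then have Gv: "lift G v = 1" unfolding lift_def v G_def using \<rho>0 D0 by simp
    have "\<rho> * (- 2 * D) + (\<sigma> + 3 * \<rho> + 4) * D + (\<sigma> + \<rho> + 4) * (- D) = 0" by algebra
    then have Fv: "lift F v = 0" unfolding lift_def v F_def by simp
    have "- \<sigma> * (- 2 * D) - (\<sigma> + 2) * D + (\<sigma> - 2) * (- D) = 0" by algebra
    then have Hv: "lift H v = 0" unfolding lift_def v H_def by simp
    have \<beta>0: "2 * (\<sigma> * \<rho> - \<rho> - 2) > 0"
      using bnd \<rho>0 by (simp add: algebra_simps)
    have \<rho>ne: "\<rho> \<noteq> 0" and Dne: "D \<noteq> 0" and \<nu>0: "\<sigma> + 2 > 0" using \<rho>0 D0 pos by auto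
    \<comment> \<open>Each \<open>refl\<close> replaces a coefficient by its explicit polynomial, so
      the normal form and the positivity lemma refer to the same numbers.\<close>
    note nf = hopf_normal_form[OF \<rho>ne Dne D_def \<mu> P refl refl F_def G_def H_def
        refl refl refl refl refl refl refl refl refl refl refl refl refl refl refl refl refl refl
        vfield_scaled_deviation[OF y p e refl refl refl],
        folded lift_def[of F] lift_def[of G] lift_def[of H]]
    show ?thesis
      by (rule subcritical_hopf_not_asymptotically_stable[OF vfield_lipschitz lin \<beta>0 \<nu>0 nf Fv Gv Hv])
         (rule hopf_first_lyapunov_coefficient_pos[OF bnd refl refl
            refl refl refl refl refl refl refl refl refl refl refl refl refl])
  qed
qed

text \<open>After \<open>\<sigma>\<close> is replaced by \<open>A * y\<^sup>2 + C * y\<close> both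
  sides are polynomials in \<open>A\<close>, \<open>C\<close>, \<open>y\<close>. Where
  \<open>d = \<sigma> - 2 - \<sigma> * (A * y\<^sup>2)\<close> is nonzero, this identifies R/L as y
  (1 + (\<sigma> + 1)(\<sigma> + 2) / d), the value of \<open>Ra\<close> at which p^2 d = (\<sigma>
  + 1)(\<sigma> + 2).\<close>

lemma L_R_coef_eq:
  assumes y: "y > 0" "A * y\<^sup>2 + C * y = \<sigma>" and sq: "sqrt (C\<^sup>2 + 4 * A * \<sigma>) = 2 * A * y + C"
  shows "y ^ 3 * L_coef A \<sigma> C = 2 * \<sigma> ^ 3 * (\<sigma> - 2 - \<sigma> * (A * y\<^sup>2))"
    and "y\<^sup>2 * R_coef A \<sigma> C = 2 * \<sigma> ^ 3 * (\<sigma> - 2 - \<sigma> * (A * y\<^sup>2) + (\<sigma> + 1) * (\<sigma> + 2))"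
proof -
  have sq': "sqrt (4 * A * \<sigma> + C\<^sup>2) = 2 * A * y + C" using sq by (simp add: add.commute)
  show "y ^ 3 * L_coef A \<sigma> C = 2 * \<sigma> ^ 3 * (\<sigma> - 2 - \<sigma> * (A * y\<^sup>2))"
    unfolding L_coef_def sq' unfolding y(2)[symmetric] by algebra
  show "y\<^sup>2 * R_coef A \<sigma> C = 2 * \<sigma> ^ 3 * (\<sigma> - 2 - \<sigma> * (A * y\<^sup>2) + (\<sigma> + 1) * (\<sigma> + 2))"
    unfolding R_coef_def sq' unfolding y(2)[symmetric] by algebra
qed

text \<open>For \<open>d > 0\<close> the condition is an upper bound on \<open>p\<^sup>2\<close>,
  hence on \<open>Ra\<close>; for \<open>d \<le> 0\<close> its left side is at most 0 and its right
  side positive, so it holds for every \<open>Ra\<close>.\<close>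

lemma stability_criterion_iff:
  assumes pos: "A > 0" "C > 0" "\<sigma> > 0" and p: "p\<^sup>2 = Ra / Ra_star A C \<sigma> - 1"
  shows "L_coef A \<sigma> C \<le> 0 \<or> (L_coef A \<sigma> C > 0 \<and> Ra < Ra_star_star A C \<sigma>) \<longleftrightarrow>
    p\<^sup>2 * (\<sigma> - 2 - \<sigma> * (A * (Ra_star A C \<sigma>)\<^sup>2)) < (\<sigma> + 1) * (\<sigma> + 2)"
proof -
  let ?y = "Ra_star A C \<sigma>"
  define d where "d = \<sigma> - 2 - \<sigma> * (A * ?y\<^sup>2)"
  note y = Ra_star_root[OF pos]
  have L: "?y ^ 3 * L_coef A \<sigma> C = 2 * \<sigma> ^ 3 * d" and R: "?y\<^sup>2 * R_coef A \<sigma> C = 2 * \<sigma> ^ 3 * (d + (\<sigma> + 1) * (\<sigma> + 2))"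
    unfolding d_def by (rule L_R_coef_eq[OF y])+
  have "L_coef A \<sigma> C = 2 * \<sigma> ^ 3 * d / ?y ^ 3" using L y(1) by (simp add: field_simps)
  then have sgn: "L_coef A \<sigma> C > 0 \<longleftrightarrow> d > 0" using pos y(1) by (simp add: zero_less_divide_iff zero_less_mult_iff)
  show ?thesis
  proof (cases "d > 0")
    case True
    then have L0: "L_coef A \<sigma> C > 0" using sgn by simp
    have "Ra < Ra_star_star A C \<sigma> \<longleftrightarrow> Ra * L_coef A \<sigma> C < R_coef A \<sigma> C"
      using L0 by (simp add: Ra_star_star_def pos_less_divide_eq)
    also have "\<dots> \<longleftrightarrow> ?y ^ 3 * (Ra * L_coef A \<sigma> C) < ?y ^ 3 * R_coef A \<sigma> C" using y(1) by simp
    also have "?y ^ 3 * (Ra * L_coef A \<sigma> C) = 2 * \<sigma> ^ 3 * (Ra * d)" using L by algebra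
    also have "?y ^ 3 * R_coef A \<sigma> C = 2 * \<sigma> ^ 3 * (?y * (d + (\<sigma> + 1) * (\<sigma> + 2)))" using R by algebra
    also have "2 * \<sigma> ^ 3 * (Ra * d) < \<dots> \<longleftrightarrow> Ra * d < ?y * (d + (\<sigma> + 1) * (\<sigma> + 2))"
      using pos by simp
    also have "\<dots> \<longleftrightarrow> p\<^sup>2 * d < (\<sigma> + 1) * (\<sigma> + 2)"
      using y(1) by (simp add: p field_simps)
    finally show ?thesis using L0 by (simp add: d_def)
  next
    case False
    then have "L_coef A \<sigma> C \<le> 0" using sgn by simp
    moreover have "p\<^sup>2 * d \<le> 0" using False by (simp add: mult_nonneg_nonpos)
    moreover have "(\<sigma> + 1) * (\<sigma> + 2) > 0" using pos by simp
    ultimately show ?thesis by (simp add: d_def)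
  qed
qed

theorem proposition4p3:
  fixes A C \<sigma> Ra :: real
  assumes "A > 0" and "C > 0" and "\<sigma> > 0" and "Ra > 0"
  shows
    "(Ra \<noteq> Ra_star A C \<sigma> \<longrightarrow>
        (asymptotically_stable (vfield A C \<sigma> Ra) (E_zero Ra) \<longleftrightarrow> Ra < Ra_star A C \<sigma>)) \<and>
     (exponentially_stable (vfield A C \<sigma> Ra) (E_zero Ra) \<longleftrightarrow> Ra < Ra_star A C \<sigma>) \<and>
     (Ra > Ra_star A C \<sigma> \<longrightarrow>
        (\<forall>E \<in> {E_plus A C \<sigma> Ra, E_minus A C \<sigma> Ra}.
           (asymptotically_stable (vfield A C \<sigma> Ra) E \<longleftrightarrow>
              L_coef A \<sigma> C \<le> 0 \<or> (L_coef A \<sigma> C > 0 \<and> Ra < Ra_star_star A C \<sigma>)) \<and>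
           (exponentially_stable (vfield A C \<sigma> Ra) E \<longleftrightarrow>
              L_coef A \<sigma> C \<le> 0 \<or> (L_coef A \<sigma> C > 0 \<and> Ra < Ra_star_star A C \<sigma>))))"
proof -
  let ?f = "vfield A C \<sigma> Ra" and ?y = "Ra_star A C \<sigma>"
  note pos = assms(1-3)
  note exp_asym = exponentially_stable_imp_asymptotically_stable
  consider "Ra < ?y" "Ra * (A * Ra + C) < \<sigma>" | "Ra = ?y" "Ra * (A * Ra + C) = \<sigma>" | "Ra > ?y" "Ra * (A * Ra + C) > \<sigma>"
    using less_Ra_star_iff[OF assms] by linarith
  then have "(Ra \<noteq> ?y \<longrightarrow> (asymptotically_stable ?f (E_zero Ra) \<longleftrightarrow> Ra < ?y)) \<and>
      (exponentially_stable ?f (E_zero Ra) \<longleftrightarrow> Ra < ?y)"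
  proof cases
    case 1
    then have "exponentially_stable ?f (E_zero Ra)" using E_zero_exponentially_stable[OF assms] by blast
    then show ?thesis using 1 exp_asym by blast
  next
    \<comment> \<open>Here the asymptotic clause is vacuous and only exponential stability has to be
      refuted.\<close>
    case 2
    then show ?thesis using E_zero_not_exponentially_stable[OF assms] by simp
  next
    case 3
    then have "\<not> asymptotically_stable ?f (E_zero Ra)" using E_zero_not_asymptotically_stable[OF assms] by blast
    then show ?thesis using 3 exp_asym by (metis less_asym)
  qed
  moreover have "(asymptotically_stable ?f E \<longleftrightarrow>
        L_coef A \<sigma> C \<le> 0 \<or> (L_coef A \<sigma> C > 0 \<and> Ra < Ra_star_star A C \<sigma>)) \<and>
      (exponentially_stable ?f E \<longleftrightarrow>
        L_coef A \<sigma> C \<le> 0 \<or> (L_coef A \<sigma> C > 0 \<and> Ra < Ra_star_star A C \<sigma>))"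
    if Ra: "Ra > ?y" and E: "E \<in> {E_plus A C \<sigma> Ra, E_minus A C \<sigma> Ra}" for E
  proof -
    obtain p where p: "p\<^sup>2 = Ra / ?y - 1" and e: "E $ 1 = p" "E $ 2 = ?y" "E $ 3 = p * ?y"
      using E_plus_minus_form[OF pos Ra E] by metis
    note y = Ra_star_root(1,2)[OF pos]
    have "p\<^sup>2 > 0" using Ra y(1) by (simp add: p)
    then have p0: "p \<noteq> 0" by auto
    note st = nontrivial_equilibrium_stability[OF pos y p0 p e]
    \<comment> \<open>The two sides of the criterion are compared by trichotomy; in both cases where
      it fails, the loss of asymptotic stability entails that of exponential stability.\<close>
    show ?thesis
      unfolding stability_criterion_iff[OF pos p]
      using st exp_asym by (meson linorder_neqE_linordered_idom order_less_irrefl)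
  qed
  ultimately show ?thesis by blast
qed

end
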